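(* Let $A,B>0$ with $A\neq B$, let $0<x_0<1$, let $P_1,P_2\in\mathbb{R}$, let $g\in L^1([0,1])$ (extended by $0$ to $\mathbb{R}$), and let $a(x)=A\,H(x_0-x)+B\,H(x-x_0)$ and $P(x)=P_1+H(x-x_0)(P_2-P_1)$. Consider solutions, in the distributional sense defined in the context, of the problem $(a\cdot u)''+P\cdot u=g$ on $[0,1]$, $u(0)=u(1)=0$. (i) If $u\in\dot{\mathcal D}'([0,1])$ is a solution, then $u$ is a locally integrable function. (ii) If $u\in L^1_{\mathrm{loc}}$ is a solution, then $u\in C^1([0,1]\setminus\{x_0\})$ and $u$ has a jump discontinuity at $x=x_0$. Furthermore, $$A\,u(x_0-)=B\,u(x_0+)\qquad\text{and}\qquad A\,u'(x_0-)=B\,u'(x_0+).$$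
   Context: $H$ denotes the Heaviside function. $\dot{\mathcal D}'([0,1]):=\{v\in\mathcal D'(\mathbb{R}) : \operatorname{supp} v\subseteq[0,1]\}$. $f(x_0-)$ and $f(x_0+)$ denote the limits of $f$ at $x_0$ from the left and from the right. Model product: a model delta net is given by specifying $\varphi\in\mathcal D(\mathbb{R})$ with $\int\varphi=1$ and putting $\varphi_\varepsilon(x)=\varphi(x/\varepsilon)/\varepsilon$, $\varepsilon>0$. For $v,w\in\mathcal D'(\mathbb{R})$ the model product is $[v\cdot w]:=\lim_{\varepsilon\to0}(v*\varphi_\varepsilon)(w*\varphi_\varepsilon)$; it is said to exist if this limit exists in $\mathcal D'(\mathbb{R})$ for every model delta net and is independent of the choice of the model delta net. Solution: $u\in\dot{\mathcal D}'([0,1])$ is called a solution if the model product $[a\cdot u]$ exists in $\mathcal D'(\mathbb{R})$ (which implies that $[P\cdot u]$ exists as well) and the equation $([a\cdot u])''+[P\cdot u]=g$ holds in $\mathcal D'(\mathbb{R})$.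
   Formalization: "u has a jump discontinuity at x_0" is proved as: both one-sided limits exist and u(x_0-) ≠ u(x_0+) unless both are 0; the literal claim fails for g=0, u=0, which is a solution. *)

theory Defs
  imports "HOL-Analysis.Analysis"
begin

text \<open>
  Test functions and distributions on the real line have scalars in a type \<open>'a\<close> of sort
  \<open>{real_normed_field, euclidean_space}\<close>. Its models are the real and the complex
  numbers, so real-valued and complex-valued distributions are treated at the same time.
\<close>

section \<open>Test functions\<close>

definition nth_deriv :: "nat \<Rightarrow> (real \<Rightarrow> 'a::real_normed_vector) \<Rightarrow> real \<Rightarrow> 'a" where
  "nth_deriv n f = ((\<lambda>h x. vector_derivative h (at x)) ^^ n) f"

definition smooth :: "(real \<Rightarrow> 'a::real_normed_vector) \<Rightarrow> bool" where
  "smooth f \<longleftrightarrow> (\<forall>n x. nth_deriv n f differentiable (at x))"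

definition supp :: "(real \<Rightarrow> 'a::zero) \<Rightarrow> real set" where
  "supp f = closure {x. f x \<noteq> 0}"

definition test_fun :: "(real \<Rightarrow> 'a::real_normed_vector) \<Rightarrow> bool" where
  "test_fun \<phi> \<longleftrightarrow> smooth \<phi> \<and> compact (supp \<phi>)"


section \<open>Distributions\<close>

text \<open>
  A distribution is a functional whose values matter on test functions only. Accordingly, equality
  of distributions is \<open>dist_eq\<close>, not equality of functionals. Continuity is expressed
  by the usual seminorm estimates on test functions supported in a given compact set.
\<close>

type_synonym 'a functional = "(real \<Rightarrow> 'a) \<Rightarrow> 'a"

definition distribution :: "'a::{real_normed_field, euclidean_space} functional \<Rightarrow> bool" where
  "distribution T \<longleftrightarrow>
     (\<forall>\<phi> \<psi>. test_fun \<phi> \<longrightarrow> test_fun \<psi> \<longrightarrow> T (\<lambda>x. \<phi> x + \<psi> x) = T \<phi> + T \<psi>) \<and>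
     (\<forall>c \<phi>. test_fun \<phi> \<longrightarrow> T (\<lambda>x. c * \<phi> x) = c * T \<phi>) \<and>
     (\<forall>K. compact K \<longrightarrow> (\<exists>C m. \<forall>\<phi>. test_fun \<phi> \<longrightarrow> supp \<phi> \<subseteq> K \<longrightarrow>
        norm (T \<phi>) \<le> C * (\<Sum>k\<le>m. SUP x. norm (nth_deriv k \<phi> x))))"

definition dist_eq :: "'a::{real_normed_field, euclidean_space} functional \<Rightarrow> 'a functional \<Rightarrow> bool"
  where "dist_eq S T \<longleftrightarrow> (\<forall>\<psi>. test_fun \<psi> \<longrightarrow> S \<psi> = T \<psi>)"

definition dist_supp :: "'a::{real_normed_field, euclidean_space} functional \<Rightarrow> real set" where
  "dist_supp T = - \<Union>{U. open U \<and> (\<forall>\<phi>. test_fun \<phi> \<longrightarrow> supp \<phi> \<subseteq> U \<longrightarrow> T \<phi> = 0)}"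

definition dist_deriv ::
    "'a::{real_normed_field, euclidean_space} functional \<Rightarrow> 'a functional" where
  "dist_deriv T = (\<lambda>\<psi>. - T (nth_deriv 1 \<psi>))"

definition locally_integrable :: "(real \<Rightarrow> 'a::euclidean_space) \<Rightarrow> bool" where
  "locally_integrable f \<longleftrightarrow> (\<forall>K. compact K \<longrightarrow> f absolutely_integrable_on K)"

definition regular_dist ::
    "(real \<Rightarrow> 'a::{real_normed_field, euclidean_space}) \<Rightarrow> 'a functional" where
  "regular_dist f = (\<lambda>\<psi>. LINT x|lebesgue. f x * \<psi> x)"

text \<open>The space of all distributions on the line with support in the unit interval.\<close>

definition dot_dist01 :: "'a::{real_normed_field, euclidean_space} functional set" where
  "dot_dist01 = {v. distribution v \<and> dist_supp v \<subseteq> {0..1}}"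


section \<open>The model product\<close>

definition convol ::
    "'a::{real_normed_field, euclidean_space} functional \<Rightarrow> (real \<Rightarrow> 'a) \<Rightarrow> real \<Rightarrow> 'a" where
  "convol v \<phi> x = v (\<lambda>y. \<phi> (x - y))"

definition mollifier :: "(real \<Rightarrow> 'a::{real_normed_field, euclidean_space}) \<Rightarrow> bool" where
  "mollifier \<phi> \<longleftrightarrow> test_fun \<phi> \<and> (LINT x|lebesgue. \<phi> x) = 1"

definition delta_net ::
    "(real \<Rightarrow> 'a::{real_normed_field, euclidean_space}) \<Rightarrow> real \<Rightarrow> real \<Rightarrow> 'a" where
  "delta_net \<phi> \<epsilon> x = \<phi> (x / \<epsilon>) / of_real \<epsilon>"

text \<open>
  \<open>has_model_product v w T\<close> says that the model product of \<open>v\<close> and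
  \<open>w\<close> exists and equals \<open>T\<close>: one and the same distribution is the limit for
  all model delta nets.
\<close>

definition has_model_product :: "'a::{real_normed_field, euclidean_space} functional \<Rightarrow>
    'a functional \<Rightarrow> 'a functional \<Rightarrow> bool" where
  "has_model_product v w T \<longleftrightarrow> distribution T \<and>
     (\<forall>\<phi>. mollifier \<phi> \<longrightarrow> (\<forall>\<psi>. test_fun \<psi> \<longrightarrow>
        ((\<lambda>\<epsilon>. regular_dist
            (\<lambda>x. convol v (delta_net \<phi> \<epsilon>) x * convol w (delta_net \<phi> \<epsilon>) x) \<psi>)
          \<longlongrightarrow> T \<psi>) (at_right 0)))"


section \<open>The boundary value problem\<close>

text \<open>The value at 0 is immaterial, since only the induced distribution is used.\<close>

definition heaviside :: "real \<Rightarrow> real" where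
  "heaviside x = (if x < 0 then 0 else 1)"

definition coeff_a ::
    "real \<Rightarrow> real \<Rightarrow> real \<Rightarrow> real \<Rightarrow> 'a::{real_normed_field, euclidean_space}" where
  "coeff_a A B x0 x = of_real (A * heaviside (x0 - x) + B * heaviside (x - x0))"

definition coeff_P ::
    "real \<Rightarrow> real \<Rightarrow> real \<Rightarrow> real \<Rightarrow> 'a::{real_normed_field, euclidean_space}" where
  "coeff_P P1 P2 x0 x = of_real (P1 + heaviside (x - x0) * (P2 - P1))"

definition extend01 :: "(real \<Rightarrow> 'a::zero) \<Rightarrow> real \<Rightarrow> 'a" where
  "extend01 g x = (if x \<in> {0..1} then g x else 0)"

text \<open>
  The boundary conditions at 0 and 1 are not imposed separately: they are encoded by requiring the
  equation on the whole line for a distribution with support in the unit interval.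
  Existence of the product \<open>q\<close> is implied by existence of \<open>w\<close> when
  \<open>A \<noteq> B\<close>.
\<close>

definition is_solution :: "real \<Rightarrow> real \<Rightarrow> real \<Rightarrow> real \<Rightarrow> real \<Rightarrow>
    (real \<Rightarrow> 'a::{real_normed_field, euclidean_space}) \<Rightarrow> 'a functional \<Rightarrow> bool" where
  "is_solution A B x0 P1 P2 g u \<longleftrightarrow> u \<in> dot_dist01 \<and>
     (\<exists>w q. has_model_product (regular_dist (coeff_a A B x0)) u w \<and>
            has_model_product (regular_dist (coeff_P P1 P2 x0)) u q \<and>
            dist_eq (\<lambda>\<psi>. dist_deriv (dist_deriv w) \<psi> + q \<psi>) (regular_dist (extend01 g)))"

end

theory Submission
  imports Defs
begin

text \<open>
  Write \<open>w\<close> and \<open>q\<close> for the model products of \<open>u\<close> with the two step functions.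

  Away from \<open>x0\<close> the step functions are locally constant, so \<open>w\<close> and \<open>q\<close> are multiples of
  \<open>u\<close> there (\<open>model_product_local\<close>) and \<open>u\<close> solves \<open>A u'' + P1 u = g\<close> on the left and
  \<open>B u'' + P2 u = g\<close> on the right. Since \<open>u\<close> vanishes outside the unit interval, it must be the
  convolution of \<open>g\<close> with the causal fundamental solution issued from the respective end point
  (\<open>one_sided_solution\<close>). These convolutions are continuously differentiable on the whole line.
  Gluing them at \<open>x0\<close> gives a bounded function \<open>v\<close>, and \<open>u - v\<close> is supported in \<open>{x0}\<close>. By
  \<open>point_supported_distribution\<close>, \<open>u = v + \<Sum>k\<le>N. c k \<delta>\<^sup>(\<^sup>k\<^sup>)\<close>, up to signs.

  The existence of \<open>w\<close> excludes all derivatives of the delta distribution. Regularise with a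
  fixed real bump \<open>\<rho>\<close> with primitive \<open>\<Phi>\<close>. Tested with \<open>(x - x0)\<^sup>j\<close>, the \<open>k\<close>-th singular
  term of the product is \<open>\<epsilon>\<close> to the power \<open>j - k\<close> times
  the moment \<open>\<integral>z\<^sup>j (A + (B - A) \<Phi>(z)) \<rho>\<^sup>(\<^sup>k\<^sup>)(z) dz\<close>. For \<open>k \<ge> 1\<close> this moment is nonzero for \<open>j = 0\<close>
  if \<open>k\<close> is odd and for \<open>j = 1\<close> if \<open>k\<close> is even, because \<open>A \<noteq> B\<close> and integration by parts
  reduces it to a nonzero multiple of the squared \<open>L\<^sup>2\<close> norm of some derivative of \<open>\<rho>\<close>
  (\<open>nonzero_moment\<close>). Here \<open>j < k\<close>, so the term of highest order would diverge
  (\<open>top_coefficient_zero\<close>).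

  Hence \<open>u = v + c \<delta>\<close>, and the product of the step function with \<open>\<delta>\<close> is \<open>(A + B)/2 \<delta>\<close>. Insert
  this in the equation and integrate by parts on both sides of \<open>x0\<close> (\<open>one_sided_green_identity\<close>).
  The terms on \<open>\<delta>''\<close>, \<open>\<delta>'\<close> and \<open>\<delta>\<close> give \<open>c (A + B)/2 = 0\<close>, hence \<open>c = 0\<close>, and then the two
  transmission conditions. Finally \<open>u = v\<close> almost everywhere if \<open>u\<close> is a function, by the lemma
  of du Bois-Reymond.
\<close>

section \<open>Smooth functions\<close>

text \<open>Smoothness and the values of all iterated derivatives are established together, by
  exhibiting a sequence of functions each of which is the derivative of its predecessor.\<close>

lemma nth_deriv_0 [simp]: "nth_deriv 0 f = f"
  by (simp add: nth_deriv_def)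

lemma nth_deriv_Suc: "nth_deriv (Suc n) f = (\<lambda>x. vector_derivative (nth_deriv n f) (at x))"
  by (simp add: nth_deriv_def)

lemma nth_deriv_eqI:
  assumes "\<And>n x. (D n has_vector_derivative D (Suc n) x) (at x)"
  shows "nth_deriv n (D 0) = D n"
proof (induction n)
  case (Suc n)
  then show ?case
    using vector_derivative_at[OF assms] by (simp add: nth_deriv_Suc)
qed simp

lemma smoothI:
  assumes "\<And>n x. (D n has_vector_derivative D (Suc n) x) (at x)"
  shows "smooth (D 0)"
  unfolding smooth_def nth_deriv_eqI[of D, OF assms]
  using assms by (meson differentiableI_vector)

lemma smooth_nth_deriv:
  assumes "smooth f"
  shows "(nth_deriv n f has_vector_derivative nth_deriv (Suc n) f x) (at x)"
  using assms unfolding smooth_def nth_deriv_Suc by (simp add: vector_derivative_works)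

lemma smooth_deriv1: "smooth f \<Longrightarrow> (f has_vector_derivative nth_deriv 1 f x) (at x)"
  using smooth_nth_deriv[of f 0 x] by simp

lemma continuous_nth_deriv: "smooth f \<Longrightarrow> continuous_on S (nth_deriv n f)"
  by (meson continuous_at_imp_continuous_on has_vector_derivative_continuous smooth_nth_deriv)

lemma smooth_continuous: "smooth f \<Longrightarrow> continuous_on S f"
  using continuous_nth_deriv[of f S 0] by simp

lemma nth_deriv_nth_deriv: "nth_deriv m (nth_deriv n f) = nth_deriv (m + n) f"
  by (simp add: nth_deriv_def funpow_add)

lemma smooth_nth_deriv_smooth: "smooth f \<Longrightarrow> smooth (nth_deriv n f)"
  by (simp add: smooth_def nth_deriv_nth_deriv)

lemma
  assumes "smooth f" "smooth g"
  shows smooth_add: "smooth (\<lambda>x. f x + g x)"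
    and nth_deriv_add: "nth_deriv n (\<lambda>x. f x + g x) = (\<lambda>x. nth_deriv n f x + nth_deriv n g x)"
proof -
  let ?D = "\<lambda>n x. nth_deriv n f x + nth_deriv n g x"
  have *: "(?D n has_vector_derivative ?D (Suc n) x) (at x)" for n x
    by (intro has_vector_derivative_add smooth_nth_deriv assms)
  show "smooth (\<lambda>x. f x + g x)" using smoothI[of ?D, OF *] by simp
  show "nth_deriv n (\<lambda>x. f x + g x) = (\<lambda>x. nth_deriv n f x + nth_deriv n g x)"
    using nth_deriv_eqI[of ?D, OF *] by simp
qed

lemma
  assumes "smooth f" "bounded_linear h"
  shows smooth_linear: "smooth (\<lambda>x. h (f x))"
    and nth_deriv_linear: "nth_deriv n (\<lambda>x. h (f x)) = (\<lambda>x. h (nth_deriv n f x))"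
proof -
  let ?D = "\<lambda>n x. h (nth_deriv n f x)"
  have *: "(?D n has_vector_derivative ?D (Suc n) x) (at x)" for n x
    by (rule bounded_linear.has_vector_derivative[OF assms(2) smooth_nth_deriv[OF assms(1)]])
  show "smooth (\<lambda>x. h (f x))" using smoothI[of ?D, OF *] by simp
  show "nth_deriv n (\<lambda>x. h (f x)) = (\<lambda>x. h (nth_deriv n f x))"
    using nth_deriv_eqI[of ?D, OF *] by simp
qed

lemma
  fixes f :: "real \<Rightarrow> 'a::real_normed_vector"
  assumes "smooth f"
  shows smooth_affine: "smooth (\<lambda>x. f (a * x + b))"
    and nth_deriv_affine: "nth_deriv n (\<lambda>x. f (a * x + b)) = (\<lambda>x. a ^ n *\<^sub>R nth_deriv n f (a * x + b))"
proof -
  let ?D = "\<lambda>n x. a ^ n *\<^sub>R nth_deriv n f (a * x + b)"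
  have *: "(?D n has_vector_derivative ?D (Suc n) x) (at x)" for n x
  proof -
    have "((nth_deriv n f \<circ> (\<lambda>x. a * x + b)) has_vector_derivative
        a *\<^sub>R nth_deriv (Suc n) f (a * x + b)) (at x)"
      by (rule vector_diff_chain_at)
         (auto intro!: derivative_eq_intros smooth_nth_deriv assms simp: has_vector_derivative_mult_right)
    from bounded_linear.has_vector_derivative[OF bounded_linear_scaleR_right[of "a^n"] this]
    show ?thesis by (simp add: o_def mult.commute)
  qed
  show "smooth (\<lambda>x. f (a * x + b))" using smoothI[of ?D, OF *] by simp
  show "nth_deriv n (\<lambda>x. f (a * x + b)) = (\<lambda>x. a ^ n *\<^sub>R nth_deriv n f (a * x + b))"
    using nth_deriv_eqI[of ?D, OF *] by simp
qed

lemma leibniz_sum: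
  fixes u v :: "nat \<Rightarrow> 'a::real_normed_algebra"
  shows "(\<Sum>k\<le>n. real (n choose k) *\<^sub>R (u k * v (Suc (n - k)) + u (Suc k) * v (n - k)))
    = (\<Sum>k\<le>Suc n. real (Suc n choose k) *\<^sub>R (u k * v (Suc n - k)))"
proof -
  have "(\<Sum>k\<le>Suc n. real (Suc n choose k) *\<^sub>R (u k * v (Suc n - k)))
      = u 0 * v (Suc n) + (\<Sum>k\<le>n. real (Suc n choose Suc k) *\<^sub>R (u (Suc k) * v (n - k)))"
    by (simp add: sum.atMost_Suc_shift del: sum.atMost_Suc binomial_Suc_Suc)
  also have "\<dots> = u 0 * v (Suc n) + (\<Sum>k\<le>n. real (n choose Suc k) *\<^sub>R (u (Suc k) * v (n - k)))
      + (\<Sum>k\<le>n. real (n choose k) *\<^sub>R (u (Suc k) * v (n - k)))"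
    by (simp add: scaleR_left_distrib sum.distrib algebra_simps)
  also have "u 0 * v (Suc n) + (\<Sum>k\<le>n. real (n choose Suc k) *\<^sub>R (u (Suc k) * v (n - k)))
      = (\<Sum>k\<le>Suc n. real (n choose k) *\<^sub>R (u k * v (Suc n - k)))"
    by (simp add: sum.atMost_Suc_shift del: sum.atMost_Suc)
  also have "\<dots> = (\<Sum>k\<le>n. real (n choose k) *\<^sub>R (u k * v (Suc (n - k))))"
    by (simp add: Suc_diff_le)
  finally show ?thesis by (simp add: scaleR_right_distrib sum.distrib)
qed

lemma
  fixes f g :: "real \<Rightarrow> 'a::real_normed_algebra"
  assumes "smooth f" "smooth g"
  shows smooth_mult: "smooth (\<lambda>x. f x * g x)"
    and nth_deriv_mult: "nth_deriv n (\<lambda>x. f x * g x) =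
      (\<lambda>x. \<Sum>k\<le>n. real (n choose k) *\<^sub>R (nth_deriv k f x * nth_deriv (n - k) g x))"
proof -
  let ?D = "\<lambda>n x. \<Sum>k\<le>n. real (n choose k) *\<^sub>R (nth_deriv k f x * nth_deriv (n - k) g x)"
  have *: "(?D n has_vector_derivative ?D (Suc n) x) (at x)" for n x
  proof -
    have "(?D n has_vector_derivative
       (\<Sum>k\<le>n. real (n choose k) *\<^sub>R
          (nth_deriv k f x * nth_deriv (Suc (n - k)) g x + nth_deriv (Suc k) f x * nth_deriv (n - k) g x))) (at x)"
      by (intro has_vector_derivative_sum
          bounded_linear.has_vector_derivative[OF bounded_linear_scaleR_right]
          has_vector_derivative_mult smooth_nth_deriv assms)
    then show ?thesis
      unfolding leibniz_sum[of n "\<lambda>k. nth_deriv k f x" "\<lambda>k. nth_deriv k g x"] .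
  qed
  show "smooth (\<lambda>x. f x * g x)" using smoothI[of ?D, OF *] by simp
  show "nth_deriv n (\<lambda>x. f x * g x) =
      (\<lambda>x. \<Sum>k\<le>n. real (n choose k) *\<^sub>R (nth_deriv k f x * nth_deriv (n - k) g x))"
    using nth_deriv_eqI[of ?D, OF *] by simp
qed

lemma smooth_const: "smooth (\<lambda>x. c)"
  using smoothI[of "\<lambda>n x. if n = 0 then c else 0"] by simp

lemma nth_deriv_of_real:
  assumes "smooth f"
  shows "nth_deriv n (\<lambda>x. of_real (f x) :: 'a::real_normed_algebra_1) = (\<lambda>x. of_real (nth_deriv n f x))"
  by (rule nth_deriv_linear[OF assms bounded_linear_of_real])

lemma nth_deriv_cong_open:
  assumes "open U" "x \<in> U" "\<And>y. y \<in> U \<Longrightarrow> f y = g y"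
  shows "nth_deriv n f x = nth_deriv n g x"
  using assms(2)
proof (induction n arbitrary: x)
  case (Suc n)
  have "eventually (\<lambda>y. nth_deriv n f y = nth_deriv n g y) (nhds x)"
    using assms(1) Suc by (auto simp: eventually_nhds)
  then show ?case unfolding nth_deriv_Suc
    by (intro vector_derivative_cong_eq) (auto simp: Suc)
qed (use assms in auto)

lemma nth_deriv_eq_0_open:
  assumes "open U" "x \<in> U" "\<And>y. y \<in> U \<Longrightarrow> f y = 0"
  shows "nth_deriv n f x = 0"
proof -
  have "nth_deriv n f x = nth_deriv n (\<lambda>x. 0) x"
    using nth_deriv_cong_open[OF assms(1,2), of f "\<lambda>x. 0"] assms(3) by simp
  also have "nth_deriv n (\<lambda>x. 0) = (\<lambda>x::real. 0)"
    using nth_deriv_eqI[of "\<lambda>n x. 0"] by simp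
  finally show ?thesis by simp
qed

section \<open>Test functions\<close>

lemma supp_subsetI: "closed C \<Longrightarrow> (\<And>x. x \<notin> C \<Longrightarrow> f x = 0) \<Longrightarrow> supp f \<subseteq> C"
  unfolding supp_def by (rule closure_minimal) auto

lemma supp_0: "x \<notin> supp f \<Longrightarrow> f x = 0"
  using closure_subset[of "{x. f x \<noteq> 0}"] unfolding supp_def by blast

lemma closed_supp: "closed (supp f)"
  by (simp add: supp_def)

lemma test_fun_iff:
  "test_fun f \<longleftrightarrow> smooth f \<and> (\<exists>R. \<forall>x. \<bar>x\<bar> > R \<longrightarrow> f x = 0)"
proof -
  have "compact (supp f) \<longleftrightarrow> (\<exists>R. \<forall>x. \<bar>x\<bar> > R \<longrightarrow> f x = 0)"
  proof
    assume "compact (supp f)"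
    then obtain R where "\<forall>x\<in>supp f. norm x \<le> R"
      using bounded_iff compact_imp_bounded by blast
    then show "\<exists>R. \<forall>x. \<bar>x\<bar> > R \<longrightarrow> f x = 0"
      using supp_0[of _ f] by (metis not_le real_norm_def)
  next
    assume "\<exists>R. \<forall>x. \<bar>x\<bar> > R \<longrightarrow> f x = 0"
    then obtain R where R: "\<forall>x. \<bar>x\<bar> > R \<longrightarrow> f x = 0" by blast
    have "supp f \<subseteq> {-R..R}"
      by (rule supp_subsetI) (use R in auto)
    then show "compact (supp f)"
      using closed_supp compact_Icc compact_Int_closed by (metis inf.absorb_iff2)
  qed
  then show ?thesis by (simp add: test_fun_def)
qed

lemma test_funI: "smooth f \<Longrightarrow> (\<And>x. \<bar>x\<bar> > R \<Longrightarrow> f x = 0) \<Longrightarrow> test_fun f"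
  by (auto simp: test_fun_iff)

lemma test_fun_smooth: "test_fun f \<Longrightarrow> smooth f"
  by (simp add: test_fun_def)

lemma test_fun_radius:
  assumes "test_fun f"
  obtains R where "R > 0" "\<And>x n. \<bar>x\<bar> > R \<Longrightarrow> nth_deriv n f x = 0"
proof -
  obtain R where R: "\<forall>x. \<bar>x\<bar> > R \<longrightarrow> f x = 0"
    using assms by (auto simp: test_fun_iff)
  have "nth_deriv n f x = 0" if "\<bar>x\<bar> > max R 1" for n x
  proof (rule nth_deriv_eq_0_open[of "- {-R..R}"])
    show "open (- {-R..R})" by (simp add: open_Compl)
  qed (use R that in auto)
  then show ?thesis using that[of "max R 1"] by auto
qed

lemma test_fun_nth_deriv: "test_fun f \<Longrightarrow> test_fun (nth_deriv n f)"
  by (meson smooth_nth_deriv_smooth test_funI test_fun_radius test_fun_smooth)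

lemma supp_nth_deriv: "supp (nth_deriv n f) \<subseteq> supp f"
proof (rule supp_subsetI[OF closed_supp])
  fix x assume "x \<notin> supp f"
  then show "nth_deriv n f x = 0"
    by (intro nth_deriv_eq_0_open[of "- supp f"]) (auto simp: closed_supp open_Compl supp_0)
qed

lemma test_fun_add: "test_fun f \<Longrightarrow> test_fun g \<Longrightarrow> test_fun (\<lambda>x. f x + g x)"
proof -
  assume f: "test_fun f" and g: "test_fun g"
  obtain R where "R > 0" and R: "\<And>x n. \<bar>x\<bar> > R \<Longrightarrow> nth_deriv n f x = 0" using test_fun_radius[OF f] by metis
  obtain S where "S > 0" and S: "\<And>x n. \<bar>x\<bar> > S \<Longrightarrow> nth_deriv n g x = 0" using test_fun_radius[OF g] by metis
  show ?thesis
  proof (rule test_funI)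
    show "f x + g x = 0" if "\<bar>x\<bar> > max R S" for x
      using R[of x 0] S[of x 0] that by simp
  qed (intro smooth_add test_fun_smooth f g)
qed

lemma test_fun_linear:
  assumes "test_fun f" "bounded_linear h" shows "test_fun (\<lambda>x. h (f x))"
proof -
  obtain R where "R > 0" and R: "\<And>x n. \<bar>x\<bar> > R \<Longrightarrow> nth_deriv n f x = 0" using test_fun_radius[OF assms(1)] by metis
  show ?thesis
    by (rule test_funI[of _ R])
       (use R[of _ 0] in \<open>auto intro: smooth_linear test_fun_smooth assms
         simp: linear_simps[OF assms(2)]\<close>)
qed

lemma test_fun_mult_left: "test_fun f \<Longrightarrow> test_fun (\<lambda>x. c * f x)"
  for c :: "'a::real_normed_algebra"
  by (rule test_fun_linear) (auto intro: bounded_linear_mult_right)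

lemma test_fun_scaleR: "test_fun f \<Longrightarrow> test_fun (\<lambda>x. c *\<^sub>R f x)"
  by (rule test_fun_linear) (auto intro: bounded_linear_scaleR_right)

lemma test_fun_minus: "test_fun f \<Longrightarrow> test_fun (\<lambda>x. - f x)"
  by (rule test_fun_linear) (auto intro: bounded_linear_minus bounded_linear_ident)

lemma test_fun_diff: "test_fun f \<Longrightarrow> test_fun g \<Longrightarrow> test_fun (\<lambda>x. f x - g x)"
  using test_fun_add[OF _ test_fun_minus, of f g] by simp

lemma test_fun_0: "test_fun (\<lambda>x. 0)"
  by (rule test_funI[OF smooth_const]) auto

lemma test_fun_sum:
  "(\<And>i. i \<in> I \<Longrightarrow> test_fun (f i)) \<Longrightarrow> test_fun (\<lambda>x. \<Sum>i\<in>I. f i x)"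
  by (induction I rule: infinite_finite_induct) (auto intro: test_fun_add test_fun_0)

lemma test_fun_mult_smooth:
  fixes f g :: "real \<Rightarrow> 'a::real_normed_algebra"
  assumes "smooth f" "test_fun g" shows "test_fun (\<lambda>x. f x * g x)"
proof -
  obtain R where "R > 0" and R: "\<And>x n. \<bar>x\<bar> > R \<Longrightarrow> nth_deriv n g x = 0" using test_fun_radius[OF assms(2)] by metis
  show ?thesis
    by (rule test_funI[of _ R]) (use R[of _ 0] in \<open>auto intro: smooth_mult test_fun_smooth assms\<close>)
qed

lemma test_fun_of_real: "test_fun f \<Longrightarrow> test_fun (\<lambda>x. of_real (f x) :: 'a::real_normed_algebra_1)"
  by (rule test_fun_linear[OF _ bounded_linear_of_real])

lemma test_fun_affine:
  assumes "test_fun f" "a \<noteq> 0" shows "test_fun (\<lambda>x. f (a * x + b))"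
proof -
  obtain R where "R > 0" and R: "\<And>x n. \<bar>x\<bar> > R \<Longrightarrow> nth_deriv n f x = 0" using test_fun_radius[OF assms(1)] by metis
  show ?thesis
  proof (rule test_funI)
    show "smooth (\<lambda>x. f (a * x + b))" by (intro smooth_affine test_fun_smooth assms)
    show "f (a * x + b) = 0" if "\<bar>x\<bar> > (R + \<bar>b\<bar>) / \<bar>a\<bar>" for x
    proof -
      have "R + \<bar>b\<bar> < \<bar>a * x\<bar>" using that assms(2) by (simp add: abs_mult field_simps)
      then have "\<bar>a * x + b\<bar> > R" by linarith
      then show ?thesis using R[of _ 0] by simp
    qed
  qed
qed

lemma test_fun_bounded:
  fixes f :: "real \<Rightarrow> 'a::real_normed_vector"
  assumes "test_fun f"
  obtains M where "M > 0" "\<And>x. norm (nth_deriv n f x) \<le> M"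
proof -
  obtain R where "R > 0" and R: "\<And>x n. \<bar>x\<bar> > R \<Longrightarrow> nth_deriv n f x = 0" using test_fun_radius[OF assms] by metis
  have "bounded (nth_deriv n f ` {-R..R})"
    by (intro compact_imp_bounded compact_continuous_image continuous_nth_deriv test_fun_smooth assms compact_Icc)
  then obtain M where M: "M > 0" "\<And>x. x \<in> {-R..R} \<Longrightarrow> norm (nth_deriv n f x) \<le> M"
    unfolding bounded_pos by auto
  have "norm (nth_deriv n f x) \<le> M" for x
    using M R[of x n] by (cases "x \<in> {-R..R}") auto
  then show ?thesis using that M by blast
qed

text \<open>Cutoffs, mollified test functions, primitives in the parameter and solutions of the adjoint
  differential equation are all integrals of this form.\<close>

lemma
  fixes k :: "real \<Rightarrow> 'a::{real_normed_field, euclidean_space}"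
  assumes k: "continuous_on {a..b} k" and \<psi>: "test_fun \<psi>" and \<alpha>: "\<alpha> \<noteq> 0"
  shows test_fun_integral: "test_fun (\<lambda>y. integral {a..b} (\<lambda>s. k s * \<psi> (\<alpha> * y + \<beta> * s)))"
    and nth_deriv_integral: "nth_deriv n (\<lambda>y. integral {a..b} (\<lambda>s. k s * \<psi> (\<alpha> * y + \<beta> * s))) =
       (\<lambda>y. \<alpha> ^ n *\<^sub>R integral {a..b} (\<lambda>s. k s * nth_deriv n \<psi> (\<alpha> * y + \<beta> * s)))"
proof -
  let ?D = "\<lambda>n y. \<alpha> ^ n *\<^sub>R integral {a..b} (\<lambda>s. k s * nth_deriv n \<psi> (\<alpha> * y + \<beta> * s))"
  have *: "(?D n has_vector_derivative ?D (Suc n) y) (at y)" for n y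
  proof -
    have cont: "continuous_on S (\<lambda>p. nth_deriv n \<psi> (\<alpha> * fst p + \<beta> * snd p))" for n and S :: "(real \<times> real) set"
      by (rule continuous_on_compose2[OF continuous_nth_deriv[OF test_fun_smooth[OF \<psi>], of UNIV]])
         (auto intro!: continuous_intros)
    have cont1: "continuous_on S (\<lambda>s. nth_deriv n \<psi> (\<alpha> * y + \<beta> * s))" for n y and S :: "real set"
      by (rule continuous_on_compose2[OF continuous_nth_deriv[OF test_fun_smooth[OF \<psi>], of UNIV]])
         (auto intro!: continuous_intros)
    have "((\<lambda>y. integral (cbox a b) (\<lambda>s. k s * nth_deriv n \<psi> (\<alpha> * y + \<beta> * s))) has_vector_derivative
       integral (cbox a b) (\<lambda>s. k s * (\<alpha> *\<^sub>R nth_deriv (Suc n) \<psi> (\<alpha> * y + \<beta> * s)))) (at y within UNIV)"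
    proof (rule leibniz_rule_vector_derivative)
      fix y t
      have "((\<lambda>y. nth_deriv n \<psi> (\<alpha> * y + \<beta> * t)) has_vector_derivative
             \<alpha> *\<^sub>R nth_deriv (Suc n) \<psi> (\<alpha> * y + \<beta> * t)) (at y)"
        using smooth_nth_deriv[OF smooth_affine[OF smooth_nth_deriv_smooth[OF test_fun_smooth[OF \<psi>]]], of 0 n \<alpha> "\<beta> * t" y]
        by (simp add: nth_deriv_affine[OF smooth_nth_deriv_smooth[OF test_fun_smooth[OF \<psi>]]] nth_deriv_nth_deriv)
      from bounded_linear.has_vector_derivative[OF bounded_linear_mult_right this, of "k t"]
      show "((\<lambda>y. k t * nth_deriv n \<psi> (\<alpha> * y + \<beta> * t)) has_vector_derivative
             k t * (\<alpha> *\<^sub>R nth_deriv (Suc n) \<psi> (\<alpha> * y + \<beta> * t))) (at y within UNIV)" by simp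
    next
      show "(\<lambda>s. k s * nth_deriv n \<psi> (\<alpha> * y + \<beta> * s)) integrable_on cbox a b" for y
        by (intro integrable_continuous continuous_intros cont1) (use k in auto)
      have "continuous_on (UNIV \<times> cbox a b) (\<lambda>p. k (snd p))"
        by (rule continuous_on_compose2[OF k]) (auto intro!: continuous_intros)
      then show "continuous_on (UNIV \<times> cbox a b) (\<lambda>(y, s). k s * (\<alpha> *\<^sub>R nth_deriv (Suc n) \<psi> (\<alpha> * y + \<beta> * s)))"
        by (auto simp: split_beta intro!: continuous_intros cont)
    qed auto
    from bounded_linear.has_vector_derivative[OF bounded_linear_scaleR_right this, of "\<alpha> ^ n"]
    show ?thesis by (simp add: mult.commute)
  qed
  show "nth_deriv n (\<lambda>y. integral {a..b} (\<lambda>s. k s * \<psi> (\<alpha> * y + \<beta> * s))) = ?D n"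
    using nth_deriv_eqI[of ?D, OF *] by simp
  have sm: "smooth (\<lambda>y. integral {a..b} (\<lambda>s. k s * \<psi> (\<alpha> * y + \<beta> * s)))"
    using smoothI[of ?D, OF *] by simp
  obtain R where "R > 0" and R: "\<And>x n. \<bar>x\<bar> > R \<Longrightarrow> nth_deriv n \<psi> x = 0" using test_fun_radius[OF \<psi>] by metis
  let ?r = "\<bar>\<beta>\<bar> * max \<bar>a\<bar> \<bar>b\<bar>"
  show "test_fun (\<lambda>y. integral {a..b} (\<lambda>s. k s * \<psi> (\<alpha> * y + \<beta> * s)))"
  proof (rule test_funI[OF sm])
    fix y assume y: "\<bar>y\<bar> > (R + ?r) / \<bar>\<alpha>\<bar>"
    have "\<psi> (\<alpha> * y + \<beta> * s) = 0" if "s \<in> {a..b}" for s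
    proof -
      have "\<bar>\<beta> * s\<bar> \<le> ?r" using that by (auto simp: abs_mult intro!: mult_left_mono)
      moreover have "R + ?r < \<bar>\<alpha> * y\<bar>" using y \<alpha> by (simp add: abs_mult field_simps)
      ultimately have "R < \<bar>\<alpha> * y + \<beta> * s\<bar>" by linarith
      then show ?thesis using R[of _ 0] by simp
    qed
    then have "integral {a..b} (\<lambda>s. k s * \<psi> (\<alpha> * y + \<beta> * s)) = integral {a..b} (\<lambda>s. 0)"
      by (intro integral_cong) auto
    then show "integral {a..b} (\<lambda>s. k s * \<psi> (\<alpha> * y + \<beta> * s)) = 0" by simp
  qed
qed

section \<open>Bump functions\<close>

lemma poly_exp_decay: "((\<lambda>x. poly p (1/x) * exp (-1/x)) \<longlongrightarrow> 0) (at_right (0::real))"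
proof -
  have "((\<lambda>y. poly p y / exp y) \<longlongrightarrow> 0) (at_top :: real filter)"
  proof -
    have "((\<lambda>y. \<Sum>i\<le>degree p. coeff p i * (y ^ i / exp y)) \<longlongrightarrow> (\<Sum>i\<le>degree p. coeff p i * 0)) (at_top :: real filter)"
      by (intro tendsto_intros tendsto_power_div_exp_0)
    then show ?thesis by (simp add: poly_altdef sum_divide_distrib)
  qed
  then have "((\<lambda>x. poly p (inverse x) / exp (inverse x)) \<longlongrightarrow> 0) (at_right (0::real))"
    by (rule filterlim_compose) (rule filterlim_inverse_at_top_right)
  then show ?thesis by (simp add: exp_minus field_simps)
qed

lemma smooth_exp_inverse: "smooth (\<lambda>x::real. if x > 0 then exp (-1/x) else 0)"
proof -
  \<comment> \<open>For \<open>x > 0\<close> the \<open>n\<close>-th derivative of \<open>exp (-1/x)\<close> is \<open>exp (-1/x)\<close> times a polynomial in \<open>1/x\<close>.\<close>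
  define p :: "nat \<Rightarrow> real poly" where
    "p = rec_nat 1 (\<lambda>n q. [:0,0,1:] * (q - pderiv q))"
  have p0: "p 0 = 1" and pS: "p (Suc n) = [:0,0,1:] * (p n - pderiv (p n))" for n
    by (simp_all add: p_def)
  define D :: "nat \<Rightarrow> real \<Rightarrow> real" where
    "D n x = (if x > 0 then poly (p n) (1/x) * exp (-1/x) else 0)" for n x
  have "(D n has_vector_derivative D (Suc n) x) (at x)" for n x
  proof -
    consider "x > 0" | "x < 0" | "x = 0" by linarith
    then show ?thesis
    proof cases
      case 1
      have "((\<lambda>x. poly (p n) (1/x) * exp (-1/x)) has_real_derivative
         (poly (pderiv (p n)) (1/x) * (-1/x^2)) * exp (-1/x) + poly (p n) (1/x) * (exp (-1/x) * (1/x^2))) (at x)"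
        using 1 by (auto intro!: derivative_eq_intros DERIV_chain'[where g="poly (p n)"] simp: power2_eq_square)
      also have "(poly (pderiv (p n)) (1/x) * (-1/x^2)) * exp (-1/x) + poly (p n) (1/x) * (exp (-1/x) * (1/x^2)) = D (Suc n) x"
        using 1 by (simp add: D_def pS algebra_simps power2_eq_square)
      finally have "(D n has_real_derivative D (Suc n) x) (at x)"
        by (rule has_field_derivative_transform_within_open[of _ _ _ "{0<..}"]) (use 1 in \<open>auto simp: D_def\<close>)
      then show ?thesis by (simp add: has_real_derivative_iff_has_vector_derivative)
    next
      case 2
      have "((\<lambda>x. 0) has_real_derivative 0) (at x)" by simp
      then have "(D n has_real_derivative 0) (at x)"
        by (rule has_field_derivative_transform_within_open[of _ _ _ "{..<0}"]) (use 2 in \<open>auto simp: D_def\<close>)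
      then show ?thesis using 2 by (simp add: has_real_derivative_iff_has_vector_derivative D_def)
    next
      case 3
      have "((\<lambda>x. D n x / x) \<longlongrightarrow> 0) (at_right 0)"
        by (rule Lim_transform_eventually[OF poly_exp_decay[of "pCons 0 (p n)"]])
           (auto simp: D_def eventually_at_filter)
      moreover have "((\<lambda>x. D n x / x) \<longlongrightarrow> 0) (at_left 0)"
        by (rule Lim_transform_eventually[of "\<lambda>x. 0"]) (auto simp: D_def eventually_at_filter)
      ultimately have "((\<lambda>x. (D n x - D n 0) / (x - 0)) \<longlongrightarrow> 0) (at 0)"
        by (simp add: D_def filterlim_split_at)
      then have "(D n has_real_derivative 0) (at 0)"
        by (simp add: has_field_derivative_iff)
      then show ?thesis using 3 by (simp add: has_real_derivative_iff_has_vector_derivative D_def)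
    qed
  qed
  from smoothI[of D, OF this] show ?thesis by (simp add: D_def[abs_def] p0 cong: if_cong)
qed

lemma real_bump:
  obtains \<rho> :: "real \<Rightarrow> real"
  where "smooth \<rho>" "\<And>x. \<bar>x\<bar> > 1 \<Longrightarrow> \<rho> x = 0" "integral {-1..1} \<rho> = 1"
proof -
  define h where "h x = (if x > 0 then exp (-1/x) else 0)" for x :: real
  define b where "b x = h (1 * x + 1) * h ((-1) * x + 1)" for x
  have h: "smooth h" using smooth_exp_inverse by (simp add: h_def[abs_def])
  have b: "smooth b"
    unfolding b_def by (intro smooth_mult smooth_affine h)
  have b_zero: "b x = 0" if "\<bar>x\<bar> > 1" for x
    using that by (auto simp: b_def h_def)
  have b_nonneg: "b x \<ge> 0" for x by (simp add: b_def h_def)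
  define c where "c = integral {-1..1} b"
  have "c \<noteq> 0"
  proof
    assume "c = 0"
    then have "b 0 = 0"
      using integral_eq_0_iff[OF smooth_continuous[OF b], of "-1" 1] b_nonneg unfolding c_def by auto
    then show False by (simp add: b_def h_def)
  qed
  show ?thesis
  proof (rule that[of "\<lambda>x. b x / c"])
    show "smooth (\<lambda>x. b x / c)"
      by (rule smooth_linear[OF b bounded_linear_divide])
    show "integral {-1..1} (\<lambda>x. b x / c) = 1"
      using \<open>c \<noteq> 0\<close> by (simp add: c_def)
  qed (simp add: b_zero)
qed

lemma cutoff:
  obtains \<eta> :: "real \<Rightarrow> real"
  where "test_fun \<eta>" "\<And>x. \<bar>x\<bar> \<le> 1 \<Longrightarrow> \<eta> x = 1" "\<And>x. \<bar>x\<bar> > 3 \<Longrightarrow> \<eta> x = 0"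
proof -
  obtain \<rho> :: "real \<Rightarrow> real" where \<rho>: "smooth \<rho>" "\<And>x. \<bar>x\<bar> > 1 \<Longrightarrow> \<rho> x = 0" "integral {-1..1} \<rho> = 1"
    using real_bump by blast
  have tf: "test_fun \<rho>" by (rule test_funI[OF \<rho>(1,2)])
  define \<eta> where "\<eta> x = integral {-2..2} (\<lambda>s. 1 * \<rho> (1 * x + 1 * s))" for x
  show ?thesis
  proof
    show "test_fun \<eta>"
      unfolding \<eta>_def by (rule test_fun_integral[OF _ tf]) auto
    show "\<eta> x = 0" if "\<bar>x\<bar> > 3" for x
    proof -
      have "\<eta> x = integral {-2..2::real} (\<lambda>s. 0)"
        unfolding \<eta>_def by (intro integral_cong) (use that in \<open>auto intro!: \<rho>(2)\<close>)
      then show ?thesis by simp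
    qed
    show "\<eta> x = 1" if "\<bar>x\<bar> \<le> 1" for x
    proof -
      have "(\<rho> has_integral 1) {-1..1}"
        using \<rho>(3) integrable_continuous_real[OF smooth_continuous[OF \<rho>(1)]]
        by (metis integrable_integral)
      from has_integral_shift_real_ivl[OF this, of x]
      have "((\<lambda>s. \<rho> (s + x)) has_integral 1) {-2..2}"
        by (rule has_integral_on_superset) (use that in \<open>auto intro!: \<rho>(2)\<close>)
      then show ?thesis by (simp add: \<eta>_def add.commute integral_unique)
    qed
  qed
qed

section \<open>Elementary properties of distributions\<close>

lemma distribution_add: "distribution u \<Longrightarrow> test_fun f \<Longrightarrow> test_fun g \<Longrightarrow> u (\<lambda>x. f x + g x) = u f + u g"
  by (simp add: distribution_def)

lemma distribution_mult: "distribution u \<Longrightarrow> test_fun f \<Longrightarrow> u (\<lambda>x. c * f x) = c * u f"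
  by (simp add: distribution_def)

lemma distribution_scaleR:
  "distribution u \<Longrightarrow> test_fun f \<Longrightarrow> u (\<lambda>x. c *\<^sub>R f x) = c *\<^sub>R u f"
  using distribution_mult[of u f "of_real c"] by (simp add: scaleR_conv_of_real)

lemma distribution_minus: "distribution u \<Longrightarrow> test_fun f \<Longrightarrow> u (\<lambda>x. - f x) = - u f"
  using distribution_mult[of u f "-1"] by simp

lemma distribution_diff:
  "distribution u \<Longrightarrow> test_fun f \<Longrightarrow> test_fun g \<Longrightarrow> u (\<lambda>x. f x - g x) = u f - u g"
  using distribution_add[of u f "\<lambda>x. - g x"] by (simp add: test_fun_minus distribution_minus)

lemma distribution_0: "distribution u \<Longrightarrow> u (\<lambda>x. 0) = 0"
  using distribution_mult[of u "\<lambda>x. 0" 0] by (simp add: test_fun_0)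

lemma distribution_sum:
  assumes "distribution u" "\<And>i. i \<in> I \<Longrightarrow> test_fun (f i)"
  shows "u (\<lambda>x. \<Sum>i\<in>I. f i x) = (\<Sum>i\<in>I. u (f i))"
  using assms(2)
proof (induction I rule: infinite_finite_induct)
  case (insert i I)
  have "u (\<lambda>x. f i x + (\<Sum>i\<in>I. f i x)) = u (f i) + u (\<lambda>x. \<Sum>i\<in>I. f i x)"
    by (rule distribution_add[OF assms(1)]) (use insert in \<open>auto intro!: test_fun_sum\<close>)
  then show ?case using insert by simp
qed (simp_all add: distribution_0 assms(1))

text \<open>Continuity in the form used below: a uniform bound on finitely many derivatives bounds the value.
  No suprema occur, so boundedness of the derivatives need not be checked separately.\<close>

lemma distribution_bound:
  fixes u :: "'a::{real_normed_field, euclidean_space} functional"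
  assumes "distribution u" "compact K"
  obtains C m where "C > 0"
    "\<And>f b. test_fun f \<Longrightarrow> (\<And>x. x \<notin> K \<Longrightarrow> f x = 0) \<Longrightarrow>
       (\<And>k x. k \<le> m \<Longrightarrow> norm (nth_deriv k f x) \<le> b) \<Longrightarrow> norm (u f) \<le> C * b"
proof -
  obtain C m where C: "\<And>f. test_fun f \<Longrightarrow> supp f \<subseteq> K \<Longrightarrow>
        norm (u f) \<le> C * (\<Sum>k\<le>m. SUP x. norm (nth_deriv k f x))"
    using assms unfolding distribution_def by metis
  show ?thesis
  proof (rule that[of "(\<bar>C\<bar> + 1) * real (m + 1)" m])
    fix f :: "real \<Rightarrow> 'a" and b :: real
    assume f: "test_fun f" "\<And>x. x \<notin> K \<Longrightarrow> f x = 0"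
      and b: "\<And>k x. k \<le> m \<Longrightarrow> norm (nth_deriv k f x) \<le> b"
    have "b \<ge> 0" using b[of 0 0] norm_ge_zero order_trans by blast
    have "supp f \<subseteq> K"
      using f(2) assms(2) by (intro supp_subsetI) (auto simp: compact_imp_closed)
    then have "norm (u f) \<le> C * (\<Sum>k\<le>m. SUP x. norm (nth_deriv k f x))"
      by (rule C[OF f(1)])
    also have "\<dots> \<le> \<bar>C\<bar> * \<bar>\<Sum>k\<le>m. SUP x. norm (nth_deriv k f x)\<bar>"
      by (metis abs_ge_self abs_mult)
    also have "\<dots> \<le> \<bar>C\<bar> * (real (m + 1) * b)"
    proof (intro mult_left_mono abs_ge_zero)
      have "\<bar>\<Sum>k\<le>m. SUP x. norm (nth_deriv k f x)\<bar> \<le> (\<Sum>k\<le>m. \<bar>SUP x. norm (nth_deriv k f x)\<bar>)"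
        by (rule sum_abs)
      also have "\<dots> \<le> of_nat (card {..m}) * b"
      proof (rule sum_bounded_above)
        fix k assume k: "k \<in> {..m}"
        have "bdd_above (range (\<lambda>x. norm (nth_deriv k f x)))"
          using b[of k] k by (intro bdd_aboveI[of _ b]) auto
        then have "0 \<le> (SUP x. norm (nth_deriv k f x))"
          by (intro cSUP_upper2[of _ _ 0]) auto
        moreover have "(SUP x. norm (nth_deriv k f x)) \<le> b"
          by (intro cSUP_least) (use b k in auto)
        ultimately show "\<bar>SUP x. norm (nth_deriv k f x)\<bar> \<le> b" by simp
      qed
      finally show "\<bar>\<Sum>k\<le>m. SUP x. norm (nth_deriv k f x)\<bar> \<le> real (m + 1) * b" by simp
    qed
    also have "\<dots> \<le> (\<bar>C\<bar> + 1) * (real (m + 1) * b)"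
      using \<open>b \<ge> 0\<close> by (intro mult_right_mono) auto
    finally show "norm (u f) \<le> (\<bar>C\<bar> + 1) * real (m + 1) * b" by (simp only: mult.assoc)
  qed (auto intro: add_nonneg_pos)
qed

lemma lint_Icc:
  fixes f :: "real \<Rightarrow> 'a::euclidean_space"
  assumes "continuous_on {a..b} f" "\<And>x. x \<notin> {a..b} \<Longrightarrow> f x = 0"
  shows "integrable lebesgue f" "(LINT x|lebesgue. f x) = integral {a..b} f"
proof -
  have eq: "indicator {a..b} x *\<^sub>R f x = f x" for x
    using assms(2)[of x] by (auto simp: indicator_def)
  have *: "f absolutely_integrable_on {a..b}"
    by (rule absolutely_integrable_continuous_real[OF assms(1)])
  then show "integrable lebesgue f"
    by (simp add: set_integrable_def eq)
  show "(LINT x|lebesgue. f x) = integral {a..b} f"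
    using set_lebesgue_integral_eq_integral(2)[OF *] by (simp add: set_lebesgue_integral_def eq)
qed

lemma test_fun_bounded_upto:
  fixes f :: "real \<Rightarrow> 'a::real_normed_vector"
  assumes "test_fun f"
  obtains M where "M > 0" "\<And>n x. n \<le> m \<Longrightarrow> norm (nth_deriv n f x) \<le> M"
proof -
  have "\<exists>M>0. \<forall>n\<le>m. \<forall>x. norm (nth_deriv n f x) \<le> M"
  proof (induction m)
    case 0
    obtain M where "M > 0" "\<And>x. norm (nth_deriv 0 f x) \<le> M" using test_fun_bounded[OF assms] by metis
    then show ?case by auto
  next
    case (Suc m)
    then obtain M where M: "M > 0" "\<forall>n\<le>m. \<forall>x. norm (nth_deriv n f x) \<le> M" by blast
    obtain M' where M': "M' > 0" "\<And>x. norm (nth_deriv (Suc m) f x) \<le> M'" using test_fun_bounded[OF assms] by metis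
    show ?case
      by (rule exI[of _ "max M M'"]) (use M M' in \<open>auto simp: le_Suc_eq le_max_iff_disj\<close>)
  qed
  then show ?thesis using that by blast
qed

lemma test_fun_lipschitz_upto:
  fixes f :: "real \<Rightarrow> 'a::real_normed_vector"
  assumes "test_fun f"
  obtains L where "L > 0" "\<And>n x y. n \<le> m \<Longrightarrow> norm (nth_deriv n f x - nth_deriv n f y) \<le> L * \<bar>x - y\<bar>"
proof -
  obtain L where L: "L > 0" "\<And>n x. n \<le> Suc m \<Longrightarrow> norm (nth_deriv n f x) \<le> L"
    using test_fun_bounded_upto[OF assms] by metis
  have "norm (nth_deriv n f x - nth_deriv n f y) \<le> L * norm (x - y)" if "n \<le> m" for n x y
  proof (rule differentiable_bound[of UNIV])
    show "(nth_deriv n f has_derivative (\<lambda>h. h *\<^sub>R nth_deriv (Suc n) f x)) (at x within UNIV)" for x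
      using smooth_nth_deriv[OF test_fun_smooth[OF assms]]
      by (simp add: has_vector_derivative_def)
    show "onorm (\<lambda>h. h *\<^sub>R nth_deriv (Suc n) f x) \<le> L" for x
      using L that by (intro onorm_le) (simp add: mult.commute[of "\<bar>_\<bar>"] mult_right_mono)
  qed auto
  then show ?thesis using that L(1) by auto
qed

section \<open>Convolution of a distribution with a test function\<close>

lemma test_fun_reflect: "test_fun p \<Longrightarrow> test_fun (\<lambda>y. p (x - y))"
  using test_fun_affine[of p "-1" x] by simp

lemma nth_deriv_reflect:
  "smooth p \<Longrightarrow> nth_deriv n (\<lambda>y. p (x - y)) = (\<lambda>y. (-1) ^ n *\<^sub>R nth_deriv n p (x - y))"
  using nth_deriv_affine[of p n "-1" x] by simp

lemma has_vector_derivative_quadratic: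
  assumes "x \<in> S" "\<And>y. y \<in> S \<Longrightarrow> norm (f y - f x - (y - x) *\<^sub>R d) \<le> C * (y - x)^2"
  shows "(f has_vector_derivative d) (at x within S)"
  unfolding has_vector_derivative_def has_derivative_within_alt
proof (intro conjI bounded_linear_scaleR_left allI impI)
  fix e :: real assume "e > 0"
  show "\<exists>\<delta>>0. \<forall>y\<in>S. norm (y - x) < \<delta> \<longrightarrow> norm (f y - f x - (y - x) *\<^sub>R d) \<le> e * norm (y - x)"
  proof (intro exI[of _ "e / (\<bar>C\<bar> + 1)"] conjI ballI impI)
    show "e / (\<bar>C\<bar> + 1) > 0" using \<open>e > 0\<close> by (simp add: add_nonneg_pos)
    fix y assume y: "y \<in> S" "norm (y - x) < e / (\<bar>C\<bar> + 1)"
    have "norm (f y - f x - (y - x) *\<^sub>R d) \<le> C * (y - x)^2" by (rule assms(2)[OF y(1)])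
    also have "\<dots> \<le> (\<bar>C\<bar> + 1) * (y - x)^2" by (intro mult_right_mono) auto
    also have "\<dots> = ((\<bar>C\<bar> + 1) * \<bar>y - x\<bar>) * \<bar>y - x\<bar>" by (simp add: power2_eq_square)
    also have "\<dots> \<le> e * \<bar>y - x\<bar>"
      using y(2) by (intro mult_right_mono) (auto simp: field_simps)
    finally show "norm (f y - f x - (y - x) *\<^sub>R d) \<le> e * norm (y - x)" by simp
  qed
qed

lemma tendsto_norm_comparison:
  fixes f :: "'b \<Rightarrow> 'c::real_normed_vector"
  assumes "eventually (\<lambda>x. norm (f x - l) \<le> g x) F" "(g \<longlongrightarrow> 0) F"
  shows "(f \<longlongrightarrow> l) F"
  using Lim_null_comparison[OF assms] by (simp add: LIM_zero_iff)

lemma continuous_convol: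
  fixes u :: "'a::{real_normed_field, euclidean_space} functional"
  assumes u: "distribution u" and p: "test_fun p"
  shows "continuous_on S (\<lambda>x. u (\<lambda>y. p (x - y)))"
proof (rule continuous_at_imp_continuous_on, rule ballI)
  fix x
  obtain r where "r > 0" and r: "\<And>x n. \<bar>x\<bar> > r \<Longrightarrow> nth_deriv n p x = 0" using test_fun_radius[OF p] by metis
  define K where "K = {x - (r + 1)..x + (r + 1)}"
  have "compact K" by (simp add: K_def)
  obtain C m where "C > 0" and C: "\<And>f b. test_fun f \<Longrightarrow> (\<And>x. x \<notin> K \<Longrightarrow> f x = 0) \<Longrightarrow>
       (\<And>k x. k \<le> m \<Longrightarrow> norm (nth_deriv k f x) \<le> b) \<Longrightarrow> norm (u f) \<le> C * b"
    using distribution_bound[OF u \<open>compact K\<close>] by metis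
  obtain L where "L > 0" and L: "\<And>n x y. n \<le> m \<Longrightarrow> norm (nth_deriv n p x - nth_deriv n p y) \<le> L * \<bar>x - y\<bar>"
    using test_fun_lipschitz_upto[OF p] by metis
  have *: "norm (u (\<lambda>y. p (x' - y)) - u (\<lambda>y. p (x - y))) \<le> C * (L * \<bar>x' - x\<bar>)" if "\<bar>x' - x\<bar> < 1" for x'
  proof -
    have "u (\<lambda>y. p (x' - y)) - u (\<lambda>y. p (x - y)) = u (\<lambda>y. p (x' - y) - p (x - y))"
      by (rule distribution_diff[OF u test_fun_reflect[OF p] test_fun_reflect[OF p], symmetric])
    also have "norm \<dots> \<le> C * (L * \<bar>x' - x\<bar>)"
    proof (rule C)
      show "test_fun (\<lambda>y. p (x' - y) - p (x - y))"
        by (intro test_fun_diff test_fun_reflect p)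
      show "p (x' - y) - p (x - y) = 0" if "y \<notin> K" for y
        using that \<open>\<bar>x' - x\<bar> < 1\<close> r[of "x' - y" 0] r[of "x - y" 0] by (auto simp: K_def abs_real_def split: if_splits)
      show "norm (nth_deriv k (\<lambda>y. p (x' - y) - p (x - y)) y) \<le> L * \<bar>x' - x\<bar>" if "k \<le> m" for k y
      proof -
        have "nth_deriv k (\<lambda>y. p (x' - y) - p (x - y)) y = 
           nth_deriv k (\<lambda>y. p (x' - y) + (-1) *\<^sub>R p (x - y)) y" by simp
        also have "\<dots> = (-1) ^ k *\<^sub>R (nth_deriv k p (x' - y) - nth_deriv k p (x - y))"
          by (subst nth_deriv_add)
             (simp_all add: nth_deriv_linear[OF _ bounded_linear_scaleR_right] smooth_linear[OF _ bounded_linear_scaleR_right]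
               test_fun_smooth test_fun_reflect p nth_deriv_linear[OF _ bounded_linear_minus[OF bounded_linear_ident]] 
               smooth_linear[OF _ bounded_linear_minus[OF bounded_linear_ident]] nth_deriv_reflect scaleR_diff_right)
        finally show ?thesis using L[OF that, of "x' - y" "x - y"] by simp
      qed
    qed
    finally show ?thesis .
  qed
  show "isCont (\<lambda>x. u (\<lambda>y. p (x - y))) x"
    unfolding isCont_def
  proof (rule tendsto_norm_comparison)
    show "eventually (\<lambda>x'. norm (u (\<lambda>y. p (x' - y)) - u (\<lambda>y. p (x - y))) \<le> C * (L * \<bar>x' - x\<bar>)) (at x)"
      using * unfolding eventually_at by (metis dist_real_def zero_less_one)
    have "((\<lambda>x'. C * (L * \<bar>x' - x\<bar>)) \<longlongrightarrow> C * (L * \<bar>x - x\<bar>)) (at x)"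
      by (intro tendsto_intros)
    then show "((\<lambda>x'. C * (L * \<bar>x' - x\<bar>)) \<longlongrightarrow> 0) (at x)" by simp
  qed
qed

lemma nth_deriv_diff:
  assumes "smooth f" "smooth g"
  shows "nth_deriv n (\<lambda>x. f x - g x) = (\<lambda>x. nth_deriv n f x - nth_deriv n g x)"
  using nth_deriv_add[OF assms(1) smooth_linear[OF assms(2) bounded_linear_minus[OF bounded_linear_ident]], of n]
    nth_deriv_linear[OF assms(2) bounded_linear_minus[OF bounded_linear_ident], of n] by simp

text \<open>A distribution commutes with the integral over a parameter. With the upper limit of that
  integral as a variable, the pairing is an antiderivative of the integrand on the left; this avoids
  Riemann sums in the space of test functions.\<close>

lemma convol_has_integral:
  fixes u :: "'a::{real_normed_field, euclidean_space} functional"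
  assumes u: "distribution u" and p: "test_fun p" and \<psi>: "test_fun \<psi>"
    and R: "R \<ge> 0"
  shows "((\<lambda>x. u (\<lambda>y. p (x - y)) * \<psi> x) has_integral
      u (\<lambda>y. integral {-R..R} (\<lambda>s. \<psi> s * p (s - y)))) {-R..R}"
proof -
  define H where "H a b y = integral {a..b} (\<lambda>s. \<psi> s * p ((-1) * y + 1 * s))" for a b y
  have c\<psi>: "continuous_on S \<psi>" for S by (simp add: \<psi> smooth_continuous test_fun_smooth)
  have cp: "continuous_on S (\<lambda>s. nth_deriv k p (s - y))" for S k y
    by (rule continuous_on_compose2[OF continuous_nth_deriv[OF test_fun_smooth[OF p], of UNIV]])
       (auto intro!: continuous_intros)
  have tH: "test_fun (H a b)" for a b
    unfolding H_def by (rule test_fun_integral[OF c\<psi> p]) auto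
  have dH: "nth_deriv k (H a b) y = (-1) ^ k *\<^sub>R integral {a..b} (\<lambda>s. \<psi> s * nth_deriv k p (s - y))" for k a b y
    unfolding H_def using nth_deriv_integral[OF c\<psi> p, of "-1" k a b 1] by simp
  obtain r where "r > 0" and r: "\<And>x n. \<bar>x\<bar> > r \<Longrightarrow> nth_deriv n p x = 0" using test_fun_radius[OF p] by metis
  define K where "K = {-(R + r)..R + r}"
  have "compact K" by (simp add: K_def)
  obtain C m where "C > 0" and C: "\<And>f b. test_fun f \<Longrightarrow> (\<And>x. x \<notin> K \<Longrightarrow> f x = 0) \<Longrightarrow>
       (\<And>k x. k \<le> m \<Longrightarrow> norm (nth_deriv k f x) \<le> b) \<Longrightarrow> norm (u f) \<le> C * b"
    using distribution_bound[OF u \<open>compact K\<close>] by metis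
  obtain L where "L > 0" and L: "\<And>n x y. n \<le> m \<Longrightarrow> norm (nth_deriv n p x - nth_deriv n p y) \<le> L * \<bar>x - y\<bar>"
    using test_fun_lipschitz_upto[OF p] by metis
  obtain M where "M > 0" and M: "\<And>n x. n \<le> m \<Longrightarrow> norm (nth_deriv n p x) \<le> M"
    using test_fun_bounded_upto[OF p] by metis
  obtain L' where "L' > 0" and L': "\<And>x y. norm (\<psi> x - \<psi> y) \<le> L' * \<bar>x - y\<bar>"
    using test_fun_lipschitz_upto[OF \<psi>, of 0] by (metis le_refl nth_deriv_0)
  obtain M' where "M' > 0" and M': "\<And>x. norm (\<psi> x) \<le> M'"
    using test_fun_bounded[OF \<psi>, of 0] by (metis nth_deriv_0)
  define B where "B = M' * L + L' * M"
  have "B > 0" using \<open>L > 0\<close> \<open>M > 0\<close> \<open>L' > 0\<close> \<open>M' > 0\<close> by (simp add: B_def add_pos_pos)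
  have lip: "norm (\<psi> s * nth_deriv k p (s - y) - \<psi> t * nth_deriv k p (t - y)) \<le> B * \<bar>s - t\<bar>"
    if "k \<le> m" for k s t y
  proof -
    have "\<psi> s * nth_deriv k p (s - y) - \<psi> t * nth_deriv k p (t - y) =
       \<psi> s * (nth_deriv k p (s - y) - nth_deriv k p (t - y)) + (\<psi> s - \<psi> t) * nth_deriv k p (t - y)"
      by (simp add: algebra_simps)
    also have "norm \<dots> \<le> norm (\<psi> s) * norm (nth_deriv k p (s - y) - nth_deriv k p (t - y))
         + norm (\<psi> s - \<psi> t) * norm (nth_deriv k p (t - y))"
      by (metis norm_mult norm_triangle_ineq)
    also have "\<dots> \<le> M' * (L * \<bar>(s - y) - (t - y)\<bar>) + (L' * \<bar>s - t\<bar>) * M"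
      by (intro add_mono mult_mono M' L L' M that) (use \<open>M' > 0\<close> \<open>L' > 0\<close> in auto)
    finally show ?thesis by (simp add: B_def algebra_simps)
  qed
  \<comment> \<open>Over a short interval \<open>H a b\<close> is, in every seminorm, quadratically close to its integrand
    at any point \<open>\<tau>\<close> of the interval times the length. Taking \<open>\<tau>\<close> to be either end point covers
    increments of both signs.\<close>
  have key: "norm (u (H a b) - (b - a) *\<^sub>R (\<psi> \<tau> * u (\<lambda>y. p (\<tau> - y)))) \<le> C * (B * (b - a)^2)"
    if ab: "-R \<le> a" "a \<le> \<tau>" "\<tau> \<le> b" "b \<le> R" for a b \<tau>
  proof -
    have tp: "test_fun (\<lambda>y. (b - a) *\<^sub>R (\<psi> \<tau> * p (\<tau> - y)))"
      by (intro test_fun_scaleR test_fun_mult_left test_fun_reflect p)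
    have "u (H a b) - (b - a) *\<^sub>R (\<psi> \<tau> * u (\<lambda>y. p (\<tau> - y))) = u (\<lambda>y. H a b y - (b - a) *\<^sub>R (\<psi> \<tau> * p (\<tau> - y)))"
      using distribution_diff[OF u tH tp, of a b]
        distribution_scaleR[OF u test_fun_mult_left[OF test_fun_reflect[OF p]], of "b - a" "\<psi> \<tau>" \<tau>]
        distribution_mult[OF u test_fun_reflect[OF p], of "\<psi> \<tau>" \<tau>] by simp
    also have "norm \<dots> \<le> C * (B * (b - a)^2)"
    proof (rule C)
      show "test_fun (\<lambda>y. H a b y - (b - a) *\<^sub>R (\<psi> \<tau> * p (\<tau> - y)))"
        by (intro test_fun_diff tH tp)
    next
      fix y assume "y \<notin> K"
      then have z: "p (s - y) = 0" if "s \<in> {a..b}" for s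
        using that ab r[of "s - y" 0] by (auto simp: K_def)
      then have "H a b y = integral {a..b} (\<lambda>s. 0)"
        unfolding H_def by (intro integral_cong) auto
      then show "H a b y - (b - a) *\<^sub>R (\<psi> \<tau> * p (\<tau> - y)) = 0"
        using z[of \<tau>] ab by simp
    next
      fix k y assume k: "k \<le> m"
      have "nth_deriv k (\<lambda>y. (b - a) *\<^sub>R (\<psi> \<tau> * p (\<tau> - y))) y = (-1) ^ k *\<^sub>R ((b - a) *\<^sub>R (\<psi> \<tau> * nth_deriv k p (\<tau> - y)))"
        by (simp add: nth_deriv_linear[OF _ bounded_linear_scaleR_right] nth_deriv_linear[OF _ bounded_linear_mult_right]
            smooth_linear[OF _ bounded_linear_mult_right] nth_deriv_reflect test_fun_smooth p test_fun_reflect)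
      then have "nth_deriv k (\<lambda>y. H a b y - (b - a) *\<^sub>R (\<psi> \<tau> * p (\<tau> - y))) y
         = (-1) ^ k *\<^sub>R (integral {a..b} (\<lambda>s. \<psi> s * nth_deriv k p (s - y)) - (b - a) *\<^sub>R (\<psi> \<tau> * nth_deriv k p (\<tau> - y)))"
        by (simp add: nth_deriv_diff[OF test_fun_smooth[OF tH] test_fun_smooth[OF tp]] dH scaleR_diff_right)
      also have "integral {a..b} (\<lambda>s. \<psi> s * nth_deriv k p (s - y)) - (b - a) *\<^sub>R (\<psi> \<tau> * nth_deriv k p (\<tau> - y))
         = integral {a..b} (\<lambda>s. \<psi> s * nth_deriv k p (s - y) - \<psi> \<tau> * nth_deriv k p (\<tau> - y))"
        using ab by (subst Henstock_Kurzweil_Integration.integral_diff)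
           (auto intro!: integrable_continuous_real continuous_intros c\<psi> cp)
      finally have "norm (nth_deriv k (\<lambda>y. H a b y - (b - a) *\<^sub>R (\<psi> \<tau> * p (\<tau> - y))) y) =
         norm (integral {a..b} (\<lambda>s. \<psi> s * nth_deriv k p (s - y) - \<psi> \<tau> * nth_deriv k p (\<tau> - y)))" by simp
      also have "\<dots> \<le> (B * (b - a)) * (b - a)"
      proof (rule integral_bound)
        fix t assume "t \<in> {a..b}"
        then have "norm (\<psi> t * nth_deriv k p (t - y) - \<psi> \<tau> * nth_deriv k p (\<tau> - y)) \<le> B * \<bar>t - \<tau>\<bar>"
          by (intro lip k)
        also have "\<dots> \<le> B * (b - a)"
          using \<open>B > 0\<close> \<open>t \<in> {a..b}\<close> ab by (intro mult_left_mono) auto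
        finally show "norm (\<psi> t * nth_deriv k p (t - y) - \<psi> \<tau> * nth_deriv k p (\<tau> - y)) \<le> B * (b - a)" .
      qed (use ab in \<open>auto intro!: continuous_intros c\<psi> cp\<close>)
      finally show "norm (nth_deriv k (\<lambda>y. H a b y - (b - a) *\<^sub>R (\<psi> \<tau> * p (\<tau> - y))) y) \<le> B * (b - a)^2"
        by (simp add: power2_eq_square)
    qed
    finally show ?thesis .
  qed
  have split: "u (H (-R) c) - u (H (-R) b) = u (H b c)" if "-R \<le> b" "b \<le> c" for b c
  proof -
    have "H (-R) c = (\<lambda>y. H (-R) b y + H b c y)"
    proof
      fix y show "H (-R) c y = H (-R) b y + H b c y"
        unfolding H_def
        by (rule Henstock_Kurzweil_Integration.integral_combine[symmetric]) (use that in \<open>auto intro!: integrable_continuous_real continuous_intros c\<psi> cp[where k=0, simplified]\<close>)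
    qed
    then show ?thesis by (simp add: distribution_add u tH)
  qed
  have "((\<lambda>x. u (\<lambda>y. p (x - y)) * \<psi> x) has_integral u (H (-R) R) - u (H (-R) (-R))) {-R..R}"
  proof (rule fundamental_theorem_of_calculus)
    show "-R \<le> R" using R by simp
    fix x assume x: "x \<in> {-R..R}"
    show "((\<lambda>t. u (H (-R) t)) has_vector_derivative u (\<lambda>y. p (x - y)) * \<psi> x) (at x within {-R..R})"
    proof (rule has_vector_derivative_quadratic[OF x])
      fix y assume y: "y \<in> {-R..R}"
      show "norm (u (H (-R) y) - u (H (-R) x) - (y - x) *\<^sub>R (u (\<lambda>y. p (x - y)) * \<psi> x)) \<le> (C * B) * (y - x)^2"
      proof (cases "x \<le> y")
        case True
        then show ?thesis using key[of x x y] split[of x y] x y by (simp add: mult.commute[of "\<psi> x"] mult.assoc)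
      next
        case False
        then have "norm (u (H (-R) y) - u (H (-R) x) - (y - x) *\<^sub>R (u (\<lambda>y. p (x - y)) * \<psi> x))
           = norm (u (H y x) - (x - y) *\<^sub>R (\<psi> x * u (\<lambda>y. p (x - y))))"
          using split[of y x] y x by (subst norm_minus_cancel[symmetric]) (simp add: algebra_simps)
        then show ?thesis using False key[of y x x] x y by (simp add: mult.assoc power2_commute)
      qed
    qed
  qed
  moreover have "H (-R) (-R) = (\<lambda>y. 0)" by (simp add: H_def fun_eq_iff)
  ultimately show ?thesis by (simp add: distribution_0 u H_def[abs_def])
qed

section \<open>Regularisation and supports\<close>

lemma test_fun_delta_net:
  assumes "test_fun \<phi>" "\<epsilon> > 0" shows "test_fun (delta_net \<phi> \<epsilon>)"
proof -
  have "test_fun (\<lambda>x. inverse (of_real \<epsilon>) * \<phi> ((1/\<epsilon>) * x + 0))"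
    by (rule test_fun_mult_left[OF test_fun_affine[OF assms(1)]]) (use assms(2) in auto)
  then show ?thesis by (simp add: delta_net_def[abs_def] field_simps)
qed

text \<open>Mollified distributions converge weakly: the pairing equals the value of \<open>u\<close> at a mollified
  test function, which converges in the space of test functions.\<close>

lemma convol_pairing_tendsto:
  fixes u :: "'a::{real_normed_field, euclidean_space} functional"
  assumes u: "distribution u" and \<psi>: "test_fun \<psi>"
    and \<phi>: "test_fun \<phi>" "\<And>x. \<bar>x\<bar> > 1 \<Longrightarrow> \<phi> x = 0" "integral {-1..1} \<phi> = 1"
  shows "((\<lambda>\<epsilon>. LINT x|lebesgue. convol u (delta_net \<phi> \<epsilon>) x * \<psi> x) \<longlongrightarrow> u \<psi>) (at_right 0)"
proof -
  obtain R where "R > 0" and R: "\<And>x n. \<bar>x\<bar> > R \<Longrightarrow> nth_deriv n \<psi> x = 0" using test_fun_radius[OF \<psi>] by metis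
  define F where "F \<epsilon> y = integral {-1..1} (\<lambda>z. \<phi> z * \<psi> (1 * y + \<epsilon> * z))" for \<epsilon> y
  have c\<phi>: "continuous_on S \<phi>" for S by (simp add: \<phi> smooth_continuous test_fun_smooth)
  have c\<psi>: "continuous_on S (\<lambda>z. nth_deriv k \<psi> (y + \<epsilon> * z))" for S k \<epsilon> y
    by (rule continuous_on_compose2[OF continuous_nth_deriv[OF test_fun_smooth[OF \<psi>], of UNIV]])
       (auto intro!: continuous_intros)
  have tF: "test_fun (F \<epsilon>)" for \<epsilon>
    unfolding F_def by (rule test_fun_integral[OF c\<phi> \<psi>]) auto
  have dF: "nth_deriv k (F \<epsilon>) y = integral {-1..1} (\<lambda>z. \<phi> z * nth_deriv k \<psi> (y + \<epsilon> * z))" for k \<epsilon> y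
    unfolding F_def using nth_deriv_integral[OF c\<phi> \<psi>, of 1 k "-1" 1 \<epsilon>] by simp
  have eq: "(LINT x|lebesgue. convol u (delta_net \<phi> \<epsilon>) x * \<psi> x) = u (F \<epsilon>)" if "\<epsilon> > 0" for \<epsilon>
  proof -
    let ?p = "delta_net \<phi> \<epsilon>"
    have p: "test_fun ?p" by (rule test_fun_delta_net[OF \<phi>(1) that])
    have c\<psi>0: "continuous_on S \<psi>" for S by (simp add: \<psi> smooth_continuous test_fun_smooth)
    have "(LINT x|lebesgue. convol u ?p x * \<psi> x) = integral {-R..R} (\<lambda>x. convol u ?p x * \<psi> x)"
      by (rule lint_Icc) (use R[of _ 0] in \<open>auto simp: convol_def intro!: continuous_intros c\<psi>0 continuous_convol[OF u p]\<close>)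
    also have "\<dots> = u (\<lambda>y. integral {-R..R} (\<lambda>s. \<psi> s * ?p (s - y)))"
      using convol_has_integral[OF u p \<psi>, of R] \<open>R > 0\<close> by (simp add: convol_def integral_unique)
    also have "(\<lambda>y. integral {-R..R} (\<lambda>s. \<psi> s * ?p (s - y))) = F \<epsilon>"
    proof
      fix y
      have cp: "continuous_on S (\<lambda>s. ?p (s - y))" for S
        by (rule continuous_on_compose2[OF smooth_continuous[OF test_fun_smooth[OF p], of UNIV]])
           (auto intro!: continuous_intros)
      have "integral {-R..R} (\<lambda>s. \<psi> s * ?p (s - y)) = (LINT s|lebesgue. \<psi> s * ?p (s - y))"
        by (rule lint_Icc(2)[symmetric]) (use R[of _ 0] in \<open>auto intro!: continuous_intros cp c\<psi>0\<close>)
      also have "\<dots> = \<epsilon> *\<^sub>R (LINT z|lebesgue. \<psi> (y + \<epsilon> * z) * ?p (y + \<epsilon> * z - y))"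
        using that by (subst lebesgue_integral_real_affine[of \<epsilon> _ y]) auto
      also have "\<dots> = (LINT z|lebesgue. \<epsilon> *\<^sub>R (\<psi> (y + \<epsilon> * z) * ?p (y + \<epsilon> * z - y)))"
        by simp
      also have "\<dots> = (LINT z|lebesgue. \<phi> z * \<psi> (y + \<epsilon> * z))"
        using that by (intro Bochner_Integration.integral_cong) (auto simp: delta_net_def scaleR_conv_of_real)
      also have "\<dots> = integral {-1..1} (\<lambda>z. \<phi> z * \<psi> (y + \<epsilon> * z))"
        by (rule lint_Icc) (use c\<psi>[of _ 0] in \<open>auto intro!: continuous_intros c\<phi> \<phi>(2)\<close>)
      finally show "integral {-R..R} (\<lambda>s. \<psi> s * ?p (s - y)) = F \<epsilon> y" by (simp add: F_def)
    qed
    finally show ?thesis .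
  qed
  define K where "K = {-(R + 1)..R + 1}"
  have "compact K" by (simp add: K_def)
  obtain C m where "C > 0" and C: "\<And>f b. test_fun f \<Longrightarrow> (\<And>x. x \<notin> K \<Longrightarrow> f x = 0) \<Longrightarrow>
       (\<And>k x. k \<le> m \<Longrightarrow> norm (nth_deriv k f x) \<le> b) \<Longrightarrow> norm (u f) \<le> C * b"
    using distribution_bound[OF u \<open>compact K\<close>] by metis
  obtain L where "L > 0" and L: "\<And>n x y. n \<le> m \<Longrightarrow> norm (nth_deriv n \<psi> x - nth_deriv n \<psi> y) \<le> L * \<bar>x - y\<bar>"
    using test_fun_lipschitz_upto[OF \<psi>] by metis
  obtain M where "M > 0" and M: "\<And>x. norm (\<phi> x) \<le> M"
    using test_fun_bounded[OF \<phi>(1), of 0] by (metis nth_deriv_0)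
  have bound: "norm (u (F \<epsilon>) - u \<psi>) \<le> C * (M * (L * \<epsilon>) * 2)" if "0 < \<epsilon>" "\<epsilon> < 1" for \<epsilon>
  proof -
    have "u (F \<epsilon>) - u \<psi> = u (\<lambda>y. F \<epsilon> y - \<psi> y)" by (rule distribution_diff[OF u tF \<psi>, symmetric])
    also have "norm \<dots> \<le> C * (M * (L * \<epsilon>) * 2)"
    proof (rule C)
      show "test_fun (\<lambda>y. F \<epsilon> y - \<psi> y)" by (intro test_fun_diff tF \<psi>)
    next
      fix y assume y: "y \<notin> K"
      have z: "\<psi> (y + \<epsilon> * z) = 0" if z: "z \<in> {-1..1}" for z
      proof -
        have "\<bar>\<epsilon> * z\<bar> \<le> 1 * 1" unfolding abs_mult by (intro mult_mono) (use z that \<open>0 < \<epsilon>\<close> \<open>\<epsilon> < 1\<close> in auto)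
        then show ?thesis using y by (intro R[of _ 0, simplified]) (auto simp: K_def)
      qed
      then have "F \<epsilon> y = integral {-1..1::real} (\<lambda>z. 0)"
        unfolding F_def by (intro integral_cong) auto
      then show "F \<epsilon> y - \<psi> y = 0" using z[of 0] by simp
    next
      fix k y assume k: "k \<le> m"
      have "nth_deriv k (\<lambda>y. F \<epsilon> y - \<psi> y) y = 
          integral {-1..1} (\<lambda>z. \<phi> z * nth_deriv k \<psi> (y + \<epsilon> * z)) - integral {-1..1} \<phi> * nth_deriv k \<psi> y"
        by (simp add: nth_deriv_diff[OF test_fun_smooth[OF tF] test_fun_smooth[OF \<psi>]] dF \<phi>(3))
      also have "\<dots> = integral {-1..1} (\<lambda>z. \<phi> z * (nth_deriv k \<psi> (y + \<epsilon> * z) - nth_deriv k \<psi> y))"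
        unfolding right_diff_distrib
        by (subst Henstock_Kurzweil_Integration.integral_diff)
           (auto intro!: integrable_continuous_real continuous_intros c\<psi> c\<phi>)
      also have "norm \<dots> \<le> (M * (L * \<epsilon>)) * (1 - (-1))"
      proof (rule integral_bound)
        fix z :: real assume z: "z \<in> {-1..1}"
        have "norm (nth_deriv k \<psi> (y + \<epsilon> * z) - nth_deriv k \<psi> y) \<le> L * \<bar>y + \<epsilon> * z - y\<bar>" by (rule L[OF k])
        also have "\<dots> \<le> L * \<epsilon>"
          using \<open>L > 0\<close> z that by (intro mult_left_mono) (auto simp: abs_mult)
        finally show "norm (\<phi> z * (nth_deriv k \<psi> (y + \<epsilon> * z) - nth_deriv k \<psi> y)) \<le> M * (L * \<epsilon>)"
          unfolding norm_mult by (intro mult_mono M) (use \<open>M > 0\<close> in auto)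
      qed (auto intro!: continuous_intros c\<psi> c\<phi>)
      finally show "norm (nth_deriv k (\<lambda>y. F \<epsilon> y - \<psi> y) y) \<le> M * (L * \<epsilon>) * 2" by simp
    qed
    finally show ?thesis .
  qed
  have "((\<lambda>\<epsilon>. u (F \<epsilon>)) \<longlongrightarrow> u \<psi>) (at_right 0)"
  proof (rule tendsto_norm_comparison)
    show "eventually (\<lambda>\<epsilon>. norm (u (F \<epsilon>) - u \<psi>) \<le> C * (M * (L * \<epsilon>) * 2)) (at_right 0)"
      using eventually_at_right_real[OF zero_less_one] by (rule eventually_mono) (use bound in auto)
    have "((\<lambda>\<epsilon>. C * (M * (L * \<epsilon>) * 2)) \<longlongrightarrow> C * (M * (L * 0) * 2)) (at_right 0)"
      by (intro tendsto_intros)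
    then show "((\<lambda>\<epsilon>. C * (M * (L * \<epsilon>) * 2)) \<longlongrightarrow> 0) (at_right 0)" by simp
  qed
  then show ?thesis
    by (rule Lim_transform_eventually) (use eq in \<open>auto simp: eventually_at_filter\<close>)
qed

text \<open>The support is the complement of a union of open null sets. Mollification replaces the
  usual partition of unity: a narrow mollifier centred at a point of \<open>supp \<psi>\<close> has its support in a
  single null set, by the Lebesgue number of the cover.\<close>

lemma distribution_vanishes_off_support:
  fixes u :: "'a::{real_normed_field, euclidean_space} functional"
  assumes u: "distribution u" and \<psi>: "test_fun \<psi>" and disj: "supp \<psi> \<inter> dist_supp u = {}"
  shows "u \<psi> = 0"
proof -
  obtain \<rho> :: "real \<Rightarrow> real" where \<rho>: "smooth \<rho>" "\<And>x. \<bar>x\<bar> > 1 \<Longrightarrow> \<rho> x = 0" "integral {-1..1} \<rho> = 1"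
    using real_bump by blast
  define \<phi> :: "real \<Rightarrow> 'a" where "\<phi> x = of_real (\<rho> x)" for x
  have \<phi>: "test_fun \<phi>" unfolding \<phi>_def by (intro test_fun_of_real test_funI \<rho>)
  have \<phi>0: "\<bar>x\<bar> > 1 \<Longrightarrow> \<phi> x = 0" for x by (simp add: \<phi>_def \<rho>)
  have "(\<rho> has_integral 1) {-1..1}"
    using \<rho>(3) integrable_continuous_real[OF smooth_continuous[OF \<rho>(1)]] by (metis integrable_integral)
  from has_integral_linear[OF this bounded_linear_of_real[where 'a='a]]
  have \<phi>1: "integral {-1..1} \<phi> = 1" by (simp add: integral_unique \<phi>_def[abs_def] o_def)
  define \<U> where "\<U> = {U. open U \<and> (\<forall>\<phi>. test_fun \<phi> \<longrightarrow> supp \<phi> \<subseteq> U \<longrightarrow> u \<phi> = 0)}"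
  have "supp \<psi> \<subseteq> \<Union>\<U>" using disj by (auto simp: dist_supp_def \<U>_def)
  moreover have "compact (supp \<psi>)" using \<psi> by (simp add: test_fun_def)
  moreover have "\<And>U. U \<in> \<U> \<Longrightarrow> open U" by (simp add: \<U>_def)
  ultimately obtain e where "e > 0" and e: "\<And>x. x \<in> supp \<psi> \<Longrightarrow> \<exists>U\<in>\<U>. ball x e \<subseteq> U"
    using Heine_Borel_lemma[of "supp \<psi>" \<U>] by metis
  have zero: "(LINT x|lebesgue. convol u (delta_net \<phi> \<epsilon>) x * \<psi> x) = 0" if "0 < \<epsilon>" "\<epsilon> < e" for \<epsilon>
  proof -
    have "convol u (delta_net \<phi> \<epsilon>) x * \<psi> x = 0" for x
    proof (cases "x \<in> supp \<psi>")
      case True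
      then obtain U where U: "U \<in> \<U>" "ball x e \<subseteq> U" using e by blast
      have "supp (\<lambda>y. delta_net \<phi> \<epsilon> (x - y)) \<subseteq> cball x \<epsilon>"
      proof (rule supp_subsetI)
        fix y assume "y \<notin> cball x \<epsilon>"
        then have "\<bar>(x - y) / \<epsilon>\<bar> > 1" using that by (simp add: dist_real_def field_simps)
        then show "delta_net \<phi> \<epsilon> (x - y) = 0" by (simp add: delta_net_def \<phi>0)
      qed simp
      also have "\<dots> \<subseteq> U" using U(2) that by auto
      finally have "u (\<lambda>y. delta_net \<phi> \<epsilon> (x - y)) = 0"
        using U(1) test_fun_reflect[OF test_fun_delta_net[OF \<phi> that(1)]] by (simp add: \<U>_def)
      then show ?thesis by (simp add: convol_def)
    qed (simp add: supp_0)
    then show ?thesis by (simp only: Bochner_Integration.integral_zero)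
  qed
  have "((\<lambda>\<epsilon>. LINT x|lebesgue. convol u (delta_net \<phi> \<epsilon>) x * \<psi> x) \<longlongrightarrow> 0) (at_right 0)"
    by (rule Lim_transform_eventually[of "\<lambda>x. 0"])
       (use zero eventually_at_right_real[OF \<open>e > 0\<close>] in \<open>auto elim: eventually_mono\<close>)
  moreover have "((\<lambda>\<epsilon>. LINT x|lebesgue. convol u (delta_net \<phi> \<epsilon>) x * \<psi> x) \<longlongrightarrow> u \<psi>) (at_right 0)"
    by (rule convol_pairing_tendsto[OF u \<psi> \<phi> \<phi>0 \<phi>1])
  ultimately have "0 = u \<psi>"
    by (rule tendsto_unique[OF trivial_limit_at_right_real])
  then show ?thesis by simp
qed

section \<open>Distributions supported at a point\<close>

lemma taylor_bound:
  fixes r :: "real \<Rightarrow> 'a::real_normed_vector"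
  assumes r: "test_fun r" and z: "\<And>j. j \<le> N \<Longrightarrow> nth_deriv j r x0 = 0"
  obtains M where "M > 0" "\<And>j x. j \<le> Suc N \<Longrightarrow> norm (nth_deriv j r x) \<le> M * \<bar>x - x0\<bar> ^ (Suc N - j)"
proof -
  obtain M where "M > 0" and M: "\<And>x. norm (nth_deriv (Suc N) r x) \<le> M"
    using test_fun_bounded[OF r] by metis
  have main: "norm (nth_deriv (Suc N - i) r x) \<le> M * \<bar>x - x0\<bar> ^ i" if "i \<le> Suc N" for i x
    using that
  proof (induction i arbitrary: x)
    case 0
    then show ?case using M by simp
  next
    case (Suc i)
    let ?f = "nth_deriv (N - i) r" and ?f' = "nth_deriv (Suc (N - i)) r"
    have "norm (?f x - ?f x0) \<le> M * \<bar>x - x0\<bar> ^ i * norm (x - x0)"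
    proof (rule differentiable_bound[of "closed_segment x0 x"])
      fix y assume y: "y \<in> closed_segment x0 x"
      show "(?f has_derivative (\<lambda>h. h *\<^sub>R ?f' y)) (at y within closed_segment x0 x)"
        using smooth_nth_deriv[OF test_fun_smooth[OF r], of "N - i" y]
        by (auto simp: has_vector_derivative_def intro: has_derivative_at_withinI)
      have "norm (?f' y) \<le> M * \<bar>y - x0\<bar> ^ i"
        using Suc.IH[of y] Suc.prems by (simp add: Suc_diff_le)
      also have "\<dots> \<le> M * \<bar>x - x0\<bar> ^ i"
        using y \<open>M > 0\<close> by (intro mult_left_mono power_mono) (auto simp: closed_segment_eq_real_ivl split: if_splits)
      finally have "norm (?f' y) \<le> M * \<bar>x - x0\<bar> ^ i" .
      then show "onorm (\<lambda>h. h *\<^sub>R ?f' y) \<le> M * \<bar>x - x0\<bar> ^ i"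
        by (intro onorm_le) (simp add: mult.commute[of "\<bar>_\<bar>"] mult_right_mono)
    qed auto
    then show ?case using z[of "N - i"] Suc.prems by (simp add: ac_simps)
  qed
  show ?thesis
  proof (rule that[OF \<open>M > 0\<close>])
    fix j x assume "j \<le> Suc N"
    then show "norm (nth_deriv j r x) \<le> M * \<bar>x - x0\<bar> ^ (Suc N - j)"
      using main[of "Suc N - j" x] by simp
  qed
qed

text \<open>Monomials centred at \<open>x0\<close>, cut off away from \<open>x0\<close>: a basis dual to the derivatives at \<open>x0\<close>.\<close>

lemma test_monomial:
  obtains e :: "nat \<Rightarrow> real \<Rightarrow> 'a::real_normed_field"
  where "\<And>k. test_fun (e k)" "\<And>j k. nth_deriv j (e k) x0 = (if j = k then 1 else 0)"
    "\<And>k x. \<bar>x - x0\<bar> \<le> 1 \<Longrightarrow> e k x = of_real ((x - x0) ^ k / fact k)"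
    "\<And>k x. \<bar>x - x0\<bar> > 3 \<Longrightarrow> e k x = 0"
proof -
  obtain \<eta> :: "real \<Rightarrow> real" where \<eta>: "test_fun \<eta>" "\<And>x. \<bar>x\<bar> \<le> 1 \<Longrightarrow> \<eta> x = 1" "\<And>x. \<bar>x\<bar> > 3 \<Longrightarrow> \<eta> x = 0"
    using cutoff by metis
  define D where "D k j x = (if j \<le> k then (x - x0) ^ (k - j) / fact (k - j) else 0)" for k j and x :: real
  have D: "(D k j has_vector_derivative D k (Suc j) x) (at x)" for k j x
  proof -
    consider "j < k" | "j = k" | "j > k" by linarith
    then show ?thesis
    proof cases
      case 1
      then obtain i where i: "k - j = Suc i" "k - Suc j = i" by (metis Suc_diff_Suc)
      have "((\<lambda>x. (x - x0) ^ Suc i / fact (Suc i)) has_real_derivative (real (Suc i) * (x - x0) ^ i) / fact (Suc i)) (at x)"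
        by (intro DERIV_cdivide) (auto intro!: derivative_eq_intros simp del: power_Suc of_nat_Suc)
      moreover have "(real (Suc i) * (x - x0) ^ i) / fact (Suc i) = (x - x0) ^ i / fact i"
        by (simp add: fact_Suc del: of_nat_Suc)
      ultimately have "((\<lambda>x. (x - x0) ^ Suc i / fact (Suc i)) has_real_derivative (x - x0) ^ i / fact i) (at x)"
        by simp
      then show ?thesis using 1 i by (simp add: D_def[abs_def] has_real_derivative_iff_has_vector_derivative)
    qed (simp_all add: D_def[abs_def])
  qed
  have D0: "D k 0 = (\<lambda>x. (x - x0) ^ k / fact k)" for k by (simp add: D_def fun_eq_iff)
  have sm: "smooth (\<lambda>x. (x - x0) ^ k / fact k)" and
    dm: "nth_deriv j (\<lambda>x. (x - x0) ^ k / fact k) = D k j" for k j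
    using smoothI[of "D k", OF D] nth_deriv_eqI[of "D k", OF D] by (simp_all add: D0)
  define e0 where "e0 k x = (x - x0) ^ k / fact k * \<eta> (1 * x + - x0)" for k x
  have te0: "test_fun (e0 k)" for k
    unfolding e0_def by (rule test_fun_mult_smooth[OF sm test_fun_affine[OF \<eta>(1)]]) auto
  have de0: "nth_deriv j (e0 k) x0 = (if j = k then 1 else 0)" for j k
  proof -
    have "nth_deriv j (e0 k) x0 = nth_deriv j (\<lambda>x. (x - x0) ^ k / fact k) x0"
      by (rule nth_deriv_cong_open[of "ball x0 1"]) (auto simp: e0_def \<eta>(2) dist_real_def)
    also have "\<dots> = (if j = k then 1 else 0)" by (auto simp: dm D_def power_0_left)
    finally show ?thesis .
  qed
  show ?thesis
  proof (rule that[of "\<lambda>k x. of_real (e0 k x)"])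
    show "test_fun (\<lambda>x. of_real (e0 k x) :: 'a)" for k by (rule test_fun_of_real[OF te0])
    show "nth_deriv j (\<lambda>x. of_real (e0 k x)) x0 = (if j = k then 1 else 0 :: 'a)" for j k
      by (simp add: nth_deriv_of_real test_fun_smooth te0 de0)
  qed (simp_all add: e0_def \<eta>)
qed

text \<open>A distribution that vanishes on test functions whose support avoids \<open>x0\<close> has, on a neighbourhood
  of \<open>x0\<close>, some finite order \<open>N\<close>. It annihilates every test function that is flat to order \<open>N\<close> at
  \<open>x0\<close>, since cutting off such a function at distance \<open>\<epsilon>\<close> leaves seminorms of size \<open>\<epsilon>\<close>.\<close>

lemma point_supported_distribution:
  fixes u :: "'a::{real_normed_field, euclidean_space} functional"
  assumes u: "distribution u" and null: "\<And>\<psi>. test_fun \<psi> \<Longrightarrow> x0 \<notin> supp \<psi> \<Longrightarrow> u \<psi> = 0"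
  obtains N c where "\<And>\<psi>. test_fun \<psi> \<Longrightarrow> u \<psi> = (\<Sum>k\<le>N. c k * nth_deriv k \<psi> x0)"
proof -
  obtain \<eta> :: "real \<Rightarrow> real" where \<eta>: "test_fun \<eta>" "\<And>x. \<bar>x\<bar> \<le> 1 \<Longrightarrow> \<eta> x = 1" "\<And>x. \<bar>x\<bar> > 3 \<Longrightarrow> \<eta> x = 0"
    using cutoff by metis
  have \<eta>d: "nth_deriv k \<eta> x = 0" if "\<bar>x\<bar> > 3" for k x
    by (rule nth_deriv_eq_0_open[of "- {-3..3}"]) (use that \<eta>(3) in \<open>auto simp: open_Compl\<close>)
  obtain e :: "nat \<Rightarrow> real \<Rightarrow> 'a" where e: "\<And>k. test_fun (e k)"
    "\<And>j k. nth_deriv j (e k) x0 = (if j = k then 1 else 0)"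
    using test_monomial[of x0] by metis
  define K where "K = {x0 - 3..x0 + 3}"
  have "compact K" by (simp add: K_def)
  obtain C N where "C > 0" and C: "\<And>f b. test_fun f \<Longrightarrow> (\<And>x. x \<notin> K \<Longrightarrow> f x = 0) \<Longrightarrow>
       (\<And>k x. k \<le> N \<Longrightarrow> norm (nth_deriv k f x) \<le> b) \<Longrightarrow> norm (u f) \<le> C * b"
    using distribution_bound[OF u \<open>compact K\<close>] by metis
  obtain M\<eta> where "M\<eta> > 0" and M\<eta>: "\<And>k x. k \<le> N \<Longrightarrow> norm (nth_deriv k \<eta> x) \<le> M\<eta>"
    using test_fun_bounded_upto[OF \<eta>(1)] by metis
  \<comment> \<open>By Taylor, \<open>r\<^sup>(\<^sup>j\<^sup>) = O(\<epsilon>\<^sup>N\<^sup>+\<^sup>1\<^sup>-\<^sup>j)\<close> on the support of the cutoff, and each derivative of the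
    cutoff costs one factor \<open>1/\<epsilon>\<close>.\<close>
  have flat: "u r = 0" if r: "test_fun r" and r0: "\<And>j. j \<le> N \<Longrightarrow> nth_deriv j r x0 = 0" for r
  proof -
    obtain M where "M > 0" and M: "\<And>j x. j \<le> Suc N \<Longrightarrow> norm (nth_deriv j r x) \<le> M * \<bar>x - x0\<bar> ^ (Suc N - j)"
      using taylor_bound[OF r r0] by metis
    define B where "B = real (Suc N) * (2 ^ N * (M\<eta> * (M * 3 ^ Suc N)))"
    have "B > 0" using \<open>M\<eta> > 0\<close> \<open>M > 0\<close> by (simp add: B_def)
    have small: "norm (u r) \<le> C * (B * \<epsilon>)" if \<epsilon>: "0 < \<epsilon>" "\<epsilon> \<le> 1" for \<epsilon>
    proof -
      define h :: "real \<Rightarrow> 'a" where "h x = of_real (\<eta> ((1/\<epsilon>) * x + (- x0 / \<epsilon>)))" for x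
      have h: "test_fun h" unfolding h_def
        by (rule test_fun_of_real[OF test_fun_affine[OF \<eta>(1)]]) (use \<epsilon> in auto)
      have hd: "nth_deriv k h x = of_real ((1/\<epsilon>) ^ k * nth_deriv k \<eta> ((x - x0) / \<epsilon>))" for k x
      proof -
        have "nth_deriv k h = (\<lambda>x. of_real ((1/\<epsilon>) ^ k *\<^sub>R nth_deriv k \<eta> ((1/\<epsilon>) * x + (- x0 / \<epsilon>))))"
          unfolding h_def
          unfolding nth_deriv_of_real[OF smooth_affine[OF test_fun_smooth[OF \<eta>(1)]]]
            nth_deriv_affine[OF test_fun_smooth[OF \<eta>(1)]] ..
        then show ?thesis by (simp add: diff_divide_distrib)
      qed
      define s where "s x = h x * r x" for x
      have s: "test_fun s" unfolding s_def by (intro test_fun_mult_smooth test_fun_smooth h r)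
      have "u (\<lambda>x. r x - s x) = 0"
      proof (rule null)
        show "test_fun (\<lambda>x. r x - s x)" by (intro test_fun_diff r s)
        have "supp (\<lambda>x. r x - s x) \<subseteq> - ball x0 \<epsilon>"
        proof (rule supp_subsetI)
          fix x assume "x \<notin> - ball x0 \<epsilon>"
          then have "\<bar>(1/\<epsilon>) * x + (- x0 / \<epsilon>)\<bar> \<le> 1"
            using \<epsilon> by (auto simp: dist_real_def field_simps abs_le_iff abs_less_iff)
          then show "r x - s x = 0" by (simp add: s_def h_def \<eta>(2) del: abs_le_iff)
        qed (auto simp: closed_Compl)
        then show "x0 \<notin> supp (\<lambda>x. r x - s x)" using \<epsilon> by auto
      qed
      then have "u r = u s" using distribution_diff[OF u r s] by simp
      moreover have "norm (u s) \<le> C * (B * \<epsilon>)"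
      proof (rule C[OF s])
        fix x assume "x \<notin> K"
        then have "\<bar>x - x0\<bar> > 3" by (auto simp: K_def)
        moreover have "\<bar>x - x0\<bar> \<le> \<bar>x - x0\<bar> / \<epsilon>" using \<epsilon> by (simp add: le_divide_eq mult_left_le)
        ultimately have "\<bar>(x - x0) / \<epsilon>\<bar> > 3" using \<epsilon> by simp
        then show "s x = 0" using hd[of 0 x] \<eta>(3)[of "(x - x0)/\<epsilon>"] by (simp add: s_def)
      next
        fix j x assume j: "j \<le> N"
        have "nth_deriv j s x = (\<Sum>k\<le>j. real (j choose k) *\<^sub>R (nth_deriv k h x * nth_deriv (j - k) r x))"
          unfolding s_def by (simp add: nth_deriv_mult test_fun_smooth h r)
        also have "norm \<dots> \<le> (\<Sum>k\<le>j. norm (real (j choose k) *\<^sub>R (nth_deriv k h x * nth_deriv (j - k) r x)))"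
          by (rule norm_sum)
        also have "\<dots> \<le> of_nat (card {..j}) * (2 ^ N * (M\<eta> * (M * 3 ^ Suc N)) * \<epsilon>)"
        proof (rule sum_bounded_above)
          fix k assume "k \<in> {..j}"
          then have k: "k \<le> j" by simp
          show "norm (real (j choose k) *\<^sub>R (nth_deriv k h x * nth_deriv (j - k) r x)) \<le> 2 ^ N * (M\<eta> * (M * 3 ^ Suc N)) * \<epsilon>"
          proof (cases "\<bar>x - x0\<bar> \<le> 3 * \<epsilon>")
            case True
            have "(j choose k) \<le> 2 ^ j" by (rule binomial_le_pow2)
            also have "\<dots> \<le> (2::nat) ^ N" using j by (intro power_increasing) auto
            finally have b: "real (j choose k) \<le> 2 ^ N"
              by (metis of_nat_le_iff of_nat_numeral of_nat_power)
            have h1: "norm (nth_deriv k h x) \<le> (1/\<epsilon>) ^ k * M\<eta>"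
              unfolding hd norm_of_real abs_mult using \<epsilon> M\<eta>[of k] k j
              by (intro mult_mono) (auto simp: power_abs)
            have "norm (nth_deriv (j - k) r x) \<le> M * \<bar>x - x0\<bar> ^ (Suc N - (j - k))"
              using j by (intro M) auto
            also have "\<dots> \<le> M * (3 * \<epsilon>) ^ (Suc N - (j - k))"
              using True \<open>M > 0\<close> by (intro mult_left_mono power_mono) auto
            also have "\<dots> = M * (3 ^ (Suc N - (j - k)) * (\<epsilon> ^ k * \<epsilon> ^ (Suc N - j)))"
              using j k by (simp add: power_mult_distrib power_add[symmetric] add.commute)
            also have "\<dots> \<le> M * (3 ^ Suc N * (\<epsilon> ^ k * \<epsilon>))"
            proof -
              have "\<epsilon> ^ (Suc N - j) \<le> \<epsilon> ^ 1" using \<epsilon> j by (intro power_decreasing) auto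
              then show ?thesis
                using \<open>M > 0\<close> \<epsilon> by (intro mult_left_mono mult_mono power_increasing) auto
            qed
            finally have r1: "norm (nth_deriv (j - k) r x) \<le> M * (3 ^ Suc N * (\<epsilon> ^ k * \<epsilon>))" .
            have "norm (real (j choose k) *\<^sub>R (nth_deriv k h x * nth_deriv (j - k) r x))
               = real (j choose k) * (norm (nth_deriv k h x) * norm (nth_deriv (j - k) r x))"
              by (simp add: norm_mult)
            also have "\<dots> \<le> 2 ^ N * (((1/\<epsilon>) ^ k * M\<eta>) * (M * (3 ^ Suc N * (\<epsilon> ^ k * \<epsilon>))))"
              using b h1 r1 \<epsilon> \<open>M\<eta> > 0\<close> by (intro mult_mono) auto
            also have "\<dots> = 2 ^ N * (M\<eta> * (M * 3 ^ Suc N)) * \<epsilon>"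
              using \<epsilon> by (simp add: power_one_over)
            finally show ?thesis .
          next
            case False
            then have "\<bar>(x - x0) / \<epsilon>\<bar> > 3" using \<epsilon> by (simp add: field_simps)
            then have "nth_deriv k h x = 0" by (simp add: hd \<eta>d)
            then show ?thesis using \<epsilon> \<open>M\<eta> > 0\<close> \<open>M > 0\<close> by simp
          qed
        qed
        also have "\<dots> \<le> B * \<epsilon>"
          using j \<epsilon> \<open>M\<eta> > 0\<close> \<open>M > 0\<close> by (simp add: B_def mult_right_mono)
        finally show "norm (nth_deriv j s x) \<le> B * \<epsilon>" .
      qed
      ultimately show ?thesis by simp
    qed
    have "norm (u r) \<le> 0"
    proof (rule tendsto_lowerbound)
      show "((\<lambda>\<epsilon>. C * (B * \<epsilon>)) \<longlongrightarrow> 0) (at_right 0)"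
        by (auto intro!: tendsto_eq_intros)
      show "eventually (\<lambda>\<epsilon>. norm (u r) \<le> C * (B * \<epsilon>)) (at_right 0)"
        using eventually_at_right_real[OF zero_less_one] by (rule eventually_mono) (use small in auto)
    qed auto
    then show ?thesis by simp
  qed
  show ?thesis
  proof (rule that[of "\<lambda>k. u (e k)" N])
    fix \<psi> :: "real \<Rightarrow> 'a" assume \<psi>: "test_fun \<psi>"
    define q where "q x = (\<Sum>k\<le>N. nth_deriv k \<psi> x0 * e k x)" for x
    have q: "test_fun q" unfolding q_def by (intro test_fun_sum test_fun_mult_left e)
    have dq: "nth_deriv j q x0 = (\<Sum>k\<le>N. nth_deriv k \<psi> x0 * nth_deriv j (e k) x0)" for j
    proof -
      have sm: "smooth (\<lambda>x. b * e k x)" for b k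
        by (rule test_fun_smooth[OF test_fun_mult_left[OF e(1)]])
      have dm: "nth_deriv j (\<lambda>x. b * e k x) = (\<lambda>x. b * nth_deriv j (e k) x)" for b k
        by (rule nth_deriv_linear[OF test_fun_smooth[OF e(1)] bounded_linear_mult_right])
      have "smooth (\<lambda>x. \<Sum>k\<le>n. nth_deriv k \<psi> x0 * e k x) \<and>
        nth_deriv j (\<lambda>x. \<Sum>k\<le>n. nth_deriv k \<psi> x0 * e k x) = (\<lambda>x. \<Sum>k\<le>n. nth_deriv k \<psi> x0 * nth_deriv j (e k) x)" for n
      proof (induction n)
        case (Suc n)
        then show ?case
          using sm[of "nth_deriv (Suc n) \<psi> x0" "Suc n"] dm[of "nth_deriv (Suc n) \<psi> x0" "Suc n"]
          by (simp add: smooth_add nth_deriv_add del: nth_deriv_0)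
      qed (use sm[of _ 0] dm[of _ 0] in simp_all)
      then show ?thesis by (simp add: q_def[abs_def])
    qed
    have "u (\<lambda>x. \<psi> x - q x) = 0"
    proof (rule flat)
      show "test_fun (\<lambda>x. \<psi> x - q x)" by (intro test_fun_diff \<psi> q)
      fix j assume "j \<le> N"
      then show "nth_deriv j (\<lambda>x. \<psi> x - q x) x0 = 0"
        by (simp add: nth_deriv_diff test_fun_smooth \<psi> q dq e(2) if_distrib[of "\<lambda>x. _ * x"] cong: if_cong)
    qed
    then have "u \<psi> = u q" using distribution_diff[OF u \<psi> q] by simp
    also have "\<dots> = (\<Sum>k\<le>N. u (\<lambda>x. nth_deriv k \<psi> x0 * e k x))"
      unfolding q_def by (intro distribution_sum u test_fun_mult_left e)
    also have "\<dots> = (\<Sum>k\<le>N. u (e k) * nth_deriv k \<psi> x0)"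
      by (intro sum.cong refl) (use distribution_mult[OF u e(1)] in \<open>simp add: mult.commute[of "u _"]\<close>)
    finally show "u \<psi> = (\<Sum>k\<le>N. u (e k) * nth_deriv k \<psi> x0)" .
  qed
qed

section \<open>Integration tools\<close>

lemma dominated_convergence_within:
  fixes s :: "real \<Rightarrow> 'b \<Rightarrow> 'c::{banach, second_countable_topology}"
  assumes "\<And>t. t \<in> S - {a} \<Longrightarrow> s t \<in> borel_measurable M" "l \<in> borel_measurable M" "integrable M w"
    and lim: "AE x in M. ((\<lambda>t. s t x) \<longlongrightarrow> l x) (at a within S)"
    and bound: "\<And>t. t \<in> S - {a} \<Longrightarrow> AE x in M. norm (s t x) \<le> w x"
  shows "((\<lambda>t. integral\<^sup>L M (s t)) \<longlongrightarrow> integral\<^sup>L M l) (at a within S)"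
  unfolding tendsto_at_iff_sequentially o_def
proof (intro allI impI)
  fix X assume X: "\<forall>i. X i \<in> S - {a}" "X \<longlonglongrightarrow> a"
  show "(\<lambda>i. integral\<^sup>L M (s (X i))) \<longlonglongrightarrow> integral\<^sup>L M l"
  proof (rule integral_dominated_convergence[where w=w])
    show "AE x in M. (\<lambda>i. s (X i) x) \<longlonglongrightarrow> l x"
      using lim by eventually_elim (use X in \<open>auto simp: tendsto_at_iff_sequentially o_def\<close>)
  qed (use assms X in auto)
qed

lemma sigma_finite_lebesgue: "sigma_finite_measure (lebesgue :: 'a::euclidean_space measure)"
proof
  show "\<exists>A. countable A \<and> A \<subseteq> sets (lebesgue :: 'a measure) \<and> \<Union>A = space (lebesgue :: 'a measure) \<and>
      (\<forall>a\<in>A. emeasure (lebesgue :: 'a measure) a \<noteq> \<infinity>)"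
  proof (intro exI[of _ "range (\<lambda>n. cball (0::'a) (real n))"] conjI ballI)
    show "\<Union>(range (\<lambda>n. cball (0::'a) (real n))) = space lebesgue"
      by (auto simp: real_arch_simple)
    fix a assume "a \<in> range (\<lambda>n. cball (0::'a) (real n))"
    then have "a \<in> lmeasurable" by auto
    then show "emeasure lebesgue a \<noteq> \<infinity>" unfolding infinity_ennreal_def by (rule fmeasurableD2)
  qed auto
qed

interpretation lebesgue_pair: pair_sigma_finite "lebesgue :: real measure" "lebesgue :: real measure"
  by (intro pair_sigma_finite.intro sigma_finite_lebesgue)

lemma borel_measurable_lebesgue: "f \<in> borel_measurable borel \<Longrightarrow> f \<in> borel_measurable lebesgue"
  by (rule measurable_completion) simp

lemma continuous_measurable_lebesgue: "continuous_on UNIV f \<Longrightarrow> f \<in> borel_measurable lebesgue"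
  by (intro borel_measurable_lebesgue borel_measurable_continuous_onI)

lemma lebesgue_fst: "(fst :: real \<times> real \<Rightarrow> real) \<in> borel_measurable (lebesgue \<Otimes>\<^sub>M lebesgue)"
  and lebesgue_snd: "(snd :: real \<times> real \<Rightarrow> real) \<in> borel_measurable (lebesgue \<Otimes>\<^sub>M lebesgue)"
proof -
  have id: "(\<lambda>x::real. x) \<in> borel_measurable lebesgue" by (intro continuous_measurable_lebesgue continuous_intros)
  show "(fst :: real \<times> real \<Rightarrow> real) \<in> borel_measurable (lebesgue \<Otimes>\<^sub>M lebesgue)"
    by (rule measurable_compose[OF measurable_fst id])
  show "(snd :: real \<times> real \<Rightarrow> real) \<in> borel_measurable (lebesgue \<Otimes>\<^sub>M lebesgue)"
    by (rule measurable_compose[OF measurable_snd id])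
qed

lemma test_fun_integrable:
  fixes \<psi> :: "real \<Rightarrow> 'a::euclidean_space"
  assumes "test_fun \<psi>" shows "integrable lebesgue \<psi>"
proof -
  obtain R where "R > 0" and R: "\<And>x n. \<bar>x\<bar> > R \<Longrightarrow> nth_deriv n \<psi> x = 0" using test_fun_radius[OF assms] by metis
  show ?thesis
    by (rule lint_Icc(1)[of "-R" R]) (use R[of _ 0] smooth_continuous[OF test_fun_smooth[OF assms]] in auto)
qed

lemma bounded_times_test_integrable:
  fixes h \<psi> :: "real \<Rightarrow> 'a::{real_normed_field, euclidean_space}"
  assumes "h \<in> borel_measurable lebesgue" "\<And>x. norm (h x) \<le> M" "integrable lebesgue \<psi>"
  shows "integrable lebesgue (\<lambda>x. h x * \<psi> x)"
proof (rule Bochner_Integration.integrable_bound[of _ "\<lambda>x. M * norm (\<psi> x)"])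
  show "integrable lebesgue (\<lambda>x. M * norm (\<psi> x))" using assms(3) by simp
  show "(\<lambda>x. h x * \<psi> x) \<in> borel_measurable lebesgue"
    by (intro borel_measurable_times assms(1) borel_measurable_integrable[OF assms(3)])
  show "AE x in lebesgue. norm (h x * \<psi> x) \<le> norm (M * norm (\<psi> x))"
    using assms(2) order_trans[OF norm_ge_zero assms(2)[of 0]]
    by (intro AE_I2) (simp add: norm_mult abs_mult mult_right_mono)
qed

section \<open>Causal convolutions\<close>

text \<open>The kernel \<open>k\<close> restricted to positive times. The value at \<open>0\<close> is set to \<open>0\<close>; it matters neither
  for the integrals nor, when \<open>k 0 = 0\<close>, for continuity.\<close>

definition causal :: "(real \<Rightarrow> real) \<Rightarrow> real \<Rightarrow> real" where
  "causal k t = (if t > 0 then k t else 0)"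

text \<open>For \<open>\<sigma> = 1\<close> the data propagate to the right, for \<open>\<sigma> = -1\<close> to the left. Both sides of \<open>x0\<close>
  are treated at once by means of \<open>\<sigma>\<close>; the side on which a solution is sought is
  \<open>{y. \<sigma> * (y - x0) < 0}\<close>.\<close>

definition causal_conv :: "(real \<Rightarrow> real) \<Rightarrow> real \<Rightarrow> (real \<Rightarrow> 'a::{banach,second_countable_topology}) \<Rightarrow> real \<Rightarrow> 'a" where
  "causal_conv k \<sigma> G y = (LINT x|lebesgue. causal k (\<sigma> * (y - x)) *\<^sub>R G x)"

lemma causal_measurable: "continuous_on UNIV k \<Longrightarrow> causal k \<in> borel_measurable borel"
  unfolding causal_def[abs_def] 
  by (intro measurable_If borel_measurable_continuous_onI) auto

lemma causal_bounded:
  assumes "continuous_on UNIV k"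
  obtains M where "M > 0" "\<And>t. \<bar>t\<bar> \<le> r \<Longrightarrow> \<bar>causal k t\<bar> \<le> M"
proof -
  have "bounded (k ` {-r..r})"
    by (intro compact_imp_bounded compact_continuous_image continuous_on_subset[OF assms] compact_Icc) auto
  then obtain M where M: "M > 0" "\<And>x. x \<in> {-r..r} \<Longrightarrow> norm (k x) \<le> M"
    unfolding bounded_pos by auto
  show ?thesis
    by (rule that[OF M(1)]) (use M in \<open>auto simp: causal_def\<close>)
qed

lemma causal_kernel_measurable:
  assumes "continuous_on UNIV k"
  shows "(\<lambda>x. causal k (\<sigma> * (y - x))) \<in> borel_measurable lebesgue"
    "(\<lambda>y. causal k (\<sigma> * (y - x))) \<in> borel_measurable lebesgue"
  by (intro borel_measurable_lebesgue measurable_compose[OF _ causal_measurable[OF assms]]; measurable)+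

lemma continuous_causal_conv:
  fixes G :: "real \<Rightarrow> 'a::{banach,second_countable_topology}"
  assumes k: "continuous_on UNIV k" and G: "integrable lebesgue G" "\<And>x. x \<notin> {0..1} \<Longrightarrow> G x = 0"
    and \<sigma>: "\<bar>\<sigma>\<bar> = 1"
  shows "continuous_on S (causal_conv k \<sigma> G)"
proof (rule continuous_at_imp_continuous_on, rule ballI)
  fix y0
  obtain M where "M > 0" and M: "\<And>t. \<bar>t\<bar> \<le> \<bar>y0\<bar> + 2 \<Longrightarrow> \<bar>causal k t\<bar> \<le> M"
    using causal_bounded[OF k, of "\<bar>y0\<bar> + 2"] by metis
  have "((\<lambda>y. LINT x|lebesgue. causal k (\<sigma> * (y - x)) *\<^sub>R G x) \<longlongrightarrow> (LINT x|lebesgue. causal k (\<sigma> * (y0 - x)) *\<^sub>R G x))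
     (at y0 within ball y0 1)"
  proof (rule dominated_convergence_within[where w="\<lambda>x. M * norm (G x)"])
    show "(\<lambda>x. causal k (\<sigma> * (y - x)) *\<^sub>R G x) \<in> borel_measurable lebesgue" for y
      by (intro borel_measurable_scaleR causal_kernel_measurable k borel_measurable_integrable G)
    then show "(\<lambda>x. causal k (\<sigma> * (y0 - x)) *\<^sub>R G x) \<in> borel_measurable lebesgue" .
    show "integrable lebesgue (\<lambda>x. M * norm (G x))" using G by simp
    have "{y0} \<in> null_sets lebesgue" by simp
    then have "AE x in lebesgue. x \<noteq> y0" by (rule AE_I'[of "{y0}"]) auto
    then show "AE x in lebesgue. ((\<lambda>y. causal k (\<sigma> * (y - x)) *\<^sub>R G x) \<longlongrightarrow> causal k (\<sigma> * (y0 - x)) *\<^sub>R G x) (at y0 within ball y0 1)"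
    proof eventually_elim
      case (elim x)
      have c: "isCont k t" for t using k by (simp add: continuous_on_eq_continuous_at)
      have "isCont (causal k) t" if "t \<noteq> 0" for t
      proof (cases "t > 0")
        case True
        then have "eventually (\<lambda>s. causal k s = k s) (nhds t)"
          by (auto simp: causal_def eventually_nhds intro!: exI[of _ "{0<..}"])
        then show ?thesis using c by (simp add: isCont_cong)
      next
        case False
        then have "eventually (\<lambda>s. causal k s = 0) (nhds t)"
          using that by (auto simp: causal_def eventually_nhds intro!: exI[of _ "{..<0}"])
        then show ?thesis by (simp add: isCont_cong)
      qed
      moreover have "\<sigma> * (y0 - x) \<noteq> 0" using elim \<sigma> by auto
      ultimately have "isCont (causal k) (\<sigma> * (y0 - x))" by blast
      then show ?case
        by (intro tendsto_intros isCont_tendsto_compose[of _ "causal k"])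
    qed
    show "AE x in lebesgue. norm (causal k (\<sigma> * (y - x)) *\<^sub>R G x) \<le> M * norm (G x)" if "y \<in> ball y0 1 - {y0}" for y
    proof (rule AE_I2)
      fix x
      show "norm (causal k (\<sigma> * (y - x)) *\<^sub>R G x) \<le> M * norm (G x)"
      proof (cases "x \<in> {0..1}")
        case True
        then have "\<bar>\<sigma> * (y - x)\<bar> \<le> \<bar>y0\<bar> + 2" using that \<sigma> by (auto simp: abs_mult dist_real_def)
        then show ?thesis using M by (simp add: mult_right_mono)
      qed (simp add: G)
    qed
  qed
  then show "isCont (causal_conv k \<sigma> G) y0"
    unfolding isCont_def causal_conv_def[abs_def] by (simp add: at_within_open[of y0 "ball y0 1"])
qed

lemma integrable_causal:
  fixes G :: "real \<Rightarrow> 'a::{banach,second_countable_topology}"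
  assumes k: "continuous_on UNIV k" and G: "integrable lebesgue G" "\<And>x. x \<notin> {0..1} \<Longrightarrow> G x = 0"
    and \<sigma>: "\<bar>\<sigma>\<bar> = 1"
  shows "integrable lebesgue (\<lambda>x. causal k (\<sigma> * (y - x)) *\<^sub>R G x)"
proof -
  obtain M where "M > 0" and M: "\<And>t. \<bar>t\<bar> \<le> \<bar>y\<bar> + 1 \<Longrightarrow> \<bar>causal k t\<bar> \<le> M"
    using causal_bounded[OF k, of "\<bar>y\<bar> + 1"] by metis
  show ?thesis
  proof (rule Bochner_Integration.integrable_bound[of _ "\<lambda>x. M * norm (G x)"])
    show "integrable lebesgue (\<lambda>x. M * norm (G x))" using G by simp
    show "(\<lambda>x. causal k (\<sigma> * (y - x)) *\<^sub>R G x) \<in> borel_measurable lebesgue"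
      by (intro borel_measurable_scaleR causal_kernel_measurable k borel_measurable_integrable G)
    show "AE x in lebesgue. norm (causal k (\<sigma> * (y - x)) *\<^sub>R G x) \<le> norm (M * norm (G x))"
    proof (rule AE_I2)
      fix x
      show "norm (causal k (\<sigma> * (y - x)) *\<^sub>R G x) \<le> norm (M * norm (G x))"
      proof (cases "x \<in> {0..1}")
        case True
        then have "\<bar>\<sigma> * (y - x)\<bar> \<le> \<bar>y\<bar> + 1" using \<sigma> by (auto simp: abs_mult)
        then show ?thesis using M \<open>M > 0\<close> by (simp add: mult_right_mono)
      qed (simp add: G)
    qed
  qed
qed

lemma has_vector_derivative_quotientI:
  fixes f :: "real \<Rightarrow> 'a::real_normed_vector"
  assumes "((\<lambda>y. (1 / (y - x)) *\<^sub>R (f y - f x)) \<longlongrightarrow> d) (at x)"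
  shows "(f has_vector_derivative d) (at x)"
  unfolding has_vector_derivative_def has_derivative_within
proof (intro conjI bounded_linear_scaleR_left)
  have "((\<lambda>y. norm ((1 / (y - x)) *\<^sub>R (f y - f x) - d)) \<longlongrightarrow> 0) (at x)"
    using assms by (simp add: LIM_zero_iff tendsto_norm_zero_iff)
  moreover have eq: "norm ((1 / (y - x)) *\<^sub>R (f y - f x) - d) = norm ((1 / norm (y - x)) *\<^sub>R (f y - (f x + (y - x) *\<^sub>R d)))"
    if "y \<noteq> x" for y
  proof -
    have "(1 / (y - x)) *\<^sub>R (f y - f x) - d = (1 / (y - x)) *\<^sub>R (f y - (f x + (y - x) *\<^sub>R d))"
      using that by (simp add: scaleR_diff_right diff_diff_eq[symmetric])
    then show ?thesis by simp
  qed
  ultimately have "((\<lambda>y. norm ((1 / norm (y - x)) *\<^sub>R (f y - (f x + (y - x) *\<^sub>R d)))) \<longlongrightarrow> 0) (at x)"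
    by (subst (asm) LIM_cong[OF refl eq refl]) auto
  then show "((\<lambda>y. (1 / norm (y - x)) *\<^sub>R (f y - (f x + (y - x) *\<^sub>R d))) \<longlongrightarrow> 0) (at x)"
    by (rule tendsto_norm_zero_cancel)
qed

text \<open>The data are merely integrable. Still the convolution is differentiable everywhere, because
  the kernel vanishes at \<open>0\<close> and hence its causal extension is locally Lipschitz.\<close>

lemma has_vector_derivative_causal_conv:
  fixes G :: "real \<Rightarrow> 'a::{banach,second_countable_topology}"
  assumes E: "\<And>t. (E has_real_derivative E1 t) (at t)" "E 0 = 0" and E1: "continuous_on UNIV E1"
    and G: "integrable lebesgue G" "\<And>x. x \<notin> {0..1} \<Longrightarrow> G x = 0" and \<sigma>: "\<bar>\<sigma>\<bar> = 1"
  shows "(causal_conv E \<sigma> G has_vector_derivative \<sigma> *\<^sub>R causal_conv E1 \<sigma> G y0) (at y0)"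
proof -
  have cE: "continuous_on UNIV E"
    using E(1) by (meson DERIV_isCont continuous_at_imp_continuous_on)
  have "bounded (E1 ` {0..\<bar>y0\<bar> + 2})"
    by (intro compact_imp_bounded compact_continuous_image continuous_on_subset[OF E1] compact_Icc) auto
  then obtain M where "M > 0" and M0: "\<And>t. 0 \<le> t \<Longrightarrow> t \<le> \<bar>y0\<bar> + 2 \<Longrightarrow> \<bar>E1 t\<bar> \<le> M"
    unfolding bounded_pos by auto
  have causalE: "causal E t = E (max t 0)" for t by (auto simp: causal_def max_def E(2))
  have lip: "\<bar>causal E s - causal E t\<bar> \<le> M * \<bar>s - t\<bar>" if "\<bar>s\<bar> \<le> \<bar>y0\<bar> + 2" "\<bar>t\<bar> \<le> \<bar>y0\<bar> + 2" for s t
  proof -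
    have "norm (E (max s 0) - E (max t 0)) \<le> M * norm (max s 0 - max t 0)"
    proof (rule field_differentiable_bound[of "{0..\<bar>y0\<bar> + 2}"])
      show "(E has_field_derivative E1 z) (at z within {0..\<bar>y0\<bar> + 2})" for z
        using E(1) by (rule has_field_derivative_at_within)
    qed (use M0 that in auto)
    also have "\<dots> \<le> M * \<bar>s - t\<bar>" using \<open>M > 0\<close> by (intro mult_left_mono) auto
    finally show ?thesis by (simp add: causalE)
  qed
  have dE: "(causal E has_real_derivative causal E1 t) (at t)" if "t \<noteq> 0" for t
  proof (cases "t > 0")
    case True
    from E(1) have "(causal E has_real_derivative E1 t) (at t)"
      by (rule has_field_derivative_transform_within_open[of _ _ _ "{0<..}"]) (use True in \<open>auto simp: causal_def\<close>)
    then show ?thesis using True by (simp add: causal_def)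
  next
    case False
    have "((\<lambda>t. 0) has_real_derivative 0) (at t)" by simp
    then have "(causal E has_real_derivative 0) (at t)"
      by (rule has_field_derivative_transform_within_open[of _ _ _ "{..<0}"]) (use False that in \<open>auto simp: causal_def\<close>)
    then show ?thesis using False by (simp add: causal_def)
  qed
  let ?q = "\<lambda>y x. ((causal E (\<sigma> * (y - x)) - causal E (\<sigma> * (y0 - x))) / (y - y0)) *\<^sub>R G x"
  have "((\<lambda>y. LINT x|lebesgue. ?q y x) \<longlongrightarrow> (LINT x|lebesgue. (\<sigma> * causal E1 (\<sigma> * (y0 - x))) *\<^sub>R G x))
     (at y0 within ball y0 1)"
  proof (rule dominated_convergence_within[where w="\<lambda>x. M * norm (G x)"])
    show "?q y \<in> borel_measurable lebesgue" for y
      by (intro borel_measurable_scaleR borel_measurable_divide borel_measurable_diff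
          causal_kernel_measurable cE borel_measurable_integrable G borel_measurable_const)
    show "(\<lambda>x. (\<sigma> * causal E1 (\<sigma> * (y0 - x))) *\<^sub>R G x) \<in> borel_measurable lebesgue"
      by (intro borel_measurable_scaleR borel_measurable_times 
          causal_kernel_measurable E1 borel_measurable_integrable G borel_measurable_const)
    show "integrable lebesgue (\<lambda>x. M * norm (G x))" using G by simp
    have "{y0} \<in> null_sets lebesgue" by simp
    then have "AE x in lebesgue. x \<noteq> y0" by (rule AE_I'[of "{y0}"]) auto
    then show "AE x in lebesgue. ((\<lambda>y. ?q y x) \<longlongrightarrow> (\<sigma> * causal E1 (\<sigma> * (y0 - x))) *\<^sub>R G x) (at y0 within ball y0 1)"
    proof eventually_elim
      case (elim x)
      have "\<sigma> * (y0 - x) \<noteq> 0" using elim \<sigma> by auto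
      have "((\<lambda>y. \<sigma> * (y - x)) has_real_derivative \<sigma>) (at y0)"
        by (auto intro!: derivative_eq_intros)
      from DERIV_chain2[of "causal E" _ "\<lambda>y. \<sigma> * (y - x)" y0 \<sigma> UNIV, OF dE[OF \<open>\<sigma> * (y0 - x) \<noteq> 0\<close>] this]
      have "((\<lambda>y. causal E (\<sigma> * (y - x))) has_real_derivative causal E1 (\<sigma> * (y0 - x)) * \<sigma>) (at y0)" .
      then have "((\<lambda>y. (causal E (\<sigma> * (y - x)) - causal E (\<sigma> * (y0 - x))) / (y - y0)) \<longlongrightarrow> \<sigma> * causal E1 (\<sigma> * (y0 - x))) (at y0)"
        by (simp add: has_field_derivative_iff mult.commute)
      then show ?case by (intro tendsto_intros) (rule tendsto_within_subset, auto)
    qed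
    show "AE x in lebesgue. norm (?q y x) \<le> M * norm (G x)" if y: "y \<in> ball y0 1 - {y0}" for y
    proof (rule AE_I2)
      fix x
      show "norm (?q y x) \<le> M * norm (G x)"
      proof (cases "x \<in> {0..1}")
        case True
        then have "\<bar>\<sigma> * (y - x)\<bar> \<le> \<bar>y0\<bar> + 2" "\<bar>\<sigma> * (y0 - x)\<bar> \<le> \<bar>y0\<bar> + 2"
          using y \<sigma> by (auto simp: abs_mult dist_real_def)
        from lip[OF this] have "\<bar>causal E (\<sigma> * (y - x)) - causal E (\<sigma> * (y0 - x))\<bar> \<le> M * \<bar>y - y0\<bar>"
          using \<sigma> by (simp add: right_diff_distrib[symmetric] abs_mult)
        then have "\<bar>(causal E (\<sigma> * (y - x)) - causal E (\<sigma> * (y0 - x))) / (y - y0)\<bar> \<le> M"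
          using y by (auto simp: abs_divide divide_le_eq)
        then show ?thesis by (simp add: mult_right_mono del: abs_divide)
      qed (simp add: G)
    qed
  qed
  moreover have "(LINT x|lebesgue. ?q y x) = (1 / (y - y0)) *\<^sub>R (causal_conv E \<sigma> G y - causal_conv E \<sigma> G y0)" for y
  proof -
    have "(LINT x|lebesgue. ?q y x) = (LINT x|lebesgue. (1 / (y - y0)) *\<^sub>R (causal E (\<sigma> * (y - x)) *\<^sub>R G x - causal E (\<sigma> * (y0 - x)) *\<^sub>R G x))"
      by (simp add: scaleR_diff_left diff_divide_distrib scaleR_diff_right)
    also have "\<dots> = (1 / (y - y0)) *\<^sub>R (LINT x|lebesgue. causal E (\<sigma> * (y - x)) *\<^sub>R G x - causal E (\<sigma> * (y0 - x)) *\<^sub>R G x)"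
      by (rule integral_scaleR_right)
    also have "(LINT x|lebesgue. causal E (\<sigma> * (y - x)) *\<^sub>R G x - causal E (\<sigma> * (y0 - x)) *\<^sub>R G x) =
        causal_conv E \<sigma> G y - causal_conv E \<sigma> G y0"
      unfolding causal_conv_def by (intro Bochner_Integration.integral_diff integrable_causal cE G \<sigma>)
    finally show ?thesis .
  qed
  moreover have "(LINT x|lebesgue. (\<sigma> * causal E1 (\<sigma> * (y0 - x))) *\<^sub>R G x) = \<sigma> *\<^sub>R causal_conv E1 \<sigma> G y0"
    by (simp add: causal_conv_def flip: scaleR_scaleR)
  ultimately have "((\<lambda>y. (1 / (y - y0)) *\<^sub>R (causal_conv E \<sigma> G y - causal_conv E \<sigma> G y0)) \<longlongrightarrow> \<sigma> *\<^sub>R causal_conv E1 \<sigma> G y0) (at y0)"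
    by (simp add: at_within_open[of y0 "ball y0 1"])
  then show ?thesis by (rule has_vector_derivative_quotientI)
qed

lemma causal_conv_fubini:
  fixes G h :: "real \<Rightarrow> 'a::{real_normed_field, euclidean_space}"
  assumes k: "continuous_on UNIV k" and G: "integrable lebesgue G" "\<And>x. x \<notin> {0..1} \<Longrightarrow> G x = 0"
    and \<sigma>: "\<bar>\<sigma>\<bar> = 1" and h: "integrable lebesgue h" "\<And>y. \<bar>y\<bar> > R \<Longrightarrow> h y = 0"
  shows "(LINT y|lebesgue. causal_conv k \<sigma> G y * h y) =
    (LINT x|lebesgue. G x * (LINT y|lebesgue. causal k (\<sigma> * (y - x)) *\<^sub>R h y))"
proof -
  let ?L = "lebesgue \<Otimes>\<^sub>M lebesgue :: (real \<times> real) measure"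
  let ?F = "\<lambda>x y. causal k (\<sigma> * (y - x)) *\<^sub>R (G x * h y)"
  obtain M where "M > 0" and M: "\<And>t. \<bar>t\<bar> \<le> \<bar>R\<bar> + 1 \<Longrightarrow> \<bar>causal k t\<bar> \<le> M"
    using causal_bounded[OF k, of "\<bar>R\<bar> + 1"] by metis
  have mG: "(\<lambda>p. G (fst p)) \<in> borel_measurable ?L" and mh: "(\<lambda>p. h (snd p)) \<in> borel_measurable ?L"
    by (intro measurable_compose[OF measurable_fst] measurable_compose[OF measurable_snd] borel_measurable_integrable G h)+
  have mk: "(\<lambda>p. causal k (\<sigma> * (snd p - fst p))) \<in> borel_measurable ?L"
    by (intro measurable_compose[OF _ causal_measurable[OF k]] borel_measurable_times borel_measurable_const
        borel_measurable_diff lebesgue_fst lebesgue_snd)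
  have mF: "case_prod ?F \<in> borel_measurable ?L"
    unfolding split_beta by (intro borel_measurable_scaleR borel_measurable_times mk mG mh)
  have bound: "integrable ?L (\<lambda>p. M * (norm (G (fst p)) * norm (h (snd p))))"
  proof (rule lebesgue_pair.Fubini_integrable)
    show "(\<lambda>p. M * (norm (G (fst p)) * norm (h (snd p)))) \<in> borel_measurable ?L"
      by (intro borel_measurable_times borel_measurable_const
          measurable_compose[OF mG borel_measurable_norm] measurable_compose[OF mh borel_measurable_norm])
    show "integrable lebesgue (\<lambda>x. LINT y|lebesgue. norm (M * (norm (G (fst (x, y))) * norm (h (snd (x, y))))))"
      using G h by (simp add: abs_mult)
    show "AE x in lebesgue. integrable lebesgue (\<lambda>y. M * (norm (G (fst (x, y))) * norm (h (snd (x, y)))))"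
      using h by simp
  qed
  have int: "integrable ?L (case_prod ?F)"
  proof (rule Bochner_Integration.integrable_bound[OF bound mF], rule AE_I2)
    fix p :: "real \<times> real"
    obtain x y where p: "p = (x, y)" by (cases p)
    show "norm (case_prod ?F p) \<le> norm (M * (norm (G (fst p)) * norm (h (snd p))))"
    proof (cases "x \<in> {0..1} \<and> \<bar>y\<bar> \<le> R")
      case True
      then have "\<bar>\<sigma> * (y - x)\<bar> \<le> \<bar>R\<bar> + 1" using \<sigma> by (auto simp: abs_mult)
      then have "\<bar>causal k (\<sigma> * (y - x))\<bar> \<le> M" by (rule M)
      then show ?thesis using \<open>M > 0\<close> by (simp add: p norm_mult abs_mult mult_right_mono)
    qed (use G(2)[of x] h(2)[of y] in \<open>auto simp: p\<close>)
  qed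
  have "(LINT y|lebesgue. causal_conv k \<sigma> G y * h y) = (LINT y|lebesgue. (LINT x|lebesgue. ?F x y))"
    unfolding causal_conv_def by (simp flip: integral_mult_left_zero)
  also have "\<dots> = (LINT x|lebesgue. (LINT y|lebesgue. ?F x y))"
    by (rule lebesgue_pair.Fubini_integral[OF int])
  also have "\<dots> = (LINT x|lebesgue. G x * (LINT y|lebesgue. causal k (\<sigma> * (y - x)) *\<^sub>R h y))"
    by (simp flip: integral_mult_right_zero)
  finally show ?thesis .
qed

section \<open>The equation with constant coefficients\<close>

lemma fundamental_solution:
  fixes c :: real
  obtains E E1 :: "real \<Rightarrow> real" where
    "\<And>t. (E has_real_derivative E1 t) (at t)" "\<And>t. (E1 has_real_derivative - c * E t) (at t)"
    "E 0 = 0" "E1 0 = 1"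
proof -
  consider "c > 0" | "c = 0" | "c < 0" by linarith
  then show ?thesis
  proof cases
    case 1
    then have "sqrt c > 0" "sqrt c * sqrt c = c" by auto
    then show ?thesis
      by (intro that[of "\<lambda>t. sin (sqrt c * t) / sqrt c" "\<lambda>t. cos (sqrt c * t)"])
         (auto intro!: derivative_eq_intros simp: field_simps)
  next
    case 2
    then show ?thesis by (intro that[of "\<lambda>t. t" "\<lambda>t. 1"]) (auto intro!: derivative_eq_intros)
  next
    case 3
    define w where "w = sqrt (- c)"
    have "w > 0" "c = - (w * w)" using 3 by (auto simp: w_def)
    then show ?thesis
      by (intro that[of "\<lambda>t. sinh (w * t) / w" "\<lambda>t. cosh (w * t)"])
         (auto intro!: derivative_eq_intros simp: field_simps)
  qed
qed

lemma kernel_integration_by_parts: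
  fixes \<psi> :: "real \<Rightarrow> 'a::{real_normed_field, euclidean_space}"
  assumes E: "\<And>t. (E has_real_derivative E1 t) (at t)" "\<And>t. (E1 has_real_derivative - c * E t) (at t)"
    "E 0 = 0" "E1 0 = 1"
    and \<psi>: "test_fun \<psi>" and \<sigma>: "\<bar>\<sigma>\<bar> = 1" and b: "b \<ge> 0"
  shows "((\<lambda>s. E s *\<^sub>R (nth_deriv 2 \<psi> (x + \<sigma> * s) + c *\<^sub>R \<psi> (x + \<sigma> * s))) has_integral
    (E b * \<sigma>) *\<^sub>R nth_deriv 1 \<psi> (x + \<sigma> * b) - E1 b *\<^sub>R \<psi> (x + \<sigma> * b) + \<psi> x) {0..b}"
proof -
  have \<sigma>2: "\<sigma> * \<sigma> = 1" using \<sigma> by (auto simp: abs_real_def split: if_splits)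
  define W where "W s = (E s * \<sigma>) *\<^sub>R nth_deriv 1 \<psi> (x + \<sigma> * s) - E1 s *\<^sub>R \<psi> (x + \<sigma> * s)" for s
  have d: "((\<lambda>s. nth_deriv n \<psi> (x + \<sigma> * s)) has_vector_derivative \<sigma> *\<^sub>R nth_deriv (Suc n) \<psi> (x + \<sigma> * s)) (at s)" for n s
  proof -
    have sm: "smooth (nth_deriv n \<psi>)" by (intro smooth_nth_deriv_smooth test_fun_smooth \<psi>)
    show ?thesis
      using smooth_deriv1[OF smooth_affine[OF sm, of \<sigma> x], of s]
      by (simp only: nth_deriv_affine[OF sm] nth_deriv_nth_deriv) (simp add: add.commute)
  qed
  have "(W has_vector_derivative E s *\<^sub>R (nth_deriv 2 \<psi> (x + \<sigma> * s) + c *\<^sub>R \<psi> (x + \<sigma> * s))) (at s)" for s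
  proof -
    have E\<sigma>: "((\<lambda>s. E s * \<sigma>) has_real_derivative E1 s * \<sigma>) (at s)"
      using DERIV_cmult_right[OF E(1)] by simp
    have "(W has_vector_derivative
        (((E s * \<sigma>) *\<^sub>R (\<sigma> *\<^sub>R nth_deriv (Suc 1) \<psi> (x + \<sigma> * s)) + (E1 s * \<sigma>) *\<^sub>R nth_deriv 1 \<psi> (x + \<sigma> * s))
        - (E1 s *\<^sub>R (\<sigma> *\<^sub>R nth_deriv (Suc 0) \<psi> (x + \<sigma> * s)) + (- c * E s) *\<^sub>R \<psi> (x + \<sigma> * s)))) (at s)"
      unfolding W_def
      by (intro has_vector_derivative_diff has_vector_derivative_scaleR E\<sigma> E(2) d d[of 0, unfolded nth_deriv_0])
    moreover have "(E s * \<sigma>) *\<^sub>R (\<sigma> *\<^sub>R nth_deriv (Suc 1) \<psi> (x + \<sigma> * s)) = E s *\<^sub>R nth_deriv 2 \<psi> (x + \<sigma> * s)"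
      by (simp add: mult.assoc \<sigma>2 numeral_2_eq_2)
    ultimately show ?thesis by (simp add: scaleR_add_right mult.commute)
  qed
  then have "((\<lambda>s. E s *\<^sub>R (nth_deriv 2 \<psi> (x + \<sigma> * s) + c *\<^sub>R \<psi> (x + \<sigma> * s))) has_integral W b - W 0) {0..b}"
    using b by (intro fundamental_theorem_of_calculus) (auto intro: has_vector_derivative_at_within)
  then show ?thesis by (simp add: W_def E)
qed

text \<open>A distribution that vanishes off the unit interval and solves the equation on one side of
  \<open>x0\<close> is given there by the convolution of the data with the causal fundamental solution. The proof
  is by duality: \<open>\<theta>\<close> below solves the adjoint equation with right-hand side \<open>\<psi>\<close>, up to a term \<open>T\<close>
  that is supported outside the unit interval.\<close>

lemma one_sided_solution:
  fixes u :: "'a::{real_normed_field, euclidean_space} functional"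
  assumes u: "distribution u" and supp01: "\<And>\<psi>. test_fun \<psi> \<Longrightarrow> supp \<psi> \<inter> {0..1} = {} \<Longrightarrow> u \<psi> = 0"
    and \<alpha>: "\<alpha> \<noteq> 0" and \<sigma>: "\<bar>\<sigma>\<bar> = 1"
    and eq: "\<And>\<psi>. test_fun \<psi> \<Longrightarrow> supp \<psi> \<subseteq> {y. \<sigma> * (y - x0) < 0} \<Longrightarrow>
      of_real \<alpha> * u (nth_deriv 2 \<psi>) + of_real P * u \<psi> = (LINT x|lebesgue. G x * \<psi> x)"
    and G: "integrable lebesgue G" "\<And>x. x \<notin> {0..1} \<Longrightarrow> G x = 0"
    and E: "\<And>t. (E has_real_derivative E1 t) (at t)" "\<And>t. (E1 has_real_derivative - (P / \<alpha>) * E t) (at t)"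
    "E 0 = 0" "E1 0 = 1"
    and \<psi>: "test_fun \<psi>" "supp \<psi> \<subseteq> {y. \<sigma> * (y - x0) < 0}"
  shows "u \<psi> = (LINT y|lebesgue. ((1 / \<alpha>) *\<^sub>R causal_conv E \<sigma> G y) * \<psi> y)"
proof -
  have \<sigma>2: "\<sigma> * \<sigma> = 1" using \<sigma> by (auto simp: abs_real_def split: if_splits)
  have cE: "continuous_on UNIV E"
    using E(1) by (meson DERIV_isCont continuous_at_imp_continuous_on)
  have cE': "continuous_on S (\<lambda>s. of_real (E s) :: 'a)" for S
    by (intro continuous_intros continuous_on_subset[OF cE]) auto
  obtain R where "R > 0" and R: "\<And>x n. \<bar>x\<bar> > R \<Longrightarrow> nth_deriv n \<psi> x = 0" using test_fun_radius[OF \<psi>(1)] by metis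
  \<comment> \<open>Large enough that the translate of \<open>\<psi>\<close> by \<open>\<sigma> * L\<close> misses the unit interval.\<close>
  define L where "L = R + 2"
  have "L > 0" using \<open>R > 0\<close> by (simp add: L_def)
  define c where "c = P / \<alpha>"
  define \<theta> :: "real \<Rightarrow> 'a" where "\<theta> y = integral {0..L} (\<lambda>s. of_real (E s) * \<psi> (1 * y + \<sigma> * s))" for y
  have \<theta>: "test_fun \<theta>" unfolding \<theta>_def by (rule test_fun_integral[OF cE' \<psi>(1)]) auto
  have d\<theta>: "nth_deriv n \<theta> y = integral {0..L} (\<lambda>s. of_real (E s) * nth_deriv n \<psi> (y + \<sigma> * s))" for n y
    unfolding \<theta>_def using nth_deriv_integral[OF cE' \<psi>(1), of 1 n 0 L \<sigma>] by simp
  define T where "T y = (E L * \<sigma>) *\<^sub>R nth_deriv 1 \<psi> (1 * y + \<sigma> * L) - E1 L *\<^sub>R \<psi> (1 * y + \<sigma> * L)" for y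
  have T: "test_fun T"
    unfolding T_def
    by (rule test_fun_diff[OF test_fun_scaleR[OF test_fun_affine[OF test_fun_nth_deriv[OF \<psi>(1)]]]
          test_fun_scaleR[OF test_fun_affine[OF \<psi>(1)]]]) auto
  have uT: "u T = 0"
  proof (rule supp01[OF T])
    have "supp T \<subseteq> - {-1/2<..<3/2}"
    proof (rule supp_subsetI)
      fix y :: real assume "y \<notin> - {-1/2<..<3/2}"
      moreover have "\<sigma> = 1 \<or> \<sigma> = -1" using \<sigma> by (auto simp: abs_real_def split: if_splits)
      ultimately have "\<bar>1 * y + \<sigma> * L\<bar> > R" using \<open>R > 0\<close> by (auto simp: L_def)
      then show "T y = 0" using R[of "1 * y + \<sigma> * L" 0] R[of "1 * y + \<sigma> * L" 1] by (simp add: T_def)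
    qed (auto simp: closed_Compl)
    moreover have "- {-1/2<..<3/2} \<inter> {0..1} = ({} :: real set)" by auto
    ultimately show "supp T \<inter> {0..1} = {}" by blast
  qed
  have c\<psi>: "continuous_on S (\<lambda>s. nth_deriv n \<psi> (y + \<sigma> * s))" for S n y
    by (rule continuous_on_compose2[OF continuous_nth_deriv[OF test_fun_smooth[OF \<psi>(1)], of UNIV]])
       (auto intro!: continuous_intros)
  have ode: "nth_deriv 2 \<theta> y = \<psi> y + T y - c *\<^sub>R \<theta> y" for y
  proof -
    have i2: "((\<lambda>s. of_real (E s) * nth_deriv n \<psi> (y + \<sigma> * s)) has_integral nth_deriv n \<theta> y) {0..L}" for n
      unfolding d\<theta> by (intro integrable_integral integrable_continuous_real continuous_intros cE' c\<psi>)
    have "((\<lambda>s. of_real (E s) * nth_deriv 2 \<psi> (y + \<sigma> * s) + c *\<^sub>R (of_real (E s) * nth_deriv 0 \<psi> (y + \<sigma> * s)))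
       has_integral nth_deriv 2 \<theta> y + c *\<^sub>R nth_deriv 0 \<theta> y) {0..L}"
      by (intro has_integral_add has_integral_cmul i2)
    moreover have "((\<lambda>s. of_real (E s) * nth_deriv 2 \<psi> (y + \<sigma> * s) + c *\<^sub>R (of_real (E s) * nth_deriv 0 \<psi> (y + \<sigma> * s)))
       has_integral T y + \<psi> y) {0..L}"
      using kernel_integration_by_parts[OF E(1) E(2)[folded c_def] E(3,4) \<psi>(1) \<sigma>, of L y] \<open>L > 0\<close>
      by (simp add: T_def scaleR_conv_of_real algebra_simps)
    ultimately have "nth_deriv 2 \<theta> y + c *\<^sub>R nth_deriv 0 \<theta> y = T y + \<psi> y" by (rule has_integral_unique)
    then show ?thesis by (simp add: algebra_simps)
  qed
  have "supp \<theta> \<subseteq> {y. \<sigma> * (y - x0) < 0}"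
  proof (cases "supp \<psi> = {}")
    case True
    then have "\<psi> x = 0" for x using supp_0[of x \<psi>] by simp
    then have "\<theta> = (\<lambda>x. 0)" by (simp add: \<theta>_def fun_eq_iff)
    then show ?thesis by (simp add: supp_def)
  next
    case False
    have "continuous_on (supp \<psi>) (\<lambda>y. \<sigma> * (y - x0))" by (intro continuous_intros)
    moreover have "compact (supp \<psi>)" using \<psi>(1) by (simp add: test_fun_def)
    ultimately obtain m where m: "m \<in> supp \<psi>" "\<And>y. y \<in> supp \<psi> \<Longrightarrow> \<sigma> * (y - x0) \<le> \<sigma> * (m - x0)"
      using continuous_attains_sup[of "supp \<psi>" "\<lambda>y. \<sigma> * (y - x0)"] False by blast
    have "supp \<theta> \<subseteq> {y. \<sigma> * (y - x0) \<le> \<sigma> * (m - x0)}"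
    proof (rule supp_subsetI)
      show "closed {y. \<sigma> * (y - x0) \<le> \<sigma> * (m - x0)}"
        by (intro closed_Collect_le continuous_intros)
      fix y assume y: "y \<notin> {y. \<sigma> * (y - x0) \<le> \<sigma> * (m - x0)}"
      have "\<psi> (1 * y + \<sigma> * s) = 0" if "s \<in> {0..L}" for s
      proof (rule supp_0, rule notI)
        assume "1 * y + \<sigma> * s \<in> supp \<psi>"
        from m(2)[OF this] have "\<sigma> * (y - x0) + \<sigma> * \<sigma> * s \<le> \<sigma> * (m - x0)" by (simp add: algebra_simps)
        then show False using y that by (simp add: \<sigma>2)
      qed
      then have "\<theta> y = integral {0..L} (\<lambda>s. 0)"
        unfolding \<theta>_def by (intro integral_cong) auto
      then show "\<theta> y = 0" by simp
    qed
    then show ?thesis using m(1) \<psi>(2) by fastforce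
  qed
  from eq[OF \<theta> this]
  have "of_real \<alpha> * u (nth_deriv 2 \<theta>) + of_real P * u \<theta> = (LINT x|lebesgue. G x * \<theta> x)" .
  moreover have "u (nth_deriv 2 \<theta>) = u \<psi> - c *\<^sub>R u \<theta>"
  proof -
    have "nth_deriv 2 \<theta> = (\<lambda>y. (\<psi> y + T y) - c *\<^sub>R \<theta> y)" using ode by (simp add: fun_eq_iff)
    then have "u (nth_deriv 2 \<theta>) = u (\<lambda>y. (\<psi> y + T y) - c *\<^sub>R \<theta> y)" by simp
    also have "\<dots> = u (\<lambda>y. \<psi> y + T y) - u (\<lambda>y. c *\<^sub>R \<theta> y)"
      by (rule distribution_diff[OF u test_fun_add[OF \<psi>(1) T] test_fun_scaleR[OF \<theta>]])
    also have "u (\<lambda>y. \<psi> y + T y) = u \<psi>" using distribution_add[OF u \<psi>(1) T] uT by simp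
    also have "u (\<lambda>y. c *\<^sub>R \<theta> y) = c *\<^sub>R u \<theta>" by (rule distribution_scaleR[OF u \<theta>])
    finally show ?thesis .
  qed
  ultimately have 1: "of_real \<alpha> * u \<psi> = (LINT x|lebesgue. G x * \<theta> x)"
    using \<alpha> by (simp add: c_def scaleR_conv_of_real algebra_simps)
  have \<theta>_eq: "\<theta> x = (LINT y|lebesgue. causal E (\<sigma> * (y - x)) *\<^sub>R \<psi> y)" if "x \<in> {0..1}" for x
  proof -
    have "(LINT y|lebesgue. causal E (\<sigma> * (y - x)) *\<^sub>R \<psi> y) =
       \<bar>\<sigma>\<bar> *\<^sub>R (LINT s|lebesgue. causal E (\<sigma> * (x + \<sigma> * s - x)) *\<^sub>R \<psi> (x + \<sigma> * s))"
      by (rule lebesgue_integral_real_affine) (use \<sigma> in auto)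
    also have "\<dots> = (LINT s|lebesgue. causal E s *\<^sub>R \<psi> (x + \<sigma> * s))"
      using \<sigma> by (simp add: mult.assoc[symmetric] \<sigma>2)
    also have "\<dots> = integral {0..L} (\<lambda>s. causal E s *\<^sub>R \<psi> (x + \<sigma> * s))"
    proof (rule lint_Icc)
      have "continuous_on {0..L} (\<lambda>s. E s *\<^sub>R \<psi> (x + \<sigma> * s))"
        by (intro continuous_intros continuous_on_subset[OF cE] c\<psi>[of _ 0, simplified nth_deriv_0]) auto
      then show "continuous_on {0..L} (\<lambda>s. causal E s *\<^sub>R \<psi> (x + \<sigma> * s))"
        by (rule continuous_on_eq) (auto simp: causal_def E(3))
      fix s assume "s \<notin> {0..L}"
      then consider "s < 0" | "s > L" by force
      then show "causal E s *\<^sub>R \<psi> (x + \<sigma> * s) = 0"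
      proof cases
        case 2
        moreover have "\<sigma> = 1 \<or> \<sigma> = -1" using \<sigma> by (auto simp: abs_real_def split: if_splits)
        ultimately have "\<bar>x + \<sigma> * s\<bar> > R" using that \<open>R > 0\<close> by (auto simp: L_def)
        then show ?thesis using R[of _ 0] by simp
      qed (simp add: causal_def)
    qed
    also have "\<dots> = \<theta> x"
      unfolding \<theta>_def by (intro integral_cong) (auto simp: causal_def E(3) scaleR_conv_of_real)
    finally show ?thesis by simp
  qed
  have i\<psi>: "integrable lebesgue \<psi>"
    by (rule lint_Icc(1)[of "-R" R]) (use R[of _ 0] smooth_continuous[OF test_fun_smooth[OF \<psi>(1)]] in auto)
  have "(LINT x|lebesgue. G x * \<theta> x) = (LINT x|lebesgue. G x * (LINT y|lebesgue. causal E (\<sigma> * (y - x)) *\<^sub>R \<psi> y))"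
    by (intro Bochner_Integration.integral_cong refl) (metis \<theta>_eq G(2) mult_zero_left)
  also have "\<dots> = (LINT y|lebesgue. causal_conv E \<sigma> G y * \<psi> y)"
    by (rule causal_conv_fubini[OF cE G \<sigma> i\<psi>, of R, symmetric]) (use R[of _ 0] in auto)
  finally have 2: "of_real \<alpha> * u \<psi> = (LINT y|lebesgue. causal_conv E \<sigma> G y * \<psi> y)" using 1 by simp
  have "u \<psi> = (1 / \<alpha>) *\<^sub>R (of_real \<alpha> * u \<psi>)" using \<alpha> by (simp add: scaleR_conv_of_real)
  then show ?thesis by (simp add: 2 flip: integral_scaleR_right)
qed

text \<open>Integrating the classical solution against the adjoint operator over the half line on which it
  solves the equation leaves boundary terms at \<open>x0\<close>.\<close>

lemma one_sided_green_identity: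
  fixes G \<psi> :: "real \<Rightarrow> 'a::{real_normed_field, euclidean_space}"
  assumes \<sigma>: "\<bar>\<sigma>\<bar> = 1"
    and G: "integrable lebesgue G" "\<And>x. x \<notin> {0..1} \<Longrightarrow> G x = 0"
    and E: "\<And>t. (E has_real_derivative E1 t) (at t)" "\<And>t. (E1 has_real_derivative - c * E t) (at t)"
    "E 0 = 0" "E1 0 = 1"
    and \<psi>: "test_fun \<psi>"
  shows "(LINT y|lebesgue. causal_conv E \<sigma> G y *
      (indicator {y. \<sigma> * (y - x0) < 0} y *\<^sub>R (nth_deriv 2 \<psi> y + c *\<^sub>R \<psi> y))) =
    (LINT x|lebesgue. G x * (indicator {y. \<sigma> * (y - x0) < 0} x *\<^sub>R \<psi> x))
    + causal_conv E \<sigma> G x0 * (\<sigma> *\<^sub>R nth_deriv 1 \<psi> x0) - causal_conv E1 \<sigma> G x0 * \<psi> x0"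
proof -
  define S where "S = {y. \<sigma> * (y - x0) < 0}"
  have "open S" unfolding S_def by (intro open_Collect_less continuous_intros)
  then have mS: "S \<in> sets lebesgue" by (simp add: borel_open)
  have \<sigma>2: "\<sigma> * \<sigma> = 1" using \<sigma> by (auto simp: abs_real_def split: if_splits)
  have cE: "continuous_on UNIV E" and cE1: "continuous_on UNIV E1"
    using E(1,2) by (meson DERIV_isCont continuous_at_imp_continuous_on)+
  obtain R where "R > 0" and R: "\<And>x n. \<bar>x\<bar> > R \<Longrightarrow> nth_deriv n \<psi> x = 0" using test_fun_radius[OF \<psi>] by metis
  define H where "H y = nth_deriv 2 \<psi> y + c *\<^sub>R \<psi> y" for y
  have cH: "continuous_on A H" for A
    unfolding H_def by (intro continuous_intros continuous_nth_deriv smooth_continuous test_fun_smooth \<psi>)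
  have H0: "H y = 0" if "\<bar>y\<bar> > R" for y using R[OF that, of 2] R[OF that, of 0] by (simp add: H_def)
  have iH: "integrable lebesgue H"
    by (rule lint_Icc(1)[of "-R" R]) (use H0 cH in auto)
  have inner: "(LINT y|lebesgue. causal E (\<sigma> * (y - x)) *\<^sub>R (indicator S y *\<^sub>R H y)) =
      indicator S x *\<^sub>R \<psi> x + (causal E (\<sigma> * (x0 - x)) * \<sigma>) *\<^sub>R nth_deriv 1 \<psi> x0
      - causal E1 (\<sigma> * (x0 - x)) *\<^sub>R \<psi> x0" for x
  proof -
    define b where "b = \<sigma> * (x0 - x)"
    have xb: "x + \<sigma> * b = x0" by (simp add: b_def mult.assoc[symmetric] \<sigma>2)
    have S: "x + \<sigma> * s \<in> S \<longleftrightarrow> s < b" for s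
    proof -
      have "\<sigma> * (x + \<sigma> * s - x0) = s - b"
        unfolding b_def by (simp add: algebra_simps mult.assoc[symmetric] \<sigma>2)
      then show ?thesis by (simp add: S_def)
    qed
    have xS: "x \<in> S \<longleftrightarrow> b > 0" using S[of 0] by simp
    have "(LINT y|lebesgue. causal E (\<sigma> * (y - x)) *\<^sub>R (indicator S y *\<^sub>R H y)) =
       \<bar>\<sigma>\<bar> *\<^sub>R (LINT s|lebesgue. causal E (\<sigma> * (x + \<sigma> * s - x)) *\<^sub>R (indicator S (x + \<sigma> * s) *\<^sub>R H (x + \<sigma> * s)))"
      by (rule lebesgue_integral_real_affine) (use \<sigma> in auto)
    also have "\<dots> = (LINT s|lebesgue. causal E s *\<^sub>R (indicator S (x + \<sigma> * s) *\<^sub>R H (x + \<sigma> * s)))"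
      using \<sigma> by (simp add: mult.assoc[symmetric] \<sigma>2)
    also have "\<dots> = (LINT s|lebesgue. indicator {0<..<b} s *\<^sub>R (E s *\<^sub>R H (x + \<sigma> * s)))"
      by (intro Bochner_Integration.integral_cong refl) (auto simp: causal_def indicator_def S)
    finally have eq: "(LINT y|lebesgue. causal E (\<sigma> * (y - x)) *\<^sub>R (indicator S y *\<^sub>R H y)) =
      (LINT s|lebesgue. indicator {0<..<b} s *\<^sub>R (E s *\<^sub>R H (x + \<sigma> * s)))" .
    show ?thesis
    proof (cases "b > 0")
      case True
      have "continuous_on {0..b} (\<lambda>s. E s *\<^sub>R H (x + \<sigma> * s))"
        by (intro continuous_intros continuous_on_subset[OF cE] continuous_on_compose2[OF cH[of UNIV]]) auto
      then have "(\<lambda>s. E s *\<^sub>R H (x + \<sigma> * s)) absolutely_integrable_on {0..b}"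
        by (rule absolutely_integrable_continuous_real)
      then have "(\<lambda>s. E s *\<^sub>R H (x + \<sigma> * s)) absolutely_integrable_on {0<..<b}"
        by (rule set_integrable_subset) auto
      from set_lebesgue_integral_eq_integral(2)[OF this]
      have "(LINT s|lebesgue. indicator {0<..<b} s *\<^sub>R (E s *\<^sub>R H (x + \<sigma> * s))) =
          integral {0<..<b} (\<lambda>s. E s *\<^sub>R H (x + \<sigma> * s))"
        by (simp add: set_lebesgue_integral_def)
      also have "\<dots> = integral {0..b} (\<lambda>s. E s *\<^sub>R H (x + \<sigma> * s))"
        by (rule integral_open_interval_real[symmetric])
      also have "\<dots> = (E b * \<sigma>) *\<^sub>R nth_deriv 1 \<psi> x0 - E1 b *\<^sub>R \<psi> x0 + \<psi> x"
        using kernel_integration_by_parts[OF E \<psi> \<sigma>, of b x] True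
        by (simp add: H_def xb integral_unique)
      finally show ?thesis using True xS eq by (simp add: causal_def b_def[symmetric])
    next
      case False
      then have "{0<..<b} = {}" by simp
      then show ?thesis using False xS eq by (simp add: causal_def b_def[symmetric])
    qed
  qed
  have i1: "integrable lebesgue (\<lambda>x. G x * (indicator S x *\<^sub>R \<psi> x))"
  proof -
    obtain M where "M > 0" and M: "\<And>x. norm (\<psi> x) \<le> M"
      using test_fun_bounded[OF \<psi>, of 0] by (metis nth_deriv_0)
    show ?thesis
    proof (rule Bochner_Integration.integrable_bound[of _ "\<lambda>x. M * norm (G x)"])
      show "integrable lebesgue (\<lambda>x. M * norm (G x))" using G by simp
      show "(\<lambda>x. G x * (indicator S x *\<^sub>R \<psi> x)) \<in> borel_measurable lebesgue"
        by (intro borel_measurable_times borel_measurable_scaleR borel_measurable_integrable[OF G(1)]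
            borel_measurable_indicator mS continuous_measurable_lebesgue smooth_continuous test_fun_smooth \<psi>)
      show "AE x in lebesgue. norm (G x * (indicator S x *\<^sub>R \<psi> x)) \<le> norm (M * norm (G x))"
        using M \<open>M > 0\<close> by (intro AE_I2) (auto simp: norm_mult indicator_def mult.commute[of M] intro!: mult_left_mono)
    qed
  qed
  have i2: "integrable lebesgue (\<lambda>x. (causal k (\<sigma> * (x0 - x)) *\<^sub>R G x) * b)" if "continuous_on UNIV k" for k and b :: 'a
    by (intro integrable_mult_left integrable_causal that G \<sigma>)
  have "(LINT y|lebesgue. causal_conv E \<sigma> G y * (indicator S y *\<^sub>R H y)) =
    (LINT x|lebesgue. G x * (LINT y|lebesgue. causal E (\<sigma> * (y - x)) *\<^sub>R (indicator S y *\<^sub>R H y)))"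
    by (rule causal_conv_fubini[OF cE G \<sigma> integrable_mult_indicator[OF mS iH], of R]) (simp_all add: H0)
  also have "\<dots> = (LINT x|lebesgue. G x * (indicator S x *\<^sub>R \<psi> x)
       + (causal E (\<sigma> * (x0 - x)) *\<^sub>R G x) * (\<sigma> *\<^sub>R nth_deriv 1 \<psi> x0) - (causal E1 (\<sigma> * (x0 - x)) *\<^sub>R G x) * \<psi> x0)"
    unfolding inner by (simp add: algebra_simps)
  also have "\<dots> = (LINT x|lebesgue. G x * (indicator S x *\<^sub>R \<psi> x))
       + (LINT x|lebesgue. (causal E (\<sigma> * (x0 - x)) *\<^sub>R G x) * (\<sigma> *\<^sub>R nth_deriv 1 \<psi> x0)) 
       - (LINT x|lebesgue. (causal E1 (\<sigma> * (x0 - x)) *\<^sub>R G x) * \<psi> x0)"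
    by (simp only: Bochner_Integration.integral_diff Bochner_Integration.integral_add Bochner_Integration.integrable_add i1 i2 cE cE1)
  also have "(LINT x|lebesgue. (causal E (\<sigma> * (x0 - x)) *\<^sub>R G x) * (\<sigma> *\<^sub>R nth_deriv 1 \<psi> x0)) = 
      causal_conv E \<sigma> G x0 * (\<sigma> *\<^sub>R nth_deriv 1 \<psi> x0)"
    unfolding causal_conv_def by (rule integral_mult_left_zero)
  also have "(LINT x|lebesgue. (causal E1 (\<sigma> * (x0 - x)) *\<^sub>R G x) * \<psi> x0) = causal_conv E1 \<sigma> G x0 * \<psi> x0"
    unfolding causal_conv_def by (rule integral_mult_left_zero)
  finally show ?thesis by (simp only: S_def H_def)
qed

section \<open>Moments of a bump function\<close>

lemma integral_by_parts:
  fixes F H F' H' :: "real \<Rightarrow> real"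
  assumes "a \<le> b"
    and F: "\<And>x. x \<in> {a..b} \<Longrightarrow> (F has_real_derivative F' x) (at x within {a..b})"
    and H: "\<And>x. x \<in> {a..b} \<Longrightarrow> (H has_real_derivative H' x) (at x within {a..b})"
    and c: "continuous_on {a..b} F'" "continuous_on {a..b} H'"
    and z: "F a * H a = 0" "F b * H b = 0"
  shows "integral {a..b} (\<lambda>x. F' x * H x) = - integral {a..b} (\<lambda>x. F x * H' x)"
proof -
  have cF: "continuous_on {a..b} F" and cH: "continuous_on {a..b} H"
    by (rule DERIV_continuous_on[OF F] DERIV_continuous_on[OF H], assumption)+
  have "((\<lambda>x. F' x * H x + F x * H' x) has_integral F b * H b - F a * H a) {a..b}"
  proof (rule fundamental_theorem_of_calculus[OF assms(1)])
    fix x assume x: "x \<in> {a..b}"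
    from DERIV_mult[OF F[OF x] H[OF x]]
    show "((\<lambda>x. F x * H x) has_vector_derivative F' x * H x + F x * H' x) (at x within {a..b})"
      by (simp add: has_real_derivative_iff_has_vector_derivative mult.commute add.commute)
  qed
  then have "integral {a..b} (\<lambda>x. F' x * H x + F x * H' x) = 0"
    using z by (simp add: integral_unique)
  moreover have "integral {a..b} (\<lambda>x. F' x * H x + F x * H' x) =
      integral {a..b} (\<lambda>x. F' x * H x) + integral {a..b} (\<lambda>x. F x * H' x)"
    by (intro Henstock_Kurzweil_Integration.integral_add integrable_continuous_real continuous_intros c cF cH)
  ultimately show ?thesis by simp
qed

text \<open>A real bump function of unit mass with support in \<open>[-1,1]\<close>. All model products are
  evaluated along the delta net generated by one such function. Integrals of its derivatives are taken
  over \<open>[-2,2]\<close>, so that boundary terms vanish trivially. No sign is assumed.\<close>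

locale bump =
  fixes \<rho> :: "real \<Rightarrow> real"
  assumes smooth_\<rho>: "smooth \<rho>" and \<rho>_0: "\<bar>x\<bar> > 1 \<Longrightarrow> \<rho> x = 0" and integral_\<rho>: "integral {-1..1} \<rho> = 1"
begin

abbreviation D :: "nat \<Rightarrow> real \<Rightarrow> real" where "D k \<equiv> nth_deriv k \<rho>"
abbreviation I :: "(real \<Rightarrow> real) \<Rightarrow> real" where "I f \<equiv> integral {-2..2} f"

lemma test_\<rho>: "test_fun \<rho>" by (rule test_funI[OF smooth_\<rho> \<rho>_0])

lemma D_0: "\<bar>x\<bar> > 1 \<Longrightarrow> D k x = 0"
  by (rule nth_deriv_eq_0_open[of "- {-1..1}"]) (auto simp: \<rho>_0 open_Compl)

lemma D_deriv: "(D k has_real_derivative D (Suc k) x) (at x within S)"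
  using smooth_nth_deriv[OF smooth_\<rho>, of k x]
  by (simp add: has_real_derivative_iff_has_vector_derivative has_vector_derivative_at_within)

lemma D_cont: "continuous_on S (D k)" by (rule continuous_nth_deriv[OF smooth_\<rho>])

lemma \<rho>_cont: "continuous_on S \<rho>" by (rule smooth_continuous[OF smooth_\<rho>])

text \<open>The primitive of \<open>\<rho>\<close>, that is, the mollified Heaviside function at unit scale. It is only used on
  \<open>[-2,2]\<close>.\<close>

definition \<Phi> :: "real \<Rightarrow> real" where "\<Phi> z = integral {-2..z} \<rho>"

lemma \<Phi>_deriv: "x \<in> {-2..2} \<Longrightarrow> (\<Phi> has_real_derivative \<rho> x) (at x within {-2..2})"
  unfolding \<Phi>_def[abs_def]
  by (rule integral_has_real_derivative) (auto intro: \<rho>_cont)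

lemma \<Phi>_cont: "continuous_on {-2..2} \<Phi>"
  by (rule DERIV_continuous_on[OF \<Phi>_deriv])

lemma \<Phi>_left: "\<Phi> (-2) = 0" by (simp add: \<Phi>_def)

lemma \<Phi>_right: "\<Phi> 2 = 1"
proof -
  have "(\<rho> has_integral 1) {-1..1}"
    using integral_\<rho> integrable_continuous_real[OF smooth_continuous[OF smooth_\<rho>]] by (metis integrable_integral)
  then have "(\<rho> has_integral 1) {-2..2}"
    by (rule has_integral_on_superset) (auto intro: \<rho>_0)
  then show ?thesis by (simp add: \<Phi>_def integral_unique)
qed

lemma integral_D: "k \<ge> 1 \<Longrightarrow> I (D k) = 0"
proof -
  assume "k \<ge> 1"
  then obtain j where k: "k = Suc j" by (cases k) auto
  have "(D k has_integral D j 2 - D j (-2)) {-2..2}"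
    unfolding k by (rule fundamental_theorem_of_calculus)
      (use D_deriv in \<open>auto simp: has_real_derivative_iff_has_vector_derivative\<close>)
  then show ?thesis by (simp add: D_0 integral_unique)
qed

lemma integral_x_D: "k \<ge> 2 \<Longrightarrow> I (\<lambda>x. x * D k x) = 0"
proof -
  assume "k \<ge> 2"
  then obtain j where k: "k = Suc j" "j \<ge> 1" by (cases k) auto
  have "I (\<lambda>x. D (Suc j) x * x) = - I (\<lambda>x. D j x * 1)"
    by (rule integral_by_parts) (auto intro!: D_deriv D_cont derivative_eq_intros simp: D_0)
  then show ?thesis using integral_D[OF k(2)] by (simp add: k mult.commute)
qed

lemma moment_even: "I (\<lambda>x. D a x * D (a + 2 * m) x) = (-1) ^ m * I (\<lambda>x. (D (a + m) x)\<^sup>2)"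
proof (induction m arbitrary: a)
  case (Suc m)
  have "I (\<lambda>x. D (Suc (a + 2 * m + 1)) x * D a x) = - I (\<lambda>x. D (a + 2 * m + 1) x * D (Suc a) x)"
    by (rule integral_by_parts) (auto intro!: D_deriv D_cont simp: D_0)
  then show ?case using Suc[of "Suc a"] by (simp add: mult.commute[of "D a _"] mult.commute[of "D (Suc a) _"])
qed (simp add: power2_eq_square)

lemma moment_odd:
  "I (\<lambda>x. x * D a x * D (a + 2 * m + 1) x) = (-1) ^ (m + 1) * (real m + 1 / 2) * I (\<lambda>x. (D (a + m) x)\<^sup>2)"
proof (induction m arbitrary: a)
  case 0
  have "I (\<lambda>x. D (Suc a) x * (x * D a x)) = - I (\<lambda>x. D a x * (D a x + x * D (Suc a) x))"
    by (rule integral_by_parts)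
       (auto intro!: D_deriv D_cont continuous_intros derivative_eq_intros simp: D_0)
  also have "I (\<lambda>x. D a x * (D a x + x * D (Suc a) x)) = I (\<lambda>x. (D a x)\<^sup>2) + I (\<lambda>x. D (Suc a) x * (x * D a x))"
    by (subst Henstock_Kurzweil_Integration.integral_add[symmetric])
       (auto intro!: integrable_continuous_real continuous_intros D_cont integral_cong simp: algebra_simps power2_eq_square)
  finally show ?case by (simp add: ac_simps)
next
  case (Suc m)
  have "I (\<lambda>x. D (Suc (a + 2 * Suc m)) x * (x * D a x)) =
     - I (\<lambda>x. D (a + 2 * Suc m) x * (D a x + x * D (Suc a) x))"
    by (rule integral_by_parts)
       (auto intro!: D_deriv D_cont continuous_intros derivative_eq_intros simp: D_0)
  also have "I (\<lambda>x. D (a + 2 * Suc m) x * (D a x + x * D (Suc a) x)) =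
     I (\<lambda>x. D a x * D (a + 2 * Suc m) x) + I (\<lambda>x. x * D (Suc a) x * D (Suc a + 2 * m + 1) x)"
    by (subst Henstock_Kurzweil_Integration.integral_add[symmetric])
       (auto intro!: integrable_continuous_real continuous_intros D_cont integral_cong simp: algebra_simps)
  also have "I (\<lambda>x. D (Suc (a + 2 * Suc m)) x * (x * D a x)) = I (\<lambda>x. x * D a x * D (a + 2 * Suc m + 1) x)"
    by (simp add: ac_simps)
  finally show ?case unfolding moment_even Suc.IH by (simp add: algebra_simps)
qed

lemma energy_nonzero: "I (\<lambda>x. (D j x)\<^sup>2) \<noteq> 0"
proof
  assume "I (\<lambda>x. (D j x)\<^sup>2) = 0"
  then have "\<forall>x\<in>{-2..2}. (D j x)\<^sup>2 = 0"
    by (subst (asm) integral_eq_0_iff) (auto intro!: continuous_intros D_cont)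
  then have "D j x = 0" for x by (cases "x \<in> {-2..2}") (auto intro: D_0)
  then have "\<forall>x. D 0 x = 0"
  proof (induction j)
    case (Suc j)
    have "D j x = 0" for x
    proof -
      have d: "(D j has_real_derivative 0) (at x)" for x using D_deriv[of j x UNIV] Suc.prems by simp
      have "D j x = D j 2" by (rule DERIV_isconst_all[OF allI, OF d])
      then show ?thesis by (simp add: D_0)
    qed
    then show ?case by (rule Suc.IH)
  qed auto
  then have "I \<rho> = I (\<lambda>x::real. 0)" by (intro integral_cong) simp
  then have "I \<rho> = 0" by simp
  then show False using \<Phi>_right by (simp add: \<Phi>_def)
qed

lemma moment_\<Phi>: "I (\<lambda>x. \<Phi> x * D (Suc k) x) = - I (\<lambda>x. \<rho> x * D k x)"
proof -
  have "I (\<lambda>x. D (Suc k) x * \<Phi> x) = - I (\<lambda>x. D k x * \<rho> x)"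
    by (rule integral_by_parts) (auto intro!: D_deriv D_cont \<Phi>_deriv \<rho>_cont simp: D_0)
  then show ?thesis by (simp add: mult.commute)
qed

lemma moment_x_\<Phi>: "I (\<lambda>x. x * \<Phi> x * D (Suc k) x) = - I (\<lambda>x. \<Phi> x * D k x) - I (\<lambda>x. x * \<rho> x * D k x)"
proof -
  have "I (\<lambda>x. D (Suc k) x * (x * \<Phi> x)) = - I (\<lambda>x. D k x * (\<Phi> x + x * \<rho> x))"
    by (rule integral_by_parts)
       (auto intro!: D_deriv D_cont \<Phi>_deriv \<Phi>_cont continuous_intros derivative_eq_intros \<rho>_cont simp: D_0)
  also have "I (\<lambda>x. D k x * (\<Phi> x + x * \<rho> x)) = I (\<lambda>x. \<Phi> x * D k x) + I (\<lambda>x. x * \<rho> x * D k x)"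
    by (subst Henstock_Kurzweil_Integration.integral_add[symmetric])
       (auto intro!: integrable_continuous_real continuous_intros D_cont \<Phi>_cont \<rho>_cont integral_cong simp: algebra_simps)
  finally show ?thesis by (simp add: ac_simps)
qed

text \<open>The moments \<open>j = 0\<close> for odd and \<open>j = 1\<close> for even \<open>N\<close> reduce to \<open>\<integral>(\<rho>\<^sup>(\<^sup>m\<^sup>))\<^sup>2\<close> for some \<open>m\<close>.\<close>

lemma nonzero_moment:
  assumes "b1 \<noteq> b2" "N \<ge> 1"
  obtains j where "j < N" "I (\<lambda>x. x ^ j * (b1 + (b2 - b1) * \<Phi> x) * D N x) \<noteq> 0"
proof (cases "odd N")
  case True
  then obtain m where N: "N = Suc (0 + 2 * m)" by (auto elim: oddE)
  have "I (\<lambda>x. x ^ 0 * (b1 + (b2 - b1) * \<Phi> x) * D N x) = b1 * I (D N) + (b2 - b1) * I (\<lambda>x. \<Phi> x * D N x)"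
    unfolding integral_mult_right[symmetric]
    by (subst Henstock_Kurzweil_Integration.integral_add[symmetric])
       (auto intro!: integrable_continuous_real continuous_intros D_cont \<Phi>_cont simp: algebra_simps)
  also have "\<dots> = (b1 - b2) * ((-1) ^ m * I (\<lambda>x. (D m x)\<^sup>2))"
    using integral_D[OF assms(2)] moment_\<Phi>[of "0 + 2 * m"] moment_even[of 0 m] by (simp add: N left_diff_distrib)
  also have "\<dots> \<noteq> 0" using assms(1) energy_nonzero[of m] by simp
  finally show ?thesis using that[of 0] assms(2) by simp
next
  case False
  then obtain m where N: "N = Suc (0 + 2 * m + 1)"
    using assms(2) by (metis Suc_eq_plus1 add_0 even_Suc not_one_le_zero oddE old.nat.exhaust)
  have "I (\<lambda>x. x ^ 1 * (b1 + (b2 - b1) * \<Phi> x) * D N x) = b1 * I (\<lambda>x. x * D N x) + (b2 - b1) * I (\<lambda>x. x * \<Phi> x * D N x)"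
    unfolding integral_mult_right[symmetric]
    by (subst Henstock_Kurzweil_Integration.integral_add[symmetric])
       (auto intro!: integrable_continuous_real continuous_intros D_cont \<Phi>_cont simp: algebra_simps)
  also have "\<dots> = (b2 - b1) * (I (\<lambda>x. \<rho> x * D (2 * m) x) - I (\<lambda>x. x * \<rho> x * D (2 * m + 1) x))"
    using integral_x_D[of N] moment_x_\<Phi>[of "0 + 2 * m + 1"] moment_\<Phi>[of "2 * m"] by (simp add: N)
  also have "\<dots> = (b2 - b1) * ((-1) ^ m * (real m + 3 / 2) * I (\<lambda>x. (D m x)\<^sup>2))"
  proof -
    have e: "I (\<lambda>x. \<rho> x * D (2 * m) x) = (-1) ^ m * I (\<lambda>x. (D m x)\<^sup>2)"
      using moment_even[of 0 m] by simp
    have o: "I (\<lambda>x. x * \<rho> x * D (2 * m + 1) x) = (-1) ^ (m + 1) * (real m + 1 / 2) * I (\<lambda>x. (D m x)\<^sup>2)"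
      using moment_odd[of 0 m] by (simp only: nth_deriv_0 add_0)
    show ?thesis unfolding e o by (simp add: field_simps)
  qed
  also have "\<dots> \<noteq> 0" using assms(1) energy_nonzero[of m] by simp
  finally show ?thesis using that[of 1] N by simp
qed

lemma mean_moment: "I (\<lambda>x. (b1 + (b2 - b1) * \<Phi> x) * \<rho> x) = (b1 + b2) / 2"
proof -
  have "((\<lambda>x. (b1 + (b2 - b1) * \<Phi> x) * \<rho> x) has_integral
     (b1 * \<Phi> 2 + (b2 - b1) * (\<Phi> 2)\<^sup>2 / 2) - (b1 * \<Phi> (-2) + (b2 - b1) * (\<Phi> (-2))\<^sup>2 / 2)) {-2..2}"
  proof (rule fundamental_theorem_of_calculus)
    fix x :: real assume x: "x \<in> {-2..2}"
    show "((\<lambda>x. b1 * \<Phi> x + (b2 - b1) * (\<Phi> x)\<^sup>2 / 2) has_vector_derivative (b1 + (b2 - b1) * \<Phi> x) * \<rho> x) (at x within {-2..2})"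
      unfolding has_real_derivative_iff_has_vector_derivative[symmetric]
      by (auto intro!: derivative_eq_intros \<Phi>_deriv[OF x] simp: field_simps)
  qed simp
  then show ?thesis by (simp add: \<Phi>_left \<Phi>_right integral_unique field_simps)
qed

section \<open>Regularisation of functions\<close>

text \<open>The bump function with values in the field of scalars.\<close>

definition \<phi> :: "real \<Rightarrow> 'a::{real_normed_field, euclidean_space}" where "\<phi> x = of_real (\<rho> x)"

text \<open>The convolution of \<open>f\<close> with \<open>\<phi>(x/\<epsilon>)/\<epsilon>\<close>, after rescaling the variable of integration.\<close>

definition reg :: "(real \<Rightarrow> 'a::{real_normed_field, euclidean_space}) \<Rightarrow> real \<Rightarrow> real \<Rightarrow> 'a" where
  "reg f \<epsilon> x = (LINT t|lebesgue. f (x - \<epsilon> * t) * \<phi> t)"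

lemma test_\<phi>: "test_fun \<phi>" unfolding \<phi>_def by (rule test_fun_of_real[OF test_\<rho>])

lemma \<phi>_0: "\<bar>x\<bar> > 1 \<Longrightarrow> \<phi> x = 0" by (simp add: \<phi>_def \<rho>_0)

lemma nth_deriv_\<phi>: "nth_deriv k \<phi> x = of_real (D k x)"
  by (simp add: \<phi>_def[abs_def] nth_deriv_of_real[OF smooth_\<rho>])

lemma integral_\<phi>: "integral {-1..1} \<phi> = 1"
proof -
  have "(\<rho> has_integral 1) {-1..1}"
    using integral_\<rho> integrable_continuous_real[OF smooth_continuous[OF smooth_\<rho>]] by (metis integrable_integral)
  from has_integral_linear[OF this bounded_linear_of_real[where 'a='a]]
  show ?thesis by (simp add: integral_unique \<phi>_def[abs_def] o_def)
qed

lemma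
  shows integrable_\<phi>: "integrable lebesgue (\<phi> :: real \<Rightarrow> 'a::{real_normed_field, euclidean_space})"
    and lint_\<phi>: "(LINT x|lebesgue. \<phi> x) = (1 :: 'a)"
proof -
  let ?\<phi> = "\<phi> :: real \<Rightarrow> 'a"
  have c: "continuous_on {-1..1} ?\<phi>" by (intro smooth_continuous test_fun_smooth test_\<phi>)
  have z: "?\<phi> x = 0" if "x \<notin> {-1..1}" for x using that by (intro \<phi>_0) auto
  show "integrable lebesgue ?\<phi>" by (rule lint_Icc(1)[OF c z])
  show "(LINT x|lebesgue. ?\<phi> x) = 1" using lint_Icc(2)[OF c z] integral_\<phi>[where 'a='a] by simp
qed

lemma mollifier_\<phi>: "mollifier \<phi>"
  by (simp add: mollifier_def test_\<phi> lint_\<phi>)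

lemma convol_regular:
  assumes "\<epsilon> > 0"
  shows "convol (regular_dist f) (delta_net \<phi> \<epsilon>) x = reg f \<epsilon> x"
proof -
  have "convol (regular_dist f) (delta_net \<phi> \<epsilon>) x = (LINT y|lebesgue. f y * (\<phi> ((x - y) / \<epsilon>) / of_real \<epsilon>))"
    by (simp add: convol_def regular_dist_def delta_net_def)
  also have "\<dots> = \<bar>-\<epsilon>\<bar> *\<^sub>R (LINT t|lebesgue. f (x + - \<epsilon> * t) * (\<phi> ((x - (x + - \<epsilon> * t)) / \<epsilon>) / of_real \<epsilon>))"
    by (rule lebesgue_integral_real_affine) (use assms in auto)
  also have "\<dots> = (LINT t|lebesgue. \<bar>-\<epsilon>\<bar> *\<^sub>R (f (x + - \<epsilon> * t) * (\<phi> ((x - (x + - \<epsilon> * t)) / \<epsilon>) / of_real \<epsilon>)))"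
    by (rule integral_scaleR_right[symmetric])
  also have "\<dots> = reg f \<epsilon> x"
    unfolding reg_def using assms by (intro Bochner_Integration.integral_cong) (auto simp: scaleR_conv_of_real)
  finally show ?thesis .
qed

lemma reg_integrand_measurable:
  assumes "f \<in> borel_measurable borel"
  shows "(\<lambda>t. f (x - \<epsilon> * t) * \<phi> t) \<in> borel_measurable lebesgue"
  by (intro borel_measurable_times borel_measurable_integrable[OF integrable_\<phi>]
      borel_measurable_lebesgue measurable_compose[OF _ assms]) measurable

lemma reg_bound:
  fixes f :: "real \<Rightarrow> 'a::{real_normed_field, euclidean_space}"
  assumes f: "f \<in> borel_measurable borel" "\<And>x. norm (f x) \<le> M"
  shows "norm (reg f \<epsilon> x) \<le> M * (LINT t|lebesgue. norm (\<phi> t :: 'a))"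
proof -
  have "norm (reg f \<epsilon> x) \<le> (LINT t|lebesgue. M * norm (\<phi> t :: 'a))"
    unfolding reg_def
  proof (rule Bochner_Integration.integral_norm_bound_integral)
    show i: "integrable lebesgue (\<lambda>t. M * norm (\<phi> t :: 'a))"
      by (intro integrable_mult_right Bochner_Integration.integrable_norm integrable_\<phi>)
    show "norm (f (x - \<epsilon> * t) * \<phi> t) \<le> M * norm (\<phi> t :: 'a)" for t
      using f(2) by (simp add: norm_mult mult_right_mono)
    then show "integrable lebesgue (\<lambda>t. f (x - \<epsilon> * t) * \<phi> t)"
      using f(2)[of 0] order_trans[OF norm_ge_zero f(2)[of 0]]
      by (intro Bochner_Integration.integrable_bound[OF i reg_integrand_measurable[OF f(1)]] AE_I2) (simp add: abs_mult)
  qed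
  then show ?thesis by simp
qed

lemma reg_measurable:
  assumes "f \<in> borel_measurable borel"
  shows "reg f \<epsilon> \<in> borel_measurable lebesgue"
  unfolding reg_def[abs_def]
proof (rule sigma_finite_measure.borel_measurable_lebesgue_integral[OF sigma_finite_lebesgue])
  have "(\<lambda>p. f (fst p - \<epsilon> * snd p) * \<phi> (snd p)) \<in> borel_measurable (lebesgue \<Otimes>\<^sub>M lebesgue)"
    by (intro borel_measurable_times measurable_compose[OF measurable_snd] borel_measurable_integrable[OF integrable_\<phi>]
      measurable_compose[OF _ assms] borel_measurable_diff lebesgue_fst lebesgue_snd borel_measurable_const)
  then show "(\<lambda>(x, t). f (x - \<epsilon> * t) * \<phi> t) \<in> borel_measurable (lebesgue \<Otimes>\<^sub>M lebesgue)"
    by (simp add: split_beta)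
qed

lemma reg_tendsto:
  fixes f :: "real \<Rightarrow> 'a::{real_normed_field, euclidean_space}"
  assumes f: "f \<in> borel_measurable borel" "\<And>x. norm (f x) \<le> M" and x: "isCont f x"
  shows "((\<lambda>\<epsilon>. reg f \<epsilon> x) \<longlongrightarrow> f x) (at_right 0)"
proof -
  have "((\<lambda>\<epsilon>. LINT t|lebesgue. f (x - \<epsilon> * t) * \<phi> t) \<longlongrightarrow> (LINT t|lebesgue. f x * \<phi> t)) (at_right 0)"
  proof (rule dominated_convergence_within[where w="\<lambda>t. M * norm (\<phi> t :: 'a)"])
    show "(\<lambda>t. f x * \<phi> t) \<in> borel_measurable lebesgue"
      by (intro borel_measurable_times borel_measurable_integrable[OF integrable_\<phi>] borel_measurable_const)
    show "integrable lebesgue (\<lambda>t. M * norm (\<phi> t :: 'a))"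
      by (intro integrable_mult_right Bochner_Integration.integrable_norm integrable_\<phi>)
    show "AE t in lebesgue. ((\<lambda>\<epsilon>. f (x - \<epsilon> * t) * \<phi> t) \<longlongrightarrow> f x * \<phi> t) (at_right 0)"
    proof (rule AE_I2)
      fix t
      have "((\<lambda>\<epsilon>. x - \<epsilon> * t) \<longlongrightarrow> x - 0 * t) (at_right 0)" by (intro tendsto_intros)
      then have "((\<lambda>\<epsilon>. f (x - \<epsilon> * t)) \<longlongrightarrow> f x) (at_right 0)"
        using isCont_tendsto_compose[OF x] by simp
      then show "((\<lambda>\<epsilon>. f (x - \<epsilon> * t) * \<phi> t) \<longlongrightarrow> f x * \<phi> t) (at_right 0)" by (intro tendsto_intros)
    qed
    show "AE t in lebesgue. norm (f (x - \<epsilon> * t) * \<phi> t) \<le> M * norm (\<phi> t :: 'a)" for \<epsilon>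
      using f(2) by (intro AE_I2) (simp add: norm_mult mult_right_mono)
  qed (rule reg_integrand_measurable[OF f(1)])
  then show ?thesis by (simp add: reg_def lint_\<phi>)
qed

lemma reg_product_tendsto:
  fixes f1 f2 \<psi> :: "real \<Rightarrow> 'a::{real_normed_field, euclidean_space}"
  assumes f1: "f1 \<in> borel_measurable borel" "\<And>x. norm (f1 x) \<le> M1" "\<And>x. x \<noteq> x0 \<Longrightarrow> isCont f1 x"
    and f2: "f2 \<in> borel_measurable borel" "\<And>x. norm (f2 x) \<le> M2" "\<And>x. x \<noteq> x0 \<Longrightarrow> isCont f2 x"
    and \<psi>: "test_fun \<psi>"
  shows "((\<lambda>\<epsilon>. LINT x|lebesgue. reg f1 \<epsilon> x * reg f2 \<epsilon> x * \<psi> x) \<longlongrightarrow> (LINT x|lebesgue. f1 x * f2 x * \<psi> x)) (at_right 0)"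
proof -
  define C where "C = (LINT t|lebesgue. norm (\<phi> t :: 'a))"
  have b1: "norm (reg f1 \<epsilon> x) \<le> M1 * C" and b2: "norm (reg f2 \<epsilon> x) \<le> M2 * C" for \<epsilon> x
    unfolding C_def by (rule reg_bound[OF f1(1,2)] reg_bound[OF f2(1,2)])+
  show ?thesis
  proof (rule dominated_convergence_within[where w="\<lambda>x. (M1 * C) * (M2 * C) * norm (\<psi> x)"])
    have m\<psi>: "\<psi> \<in> borel_measurable lebesgue" using test_fun_integrable[OF \<psi>] by simp
    show "(\<lambda>x. reg f1 \<epsilon> x * reg f2 \<epsilon> x * \<psi> x) \<in> borel_measurable lebesgue" for \<epsilon>
      by (intro borel_measurable_times reg_measurable f1 f2 m\<psi>)
    show "(\<lambda>x. f1 x * f2 x * \<psi> x) \<in> borel_measurable lebesgue"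
      by (intro borel_measurable_times borel_measurable_lebesgue f1 f2 m\<psi>)
    show "integrable lebesgue (\<lambda>x. (M1 * C) * (M2 * C) * norm (\<psi> x))"
      using test_fun_integrable[OF \<psi>] by simp
    have "{x0} \<in> null_sets lebesgue" by simp
    then have "AE x in lebesgue. x \<noteq> x0" by (rule AE_I'[of "{x0}"]) auto
    then show "AE x in lebesgue. ((\<lambda>\<epsilon>. reg f1 \<epsilon> x * reg f2 \<epsilon> x * \<psi> x) \<longlongrightarrow> f1 x * f2 x * \<psi> x) (at_right 0)"
      by eventually_elim (intro tendsto_intros reg_tendsto[OF f1(1,2)] reg_tendsto[OF f2(1,2)] f1(3) f2(3))
    show "AE x in lebesgue. norm (reg f1 \<epsilon> x * reg f2 \<epsilon> x * \<psi> x) \<le> (M1 * C) * (M2 * C) * norm (\<psi> x)" for \<epsilon>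
      unfolding norm_mult using order_trans[OF norm_ge_zero b1[of 0 0]] order_trans[OF norm_ge_zero b2[of 0 0]]
      by (intro AE_I2 mult_mono b1 b2) auto
  qed
qed

end

section \<open>Model products with step functions\<close>

text \<open>A step function with jump at \<open>x0\<close>; its value at \<open>x0\<close> is arbitrary.\<close>

definition step_at :: "real \<Rightarrow> real \<Rightarrow> real \<Rightarrow> (real \<Rightarrow> real) \<Rightarrow> bool" where
  "step_at x0 bl br \<beta> \<longleftrightarrow> (\<forall>x<x0. \<beta> x = bl) \<and> (\<forall>x>x0. \<beta> x = br)"

lemma step_at_measurable:
  assumes "step_at x0 bl br \<beta>" shows "\<beta> \<in> borel_measurable borel"
proof -
  have "\<beta> = (\<lambda>x. if x < x0 then bl else if x > x0 then br else \<beta> x0)"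
    using assms by (auto simp: step_at_def fun_eq_iff not_less le_less)
  also have "\<dots> \<in> borel_measurable borel" by measurable
  finally show ?thesis .
qed

lemma step_at_bounded:
  assumes "step_at x0 bl br \<beta>" shows "\<bar>\<beta> x\<bar> \<le> \<bar>bl\<bar> + \<bar>br\<bar> + \<bar>\<beta> x0\<bar>"
  using assms by (cases x x0 rule: linorder_cases) (auto simp: step_at_def)

lemma step_at_isCont:
  assumes "step_at x0 bl br \<beta>" "x \<noteq> x0"
  shows "isCont (\<lambda>x. of_real (\<beta> x) :: 'a::real_normed_algebra_1) x"
proof (cases "x < x0")
  case True
  then have "eventually (\<lambda>y. of_real (\<beta> y) = (of_real bl :: 'a)) (nhds x)"
    using assms(1) by (auto simp: step_at_def eventually_nhds intro!: exI[of _ "{..<x0}"])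
  then show ?thesis by (simp add: isCont_cong)
next
  case False
  then have "eventually (\<lambda>y. of_real (\<beta> y) = (of_real br :: 'a)) (nhds x)"
    using assms by (auto simp: step_at_def eventually_nhds intro!: exI[of _ "{x0<..}"])
  then show ?thesis by (simp add: isCont_cong)
qed

context bump
begin

text \<open>The regularised step function in the variable \<open>z = (x - x0)/\<epsilon>\<close>. By homogeneity it does not
  depend on \<open>\<epsilon>\<close>.\<close>

definition avg :: "real \<Rightarrow> (real \<Rightarrow> real) \<Rightarrow> real \<Rightarrow> real" where
  "avg x0 \<beta> z = (LINT t|lebesgue. \<beta> (x0 + (z - t)) * \<rho> t)"

lemma integrable_\<rho>: "integrable lebesgue \<rho>" and lint_\<rho>: "(LINT x|lebesgue. \<rho> x) = 1"
proof -
  have z: "\<rho> x = 0" if "x \<notin> {-1..1}" for x using that by (intro \<rho>_0) auto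
  show "integrable lebesgue \<rho>" by (rule lint_Icc(1)[OF \<rho>_cont z])
  show "(LINT x|lebesgue. \<rho> x) = 1" using lint_Icc(2)[OF \<rho>_cont z] integral_\<rho> by simp
qed

lemma avg_step:
  assumes "step_at x0 bl br \<beta>" "z \<in> {-1..1}"
  shows "avg x0 \<beta> z = bl + (br - bl) * \<Phi> z"
proof -
  have i: "integrable lebesgue (\<lambda>t. indicator {-2..z} t *\<^sub>R \<rho> t)"
    by (rule integrable_mult_indicator[OF _ integrable_\<rho>]) simp
  have "{z} \<in> null_sets lebesgue" by simp
  then have ae: "AE t in lebesgue. t \<noteq> z" by (rule AE_I'[of "{z}"]) auto
  have "avg x0 \<beta> z = (LINT t|lebesgue. bl * \<rho> t + (br - bl) * (indicator {-2..z} t *\<^sub>R \<rho> t))"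
    unfolding avg_def
  proof (rule integral_cong_AE)
    show "(\<lambda>t. \<beta> (x0 + (z - t)) * \<rho> t) \<in> borel_measurable lebesgue"
      by (intro borel_measurable_times borel_measurable_integrable[OF integrable_\<rho>]
        borel_measurable_lebesgue measurable_compose[OF _ step_at_measurable[OF assms(1)]]) measurable
    show "(\<lambda>t. bl * \<rho> t + (br - bl) * (indicator {-2..z} t *\<^sub>R \<rho> t)) \<in> borel_measurable lebesgue"
      by (intro borel_measurable_integrable Bochner_Integration.integrable_add integrable_mult_right integrable_\<rho> i)
    show "AE t in lebesgue. \<beta> (x0 + (z - t)) * \<rho> t = bl * \<rho> t + (br - bl) * (indicator {-2..z} t *\<^sub>R \<rho> t)"
      using ae
    proof eventually_elim
      case (elim t)
      consider "t < -2" | "-2 \<le> t" "t < z" | "t > z" using elim by linarith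
      then show ?case
        using assms by cases (auto simp: step_at_def \<rho>_0 indicator_def algebra_simps)
    qed
  qed
  also have "\<dots> = bl * (LINT t|lebesgue. \<rho> t) + (br - bl) * (LINT t|lebesgue. indicator {-2..z} t *\<^sub>R \<rho> t)"
    by (simp only: Bochner_Integration.integral_add[OF integrable_mult_right[OF integrable_\<rho>] integrable_mult_right[OF i]]
        integral_mult_right_zero)
  also have "(LINT t|lebesgue. indicator {-2..z} t *\<^sub>R \<rho> t) = \<Phi> z"
    using set_lebesgue_integral_eq_integral(2)[OF absolutely_integrable_continuous_real[OF \<rho>_cont, of "-2" z]]
    by (simp add: set_lebesgue_integral_def \<Phi>_def)
  finally show ?thesis by (simp add: lint_\<rho>)
qed

lemma reg_step:
  assumes "step_at x0 bl br \<beta>" "\<epsilon> > 0"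
  shows "reg (\<lambda>x. of_real (\<beta> x)) \<epsilon> (x0 + \<epsilon> * z) = (of_real (avg x0 \<beta> z) :: 'a::{real_normed_field, euclidean_space})"
proof -
  have "\<beta> (x0 + \<epsilon> * s) = \<beta> (x0 + s)" for s
    using assms by (cases s "0::real" rule: linorder_cases) (auto simp: step_at_def mult_less_0_iff)
  then have "\<beta> (x0 + \<epsilon> * z - \<epsilon> * t) = \<beta> (x0 + (z - t))" for t
    by (metis add_diff_eq right_diff_distrib)
  then have "reg (\<lambda>x. of_real (\<beta> x)) \<epsilon> (x0 + \<epsilon> * z) = (LINT t|lebesgue. of_real (\<beta> (x0 + (z - t)) * \<rho> t) :: 'a)"
    by (simp add: reg_def \<phi>_def)
  also have "\<dots> = of_real (avg x0 \<beta> z)" unfolding avg_def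
  proof (rule integral_of_real, rule bounded_times_test_integrable)
    show "(\<lambda>t. \<beta> (x0 + (z - t))) \<in> borel_measurable lebesgue"
      by (intro borel_measurable_lebesgue measurable_compose[OF _ step_at_measurable[OF assms(1)]]) measurable
    show "norm (\<beta> (x0 + (z - t))) \<le> \<bar>bl\<bar> + \<bar>br\<bar> + \<bar>\<beta> x0\<bar>" for t
      using step_at_bounded[OF assms(1)] by simp
  qed (rule integrable_\<rho>)
  finally show ?thesis .
qed

lemma model_product_tendsto:
  assumes "has_model_product (regular_dist a) u w" "test_fun \<psi>"
  shows "((\<lambda>\<epsilon>. LINT x|lebesgue. reg a \<epsilon> x * convol u (delta_net \<phi> \<epsilon>) x * \<psi> x) \<longlongrightarrow> w \<psi>) (at_right 0)"
proof -
  have "((\<lambda>\<epsilon>. regular_dist (\<lambda>x. convol (regular_dist a) (delta_net \<phi> \<epsilon>) x * convol u (delta_net \<phi> \<epsilon>) x) \<psi>) \<longlongrightarrow> w \<psi>) (at_right 0)"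
    using assms mollifier_\<phi> unfolding has_model_product_def by blast
  then show ?thesis
    by (rule Lim_transform_eventually) (auto simp: eventually_at_filter regular_dist_def[of "\<lambda>x. _ x * _ x"] convol_regular)
qed

text \<open>Where the coefficient is constant, the model product is the ordinary product.\<close>

lemma model_product_local:
  fixes u :: "'a::{real_normed_field, euclidean_space} functional"
  assumes w: "has_model_product (regular_dist (\<lambda>x. of_real (\<beta> x))) u w" and u: "distribution u"
    and \<psi>: "test_fun \<psi>" "supp \<psi> \<subseteq> U" and U: "open U" "\<And>x. x \<in> U \<Longrightarrow> \<beta> x = b"
  shows "w \<psi> = of_real b * u \<psi>"
proof -
  have "compact (supp \<psi>)" using \<psi>(1) by (simp add: test_fun_def)
  then obtain e where "e > 0" and e: "\<And>x. x \<in> supp \<psi> \<Longrightarrow> ball x e \<subseteq> U"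
    using Heine_Borel_lemma[of "supp \<psi>" "{U}"] \<psi>(2) U(1) by auto
  have *: "reg (\<lambda>x. of_real (\<beta> x)) \<epsilon> x * v * \<psi> x = of_real b * (v * \<psi> x)" if "\<epsilon> \<in> {0<..<e}" for \<epsilon> x and v :: 'a
  proof (cases "x \<in> supp \<psi>")
    case True
    have "of_real (\<beta> (x - \<epsilon> * t)) * \<phi> t = of_real b * (\<phi> t :: 'a)" for t
    proof (cases "\<bar>t\<bar> > 1")
      case False
      then have "\<bar>\<epsilon> * t\<bar> \<le> \<epsilon> * 1" unfolding abs_mult using that by (intro mult_mono) auto
      then have "x - \<epsilon> * t \<in> ball x e" using that by (auto simp: dist_real_def)
      then have "x - \<epsilon> * t \<in> U" using e[OF True] by blast
      then show ?thesis using U(2) by simp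
    qed (simp add: \<phi>_0)
    then have "reg (\<lambda>x. of_real (\<beta> x)) \<epsilon> x = (of_real b :: 'a)"
      unfolding reg_def by (simp only: integral_mult_right_zero lint_\<phi> mult_1_right)
    then show ?thesis by simp
  qed (simp add: supp_0)
  have "((\<lambda>\<epsilon>. of_real b * (LINT x|lebesgue. convol u (delta_net \<phi> \<epsilon>) x * \<psi> x)) \<longlongrightarrow> of_real b * u \<psi>) (at_right 0)"
    by (intro tendsto_intros convol_pairing_tendsto u \<psi> test_\<phi> \<phi>_0 integral_\<phi>)
  moreover have "eventually (\<lambda>\<epsilon>. of_real b * (LINT x|lebesgue. convol u (delta_net \<phi> \<epsilon>) x * \<psi> x) =
      (LINT x|lebesgue. reg (\<lambda>x. of_real (\<beta> x)) \<epsilon> x * convol u (delta_net \<phi> \<epsilon>) x * \<psi> x)) (at_right 0)"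
    using eventually_at_right_real[OF \<open>e > 0\<close>] by (rule eventually_mono) (simp only: * integral_mult_right_zero)
  ultimately have "((\<lambda>\<epsilon>. LINT x|lebesgue. reg (\<lambda>x. of_real (\<beta> x)) \<epsilon> x * convol u (delta_net \<phi> \<epsilon>) x * \<psi> x)
     \<longlongrightarrow> of_real b * u \<psi>) (at_right 0)" by (rule Lim_transform_eventually)
  with model_product_tendsto[OF w \<psi>(1)] show ?thesis
    by (rule tendsto_unique[OF trivial_limit_at_right_real])
qed

lemma nth_deriv_delta_net:
  assumes "\<epsilon> > 0"
  shows "nth_deriv k (delta_net \<phi> \<epsilon>) z = (of_real ((1 / \<epsilon>) ^ Suc k * D k (z / \<epsilon>)) :: 'a::{real_normed_field, euclidean_space})"
proof -
  let ?\<phi> = "\<phi> :: real \<Rightarrow> 'a"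
  have sm: "smooth ?\<phi>" by (rule test_fun_smooth[OF test_\<phi>])
  have "delta_net ?\<phi> \<epsilon> = (\<lambda>x. (1 / \<epsilon>) *\<^sub>R ?\<phi> ((1 / \<epsilon>) * x + 0))"
    by (simp add: delta_net_def fun_eq_iff scaleR_conv_of_real divide_inverse mult.commute)
  then show ?thesis
    by (simp only: nth_deriv_linear[OF smooth_affine[OF sm] bounded_linear_scaleR_right] nth_deriv_affine[OF sm] nth_deriv_\<phi>)
       (simp add: scaleR_conv_of_real)
qed

text \<open>If \<open>u\<close> is a bounded function plus derivatives of the delta distribution at \<open>x0\<close>, the product
  at scale \<open>\<epsilon>\<close> splits into a regular part, bounded in \<open>\<epsilon>\<close>, and singular terms that become explicit in
  the variable \<open>z = (x - x0)/\<epsilon>\<close>.\<close>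

lemma model_product_expansion:
  fixes u :: "'a::{real_normed_field, euclidean_space} functional"
  assumes w: "has_model_product (regular_dist (\<lambda>x. of_real (\<beta> x))) u w"
    and \<beta>: "step_at x0 bl br \<beta>"
    and f: "f \<in> borel_measurable borel" "\<And>x. norm (f x) \<le> M"
    and rep: "\<And>\<psi>. test_fun \<psi> \<Longrightarrow> u \<psi> = (LINT x|lebesgue. f x * \<psi> x) + (\<Sum>k\<le>N. c k * nth_deriv k \<psi> x0)"
    and \<psi>: "test_fun \<psi>"
  shows "((\<lambda>\<epsilon>. (LINT x|lebesgue. reg (\<lambda>x. of_real (\<beta> x)) \<epsilon> x * reg f \<epsilon> x * \<psi> x)
      + (\<Sum>k\<le>N. c k * (of_real ((-1) ^ k * (1 / \<epsilon>) ^ k) *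
            (LINT z|lebesgue. of_real (avg x0 \<beta> z * D k z) * \<psi> (x0 + \<epsilon> * z))))) \<longlongrightarrow> w \<psi>) (at_right 0)"
proof -
  let ?a = "\<lambda>x. of_real (\<beta> x) :: 'a"
  define B where "B = \<bar>bl\<bar> + \<bar>br\<bar> + \<bar>\<beta> x0\<bar>"
  have a: "?a \<in> borel_measurable borel" "\<And>x. norm (?a x) \<le> B"
    using step_at_measurable[OF \<beta>] step_at_bounded[OF \<beta>] by (simp_all add: B_def)
  define C where "C = (LINT t|lebesgue. norm (\<phi> t :: 'a))"
  have ba: "norm (reg ?a \<epsilon> x) \<le> B * C" and bf: "norm (reg f \<epsilon> x) \<le> M * C" for \<epsilon> x
    unfolding C_def by (rule reg_bound[OF a] reg_bound[OF f])+
  have i\<psi>: "integrable lebesgue \<psi>" by (rule test_fun_integrable[OF \<psi>])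
  have eq: "(LINT x|lebesgue. reg ?a \<epsilon> x * convol u (delta_net \<phi> \<epsilon>) x * \<psi> x) =
     (LINT x|lebesgue. reg ?a \<epsilon> x * reg f \<epsilon> x * \<psi> x)
      + (\<Sum>k\<le>N. c k * (of_real ((-1) ^ k * (1 / \<epsilon>) ^ k) *
            (LINT z|lebesgue. of_real (avg x0 \<beta> z * D k z) * \<psi> (x0 + \<epsilon> * z))))" if "\<epsilon> > 0" for \<epsilon>
  proof -
    let ?p = "delta_net \<phi> \<epsilon> :: real \<Rightarrow> 'a"
    have p: "test_fun ?p" by (rule test_fun_delta_net[OF test_\<phi> that])
    have conv: "convol u ?p x = reg f \<epsilon> x + (\<Sum>k\<le>N. c k * ((-1) ^ k *\<^sub>R nth_deriv k ?p (x - x0)))" for x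
      using rep[OF test_fun_reflect[OF p, of x]] convol_regular[OF that, of f x]
      by (simp add: convol_def regular_dist_def nth_deriv_reflect test_fun_smooth p)
    define s where "s k x = reg ?a \<epsilon> x * nth_deriv k ?p (x - x0) * \<psi> x" for k x
    have int_s: "integrable lebesgue (s k)" for k
    proof -
      obtain M' where "M' > 0" and M': "\<And>x. norm (nth_deriv k ?p x) \<le> M'" using test_fun_bounded[OF p] by metis
      show ?thesis unfolding s_def
      proof (rule bounded_times_test_integrable[where M="B * C * M'"])
        have "continuous_on UNIV (\<lambda>x. nth_deriv k ?p (x - x0))"
          by (rule continuous_on_compose2[OF continuous_nth_deriv[OF test_fun_smooth[OF p], of UNIV]])
             (auto intro!: continuous_intros)
        then show "(\<lambda>x. reg ?a \<epsilon> x * nth_deriv k ?p (x - x0)) \<in> borel_measurable lebesgue"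
          by (intro borel_measurable_times reg_measurable a continuous_measurable_lebesgue)
        show "norm (reg ?a \<epsilon> x * nth_deriv k ?p (x - x0)) \<le> B * C * M'" for x
          unfolding norm_mult using order_trans[OF norm_ge_zero ba[of 0 0]] by (intro mult_mono ba M') auto
      qed (rule i\<psi>)
    qed
    have i0: "integrable lebesgue (\<lambda>x. reg ?a \<epsilon> x * reg f \<epsilon> x * \<psi> x)"
    proof (rule bounded_times_test_integrable[where M="B * C * (M * C)"])
      show "norm (reg ?a \<epsilon> x * reg f \<epsilon> x) \<le> B * C * (M * C)" for x
        unfolding norm_mult using order_trans[OF norm_ge_zero ba[of 0 0]] by (intro mult_mono ba bf) auto
    qed (intro borel_measurable_times reg_measurable a f i\<psi>)+
    have "(LINT x|lebesgue. reg ?a \<epsilon> x * convol u ?p x * \<psi> x) =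
      (LINT x|lebesgue. reg ?a \<epsilon> x * reg f \<epsilon> x * \<psi> x + (\<Sum>k\<le>N. (c k * of_real ((-1) ^ k)) * s k x))"
    proof (intro Bochner_Integration.integral_cong refl)
      fix x
      have "reg ?a \<epsilon> x * convol u ?p x * \<psi> x = reg ?a \<epsilon> x * reg f \<epsilon> x * \<psi> x +
         (reg ?a \<epsilon> x * \<psi> x) * (\<Sum>k\<le>N. c k * ((-1) ^ k *\<^sub>R nth_deriv k ?p (x - x0)))"
        by (simp add: conv algebra_simps)
      also have "(reg ?a \<epsilon> x * \<psi> x) * (\<Sum>k\<le>N. c k * ((-1) ^ k *\<^sub>R nth_deriv k ?p (x - x0))) =
         (\<Sum>k\<le>N. (c k * of_real ((-1) ^ k)) * s k x)"
        unfolding sum_distrib_left s_def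
        by (intro sum.cong refl) (simp add: scaleR_conv_of_real ac_simps)
      finally show "reg ?a \<epsilon> x * convol u ?p x * \<psi> x =
         reg ?a \<epsilon> x * reg f \<epsilon> x * \<psi> x + (\<Sum>k\<le>N. (c k * of_real ((-1) ^ k)) * s k x)" .
    qed
    also have "\<dots> = (LINT x|lebesgue. reg ?a \<epsilon> x * reg f \<epsilon> x * \<psi> x) + (\<Sum>k\<le>N. (c k * of_real ((-1) ^ k)) * (LINT x|lebesgue. s k x))"
      by (subst Bochner_Integration.integral_add[OF i0])
         (auto intro!: Bochner_Integration.integrable_sum integrable_mult_right int_s simp: Bochner_Integration.integral_sum int_s)
    also have "(\<lambda>k. LINT x|lebesgue. s k x) = (\<lambda>k. of_real ((1 / \<epsilon>) ^ k) * (LINT z|lebesgue. of_real (avg x0 \<beta> z * D k z) * \<psi> (x0 + \<epsilon> * z)))"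
    proof
      fix k
      have "(LINT x|lebesgue. s k x) = \<bar>\<epsilon>\<bar> *\<^sub>R (LINT z|lebesgue. s k (x0 + \<epsilon> * z))"
        by (rule lebesgue_integral_real_affine) (use that in auto)
      also have "\<dots> = (LINT z|lebesgue. \<bar>\<epsilon>\<bar> *\<^sub>R s k (x0 + \<epsilon> * z))"
        by (rule integral_scaleR_right[symmetric])
      also have "\<dots> = (LINT z|lebesgue. of_real ((1 / \<epsilon>) ^ k) * (of_real (avg x0 \<beta> z * D k z) * \<psi> (x0 + \<epsilon> * z)))"
      proof (intro Bochner_Integration.integral_cong refl)
        fix z
        have z: "(x0 + \<epsilon> * z - x0) / \<epsilon> = z" using that by simp
        show "\<bar>\<epsilon>\<bar> *\<^sub>R s k (x0 + \<epsilon> * z) =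
            of_real ((1 / \<epsilon>) ^ k) * (of_real (avg x0 \<beta> z * D k z) * \<psi> (x0 + \<epsilon> * z))"
          unfolding s_def reg_step[OF \<beta> that] nth_deriv_delta_net[OF that] z
          using that by (simp add: scaleR_conv_of_real)
      qed
      also have "\<dots> = of_real ((1 / \<epsilon>) ^ k) * (LINT z|lebesgue. of_real (avg x0 \<beta> z * D k z) * \<psi> (x0 + \<epsilon> * z))"
        by (rule integral_mult_right_zero)
      finally show "(LINT x|lebesgue. s k x) = of_real ((1 / \<epsilon>) ^ k) * (LINT z|lebesgue. of_real (avg x0 \<beta> z * D k z) * \<psi> (x0 + \<epsilon> * z))" .
    qed
    finally show ?thesis by (simp add: mult.assoc)
  qed
  show ?thesis
    by (rule Lim_transform_eventually[OF model_product_tendsto[OF w \<psi>]])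
       (use eq in \<open>auto simp: eventually_at_filter\<close>)
qed

lemma
  assumes "step_at x0 bl br \<beta>"
  shows moment_integrable: "integrable lebesgue (\<lambda>z. z ^ j * avg x0 \<beta> z * D k z)"
    and moment_lint: "(LINT z|lebesgue. z ^ j * avg x0 \<beta> z * D k z) = I (\<lambda>x. x ^ j * (bl + (br - bl) * \<Phi> x) * D k x)"
proof -
  let ?h = "\<lambda>z. if z \<in> {-2..2} then z ^ j * (bl + (br - bl) * \<Phi> z) * D k z else 0"
  have eq: "(\<lambda>z. z ^ j * avg x0 \<beta> z * D k z) = ?h"
  proof
    fix z show "z ^ j * avg x0 \<beta> z * D k z = ?h z"
      using avg_step[OF assms, of z] D_0[of z k] by (cases "z \<in> {-1..1}") (auto simp: abs_real_def split: if_splits)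
  qed
  have "continuous_on {-2..2} (\<lambda>z. z ^ j * (bl + (br - bl) * \<Phi> z) * D k z)"
    by (intro continuous_intros \<Phi>_cont D_cont)
  then have c: "continuous_on {-2..2} ?h" by (rule continuous_on_eq) auto
  have z: "?h z = 0" if "z \<notin> {-2..2}" for z using that by auto
  show "integrable lebesgue (\<lambda>z. z ^ j * avg x0 \<beta> z * D k z)"
    unfolding eq by (rule lint_Icc(1)[OF c z])
  have "I ?h = I (\<lambda>x. x ^ j * (bl + (br - bl) * \<Phi> x) * D k x)"
    by (intro integral_cong) auto
  then show "(LINT z|lebesgue. z ^ j * avg x0 \<beta> z * D k z) = I (\<lambda>x. x ^ j * (bl + (br - bl) * \<Phi> x) * D k x)"
    unfolding eq using lint_Icc(2)[OF c z] by simp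
qed

text \<open>Testing with a monomial at \<open>x0\<close> of degree \<open>j\<close> turns the \<open>k\<close>-th singular term into a
  constant times \<open>\<epsilon>\<^sup>j\<^sup>-\<^sup>k\<close>. After multiplication by \<open>\<epsilon>\<^sup>N\<^sup>-\<^sup>j\<close>, where \<open>j < N\<close>, only the term \<open>k = N\<close>
  survives in the limit, and the limit must be \<open>0\<close> since the product converges.\<close>

lemma top_coefficient_zero:
  fixes u :: "'a::{real_normed_field, euclidean_space} functional"
  assumes w: "has_model_product (regular_dist (\<lambda>x. of_real (\<beta> x))) u w"
    and \<beta>: "step_at x0 bl br \<beta>" "bl \<noteq> br"
    and f: "f \<in> borel_measurable borel" "\<And>x. norm (f x) \<le> M" "\<And>x. x \<noteq> x0 \<Longrightarrow> isCont f x"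
    and rep: "\<And>\<psi>. test_fun \<psi> \<Longrightarrow> u \<psi> = (LINT x|lebesgue. f x * \<psi> x) + (\<Sum>k\<le>N. c k * nth_deriv k \<psi> x0)"
    and N: "N \<ge> 1"
  shows "c N = 0"
proof -
  obtain j where j: "j < N" "I (\<lambda>x. x ^ j * (bl + (br - bl) * \<Phi> x) * D N x) \<noteq> 0"
    using nonzero_moment[OF \<beta>(2) N] by metis
  define m where "m k = I (\<lambda>x. x ^ j * (bl + (br - bl) * \<Phi> x) * D k x) / fact j" for k
  obtain e :: "nat \<Rightarrow> real \<Rightarrow> 'a" where e: "\<And>k. test_fun (e k)"
    "\<And>k x. \<bar>x - x0\<bar> \<le> 1 \<Longrightarrow> e k x = of_real ((x - x0) ^ k / fact k)"
    using test_monomial[of x0] by metis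
  let ?a = "\<lambda>x. of_real (\<beta> x) :: 'a"
  let ?Rg = "\<lambda>\<epsilon>. LINT x|lebesgue. reg ?a \<epsilon> x * reg f \<epsilon> x * e j x"
  let ?\<mu> = "\<lambda>k \<epsilon>. LINT z|lebesgue. of_real (avg x0 \<beta> z * D k z) * e j (x0 + \<epsilon> * z)"
  have \<mu>: "?\<mu> k \<epsilon> = of_real (\<epsilon> ^ j * m k)" if "\<epsilon> \<in> {0<..<1}" for k \<epsilon>
  proof -
    have "?\<mu> k \<epsilon> = (LINT z|lebesgue. of_real (\<epsilon> ^ j / fact j * (z ^ j * avg x0 \<beta> z * D k z)))"
    proof (intro Bochner_Integration.integral_cong refl)
      fix z
      show "of_real (avg x0 \<beta> z * D k z) * e j (x0 + \<epsilon> * z) = (of_real (\<epsilon> ^ j / fact j * (z ^ j * avg x0 \<beta> z * D k z)) :: 'a)"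
      proof (cases "\<bar>z\<bar> > 1")
        case False
        then have "\<bar>\<epsilon> * z\<bar> \<le> 1 * 1" unfolding abs_mult using that by (intro mult_mono) auto
        then have "e j (x0 + \<epsilon> * z) = of_real ((\<epsilon> * z) ^ j / fact j)" using e(2)[of "x0 + \<epsilon> * z" j] by simp
        then show ?thesis by (simp add: power_mult_distrib ac_simps)
      qed (simp add: D_0)
    qed
    also have "\<dots> = of_real (\<epsilon> ^ j / fact j * (LINT z|lebesgue. z ^ j * avg x0 \<beta> z * D k z))"
      by (simp only: integral_of_real[OF integrable_mult_right[OF moment_integrable[OF \<beta>(1)]]] integral_mult_right_zero)
    finally show ?thesis by (simp add: moment_lint[OF \<beta>(1)] m_def)
  qed
  have a: "?a \<in> borel_measurable borel" "\<And>x. norm (?a x) \<le> \<bar>bl\<bar> + \<bar>br\<bar> + \<bar>\<beta> x0\<bar>"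
    using step_at_measurable[OF \<beta>(1)] step_at_bounded[OF \<beta>(1)] by simp_all
  have Rg: "(?Rg \<longlongrightarrow> (LINT x|lebesgue. ?a x * f x * e j x)) (at_right 0)"
    by (rule reg_product_tendsto[OF a step_at_isCont[OF \<beta>(1)] f e(1)])
  have pow: "((\<lambda>\<epsilon>. of_real (\<epsilon> ^ i) :: 'a) \<longlongrightarrow> of_real (0 ^ i)) (at_right 0)" for i
    by (intro tendsto_intros)
  have 0: "((\<lambda>\<epsilon>. of_real (\<epsilon> ^ (N - j)) * (?Rg \<epsilon> + (\<Sum>k\<le>N. c k * (of_real ((-1) ^ k * (1 / \<epsilon>) ^ k) * ?\<mu> k \<epsilon>)))) \<longlongrightarrow>
     of_real (0 ^ (N - j)) * w (e j)) (at_right 0)"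
    by (intro tendsto_mult[OF pow] model_product_expansion[OF w \<beta>(1) f(1,2) rep e(1)])
  have 1: "((\<lambda>\<epsilon>. of_real (\<epsilon> ^ (N - j)) * ?Rg \<epsilon> + (\<Sum>k\<le>N. c k * (of_real ((-1) ^ k * m k) * of_real (\<epsilon> ^ (N - k))))) \<longlongrightarrow>
     of_real (0 ^ (N - j)) * (LINT x|lebesgue. ?a x * f x * e j x) + (\<Sum>k\<le>N. c k * (of_real ((-1) ^ k * m k) * of_real (0 ^ (N - k))))) (at_right 0)"
    by (intro tendsto_add tendsto_sum tendsto_mult[OF tendsto_const] tendsto_mult[OF pow] pow Rg)
  have "eventually (\<lambda>\<epsilon>. of_real (\<epsilon> ^ (N - j)) * (?Rg \<epsilon> + (\<Sum>k\<le>N. c k * (of_real ((-1) ^ k * (1 / \<epsilon>) ^ k) * ?\<mu> k \<epsilon>)))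
     = of_real (\<epsilon> ^ (N - j)) * ?Rg \<epsilon> + (\<Sum>k\<le>N. c k * (of_real ((-1) ^ k * m k) * of_real (\<epsilon> ^ (N - k))))) (at_right 0)"
    using eventually_at_right_real[OF zero_less_one]
  proof (rule eventually_mono)
    fix \<epsilon> :: real assume \<epsilon>: "\<epsilon> \<in> {0<..<1}"
    have "of_real (\<epsilon> ^ (N - j)) * (c k * (of_real ((-1) ^ k * (1 / \<epsilon>) ^ k) * ?\<mu> k \<epsilon>))
      = c k * (of_real ((-1) ^ k * m k) * of_real (\<epsilon> ^ (N - k)))" if "k \<le> N" for k
    proof -
      have "\<epsilon> ^ (N - j) * ((1 / \<epsilon>) ^ k * \<epsilon> ^ j) = \<epsilon> ^ N * (1 / \<epsilon>) ^ k"
        using j(1) by (simp add: power_add[symmetric])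
      also have "\<dots> = \<epsilon> ^ (N - k)"
        using \<epsilon> that by (simp add: power_diff power_one_over)
      finally have p: "\<epsilon> ^ (N - j) * ((1 / \<epsilon>) ^ k * \<epsilon> ^ j) = \<epsilon> ^ (N - k)" .
      have "of_real (\<epsilon> ^ (N - j)) * (c k * (of_real ((-1) ^ k * (1 / \<epsilon>) ^ k) * ?\<mu> k \<epsilon>)) =
        c k * of_real ((-1) ^ k * m k * (\<epsilon> ^ (N - j) * ((1 / \<epsilon>) ^ k * \<epsilon> ^ j)))"
        unfolding \<mu>[OF \<epsilon>] by (simp add: ac_simps)
      then show ?thesis unfolding p by simp
    qed
    then show "of_real (\<epsilon> ^ (N - j)) * (?Rg \<epsilon> + (\<Sum>k\<le>N. c k * (of_real ((-1) ^ k * (1 / \<epsilon>) ^ k) * ?\<mu> k \<epsilon>)))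
     = of_real (\<epsilon> ^ (N - j)) * ?Rg \<epsilon> + (\<Sum>k\<le>N. c k * (of_real ((-1) ^ k * m k) * of_real (\<epsilon> ^ (N - k))))"
      unfolding distrib_left sum_distrib_left by (intro arg_cong2[of _ _ _ _ "(+)"] sum.cong refl) simp
  qed
  from Lim_transform_eventually[OF 0 this] 1
  have "of_real (0 ^ (N - j)) * w (e j) = of_real (0 ^ (N - j)) * (LINT x|lebesgue. ?a x * f x * e j x)
      + (\<Sum>k\<le>N. c k * (of_real ((-1) ^ k * m k) * of_real (0 ^ (N - k))))"
    by (rule tendsto_unique[OF trivial_limit_at_right_real])
  moreover have "(\<Sum>k\<le>N. c k * (of_real ((-1) ^ k * m k) * of_real (0 ^ (N - k)))) = c N * of_real ((-1) ^ N * m N)"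
  proof -
    have "(\<Sum>k\<le>N. c k * (of_real ((-1) ^ k * m k) * of_real (0 ^ (N - k)))) =
      (\<Sum>k\<le>N. if k = N then c N * of_real ((-1) ^ N * m N) else 0)"
      by (intro sum.cong refl) (auto simp: power_0_left)
    then show ?thesis by simp
  qed
  ultimately have "c N * of_real ((-1) ^ N * m N) = 0" using j(1) by (simp add: power_0_left)
  moreover have "m N \<noteq> 0" using j(2) by (simp add: m_def)
  ultimately show ?thesis by simp
qed

lemma only_delta:
  fixes u :: "'a::{real_normed_field, euclidean_space} functional"
  assumes w: "has_model_product (regular_dist (\<lambda>x. of_real (\<beta> x))) u w"
    and \<beta>: "step_at x0 bl br \<beta>" "bl \<noteq> br"
    and f: "f \<in> borel_measurable borel" "\<And>x. norm (f x) \<le> M" "\<And>x. x \<noteq> x0 \<Longrightarrow> isCont f x"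
    and rep: "\<And>\<psi>. test_fun \<psi> \<Longrightarrow> u \<psi> = (LINT x|lebesgue. f x * \<psi> x) + (\<Sum>k\<le>N. c k * nth_deriv k \<psi> x0)"
  shows "test_fun \<psi> \<Longrightarrow> u \<psi> = (LINT x|lebesgue. f x * \<psi> x) + c 0 * \<psi> x0"
  using rep
proof (induction N)
  case (Suc N)
  have "c (Suc N) = 0" by (rule top_coefficient_zero[OF w \<beta> f Suc.prems(2)]) auto
  then show ?case using Suc by simp
qed simp

text \<open>The model product of a step function with \<open>\<delta>\<close> is the mean of the one-sided values times
  \<open>\<delta>\<close>.\<close>

lemma model_product_delta:
  fixes u :: "'a::{real_normed_field, euclidean_space} functional"
  assumes w: "has_model_product (regular_dist (\<lambda>x. of_real (\<beta> x))) u w"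
    and \<beta>: "step_at x0 bl br \<beta>"
    and f: "f \<in> borel_measurable borel" "\<And>x. norm (f x) \<le> M" "\<And>x. x \<noteq> x0 \<Longrightarrow> isCont f x"
    and rep: "\<And>\<psi>. test_fun \<psi> \<Longrightarrow> u \<psi> = (LINT x|lebesgue. f x * \<psi> x) + c * \<psi> x0"
    and \<psi>: "test_fun \<psi>"
  shows "w \<psi> = (LINT x|lebesgue. of_real (\<beta> x) * f x * \<psi> x) + c * of_real ((bl + br) / 2) * \<psi> x0"
proof -
  let ?a = "\<lambda>x. of_real (\<beta> x) :: 'a"
  have a: "?a \<in> borel_measurable borel" "\<And>x. norm (?a x) \<le> \<bar>bl\<bar> + \<bar>br\<bar> + \<bar>\<beta> x0\<bar>"
    using step_at_measurable[OF \<beta>(1)] step_at_bounded[OF \<beta>(1)] by simp_all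
  have rep': "u \<psi> = (LINT x|lebesgue. f x * \<psi> x) + (\<Sum>k\<le>0. (\<lambda>_. c) k * nth_deriv k \<psi> x0)" if "test_fun \<psi>" for \<psi>
    using rep[OF that] by simp
  have h: "((\<lambda>\<epsilon>. LINT z|lebesgue. of_real (avg x0 \<beta> z * D 0 z) * \<psi> (x0 + \<epsilon> * z)) \<longlongrightarrow>
     (LINT z|lebesgue. of_real (avg x0 \<beta> z * D 0 z) * \<psi> x0)) (at_right 0)"
  proof -
    let ?h = "\<lambda>z. of_real (avg x0 \<beta> z * D 0 z) :: 'a"
    have ih: "integrable lebesgue ?h"
      using integrable_of_real[OF moment_integrable[OF \<beta>, of 0 0], where 'a='a] by simp
    obtain M' where "M' > 0" and M': "\<And>x. norm (\<psi> x) \<le> M'"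
      using test_fun_bounded[OF \<psi>, of 0] by (metis nth_deriv_0)
    have c\<psi>: "continuous_on UNIV \<psi>" by (rule smooth_continuous[OF test_fun_smooth[OF \<psi>]])
    show ?thesis
    proof (rule dominated_convergence_within[where w="\<lambda>z. norm (?h z) * M'"])
      show "(\<lambda>z. ?h z * \<psi> (x0 + \<epsilon> * z)) \<in> borel_measurable lebesgue" for \<epsilon>
        by (intro borel_measurable_times borel_measurable_integrable[OF ih] continuous_measurable_lebesgue
            continuous_on_compose2[OF c\<psi>] continuous_intros) auto
      show "(\<lambda>z. ?h z * \<psi> x0) \<in> borel_measurable lebesgue"
        by (intro borel_measurable_times borel_measurable_integrable[OF ih] borel_measurable_const)
      show "integrable lebesgue (\<lambda>z. norm (?h z) * M')" 
        by (rule integrable_mult_left[OF Bochner_Integration.integrable_norm[OF ih]])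
      show "AE z in lebesgue. norm (?h z * \<psi> (x0 + \<epsilon> * z)) \<le> norm (?h z) * M'" for \<epsilon>
        unfolding norm_mult[of "?h _"] by (intro AE_I2 mult_left_mono M') auto
      show "AE z in lebesgue. ((\<lambda>\<epsilon>. ?h z * \<psi> (x0 + \<epsilon> * z)) \<longlongrightarrow> ?h z * \<psi> x0) (at_right 0)"
      proof (rule AE_I2)
        fix z
        have "isCont \<psi> x0" using c\<psi> by (simp add: continuous_on_eq_continuous_at)
        moreover have "((\<lambda>\<epsilon>. x0 + \<epsilon> * z) \<longlongrightarrow> x0 + 0 * z) (at_right 0)" by (intro tendsto_intros)
        ultimately have "((\<lambda>\<epsilon>. \<psi> (x0 + \<epsilon> * z)) \<longlongrightarrow> \<psi> x0) (at_right 0)"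
          using isCont_tendsto_compose by force
        then show "((\<lambda>\<epsilon>. ?h z * \<psi> (x0 + \<epsilon> * z)) \<longlongrightarrow> ?h z * \<psi> x0) (at_right 0)" by (rule tendsto_mult[OF tendsto_const])
      qed
    qed
  qed
  have "(LINT z|lebesgue. of_real (avg x0 \<beta> z * D 0 z) * \<psi> x0) = of_real (LINT z|lebesgue. z ^ 0 * avg x0 \<beta> z * D 0 z) * \<psi> x0"
    using integral_of_real[OF moment_integrable[OF \<beta>, of 0 0], where 'a='a] by (simp del: of_real_mult)
  also have "\<dots> = of_real ((bl + br) / 2) * \<psi> x0"
    unfolding moment_lint[OF \<beta>] by (simp only: power_0 mult_1 nth_deriv_0 mean_moment)
  finally have mu: "(LINT z|lebesgue. of_real (avg x0 \<beta> z * D 0 z) * \<psi> x0) = of_real ((bl + br) / 2) * \<psi> x0" .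
  have "((\<lambda>\<epsilon>. (LINT x|lebesgue. reg ?a \<epsilon> x * reg f \<epsilon> x * \<psi> x)
      + c * (LINT z|lebesgue. of_real (avg x0 \<beta> z * D 0 z) * \<psi> (x0 + \<epsilon> * z))) \<longlongrightarrow>
      (LINT x|lebesgue. ?a x * f x * \<psi> x) + c * (of_real ((bl + br) / 2) * \<psi> x0)) (at_right 0)"
    by (intro tendsto_add tendsto_mult[OF tendsto_const] h[unfolded mu] reg_product_tendsto[OF a step_at_isCont[OF \<beta>] f \<psi>])
  moreover have "((\<lambda>\<epsilon>. (LINT x|lebesgue. reg ?a \<epsilon> x * reg f \<epsilon> x * \<psi> x)
      + c * (LINT z|lebesgue. of_real (avg x0 \<beta> z * D 0 z) * \<psi> (x0 + \<epsilon> * z))) \<longlongrightarrow> w \<psi>) (at_right 0)"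
    using model_product_expansion[OF w \<beta> f(1,2) rep' \<psi>] by simp
  ultimately have "(LINT x|lebesgue. ?a x * f x * \<psi> x) + c * (of_real ((bl + br) / 2) * \<psi> x0) = w \<psi>"
    by (rule tendsto_unique[OF trivial_limit_at_right_real])
  then show ?thesis by (simp only: mult.assoc)
qed

end

section \<open>Locally integrable functions as distributions\<close>

text \<open>Mollified indicator functions of intervals are test functions.\<close>

lemma (in bump) integral_interval_eq_0:
  fixes h :: "real \<Rightarrow> 'a::{real_normed_field, euclidean_space}"
  assumes h: "locally_integrable h" and z: "\<And>\<psi>. test_fun \<psi> \<Longrightarrow> (LINT x|lebesgue. h x * \<psi> x) = 0"
  shows "(LINT x|lebesgue. indicator {a..b} x *\<^sub>R h x) = 0"
proof -
  define i :: "real \<Rightarrow> 'a" where "i x = (if x \<in> {a..b} then 1 else 0)" for x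
  have i: "i \<in> borel_measurable borel" unfolding i_def[abs_def] by measurable
  have i1: "norm (i x) \<le> 1" for x by (simp add: i_def)
  define w where "w x = indicator {a-1..b+1} x *\<^sub>R h x" for x
  have w: "integrable lebesgue w"
    using h unfolding locally_integrable_def set_integrable_def w_def[abs_def] by blast
  have test: "test_fun (reg i \<epsilon>)" if "\<epsilon> > 0" for \<epsilon>
  proof -
    let ?p = "delta_net \<phi> \<epsilon> :: real \<Rightarrow> 'a"
    have p: "test_fun ?p" by (rule test_fun_delta_net[OF test_\<phi> that])
    have "reg i \<epsilon> = (\<lambda>x. integral {a..b} (\<lambda>s. 1 * ?p (1 * x + (-1) * s)))"
    proof
      fix x
      have "reg i \<epsilon> x = (LINT y|lebesgue. i y * ?p (x - y))"
        using convol_regular[OF that, of i x] by (simp add: convol_def regular_dist_def)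
      also have "\<dots> = (LINT y|lebesgue. indicator {a..b} y *\<^sub>R ?p (x - y))"
        by (intro Bochner_Integration.integral_cong refl) (simp add: i_def indicator_def)
      also have "\<dots> = integral {a..b} (\<lambda>s. ?p (x - s))"
      proof -
        have "continuous_on {a..b} (\<lambda>s. ?p (x - s))"
          by (intro smooth_continuous test_fun_smooth test_fun_reflect p)
        from set_lebesgue_integral_eq_integral(2)[OF absolutely_integrable_continuous_real[OF this]]
        show ?thesis by (simp add: set_lebesgue_integral_def)
      qed
      finally show "reg i \<epsilon> x = integral {a..b} (\<lambda>s. 1 * ?p (1 * x + (-1) * s))" by simp
    qed
    moreover have "test_fun (\<lambda>x. integral {a..b} (\<lambda>s. 1 * ?p (1 * x + (-1) * s)))"
      by (rule test_fun_integral[OF _ p]) auto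
    ultimately show ?thesis by simp
  qed
  have zero: "(LINT x|lebesgue. w x * reg i \<epsilon> x) = 0" if \<epsilon>: "\<epsilon> \<in> {0<..<1}" for \<epsilon>
  proof -
    have eq: "w x * reg i \<epsilon> x = h x * reg i \<epsilon> x" for x
    proof (cases "x \<in> {a-1..b+1}")
      case False
      have "i (x - \<epsilon> * t) * \<phi> t = 0" for t
      proof (cases "\<bar>t\<bar> > 1")
        case t: False
        have "\<bar>\<epsilon> * t\<bar> \<le> 1 * 1" unfolding abs_mult using \<epsilon> t by (intro mult_mono) auto
        then have "x - \<epsilon> * t \<notin> {a..b}" using False by auto
        then have "i (x - \<epsilon> * t) = 0" unfolding i_def by (rule if_not_P)
        then show ?thesis by simp
      qed (simp add: \<phi>_0)
      then have "reg i \<epsilon> x = 0" unfolding reg_def by (simp only: Bochner_Integration.integral_zero)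
      then show ?thesis by simp
    qed (simp add: w_def)
    show ?thesis unfolding eq by (rule z[OF test]) (use \<epsilon> in simp)
  qed
  have filt: "at (0::real) within {0<..<1} = at_right 0"
    by (rule at_within_nhd[of _ "{..<1}"]) auto
  define C where "C = (LINT t|lebesgue. norm (\<phi> t :: 'a))"
  have "((\<lambda>\<epsilon>. LINT x|lebesgue. w x * reg i \<epsilon> x) \<longlongrightarrow> (LINT x|lebesgue. w x * i x)) (at 0 within {0<..<1})"
  proof (rule dominated_convergence_within[where w="\<lambda>x. norm (w x) * (1 * C)"])
    show "(\<lambda>x. w x * reg i \<epsilon> x) \<in> borel_measurable lebesgue" for \<epsilon>
      by (intro borel_measurable_times borel_measurable_integrable[OF w] reg_measurable i)
    show "(\<lambda>x. w x * i x) \<in> borel_measurable lebesgue"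
      by (intro borel_measurable_times borel_measurable_integrable[OF w] borel_measurable_lebesgue i)
    show "integrable lebesgue (\<lambda>x. norm (w x) * (1 * C))"
      by (rule integrable_mult_left[OF Bochner_Integration.integrable_norm[OF w]])
    have "{a, b} \<in> null_sets lebesgue" by (intro finite_imp_null_set_lborel[THEN null_sets_completionI]) simp
    then have "AE x in lebesgue. x \<notin> {a, b}" by (rule AE_not_in)
    then show "AE x in lebesgue. ((\<lambda>\<epsilon>. w x * reg i \<epsilon> x) \<longlongrightarrow> w x * i x) (at 0 within {0<..<1})"
    proof eventually_elim
      case (elim x)
      have "isCont i x"
      proof (cases "x \<in> {a<..<b}")
        case True
        then have "eventually (\<lambda>y. i y = 1) (nhds x)"
          by (auto simp: i_def eventually_nhds intro!: exI[of _ "{a<..<b}"])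
        then show ?thesis by (simp add: isCont_cong)
      next
        case False
        then have "x \<in> - {a..b}" using elim by auto
        then have "eventually (\<lambda>y. i y = 0) (nhds x)"
          by (auto simp: i_def eventually_nhds open_Compl intro!: exI[of _ "- {a..b}"])
        then show ?thesis by (simp add: isCont_cong)
      qed
      then show ?case unfolding filt by (intro tendsto_intros reg_tendsto[OF i i1])
    qed
    show "AE x in lebesgue. norm (w x * reg i \<epsilon> x) \<le> norm (w x) * (1 * C)" for \<epsilon>
      unfolding norm_mult C_def by (intro AE_I2 mult_left_mono reg_bound i i1) auto
  qed
  moreover have "((\<lambda>\<epsilon>. LINT x|lebesgue. w x * reg i \<epsilon> x) \<longlongrightarrow> 0) (at 0 within {0<..<1})"
    by (rule Lim_transform_eventually[of "\<lambda>x. 0"]) (use zero in \<open>auto simp: eventually_at_filter\<close>)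
  ultimately have "(LINT x|lebesgue. w x * i x) = 0"
    unfolding filt by (rule tendsto_unique[OF trivial_limit_at_right_real])
  moreover have "(LINT x|lebesgue. w x * i x) = (LINT x|lebesgue. indicator {a..b} x *\<^sub>R h x)"
    by (intro Bochner_Integration.integral_cong refl) (auto simp: w_def i_def indicator_def)
  ultimately show ?thesis by simp
qed

text \<open>Intervals form a generator of the Borel sets that is stable under intersection, so all integrals
  over measurable sets vanish.\<close>

lemma AE_0_of_intervals:
  fixes g :: "real \<Rightarrow> 'a::euclidean_space"
  assumes g: "integrable lebesgue g" and z: "\<And>a b. (LINT x|lebesgue. indicator {a..b} x *\<^sub>R g x) = 0"
    and total: "(LINT x|lebesgue. g x) = 0"
  shows "AE x in lebesgue. g x = 0"
proof (rule sigma_finite_measure.density_zero[OF sigma_finite_lebesgue g])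
  have borel: "set_lebesgue_integral lebesgue A g = 0" if "A \<in> sets borel" for A
  proof -
    let ?G = "range (\<lambda>(a, b). {a..b} :: real set)"
    have sets: "sets borel = sigma_sets UNIV ?G"
      by (subst borel_eq_atLeastAtMost) (simp add: sets_measure_of)
    have mb: "B \<in> sets lebesgue" if "B \<in> sigma_sets UNIV ?G" for B
      using that sets by (metis sets_completionI_sets sets_lborel)
    have si: "set_integrable lebesgue B g" if "B \<in> sigma_sets UNIV ?G" for B
      unfolding set_integrable_def by (rule integrable_mult_indicator[OF mb[OF that] g])
    have "Int_stable ?G"
    proof (rule Int_stableI)
      fix B C assume "B \<in> ?G" "C \<in> ?G"
      then obtain a b c d where "B = {a..b}" "C = {c..d}" by auto
      then have "B \<inter> C = {max a c..min b d}" by (simp add: Int_atLeastAtMost)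
      then show "B \<inter> C \<in> ?G" by (intro range_eqI[of _ _ "(max a c, min b d)"]) simp
    qed
    moreover have "?G \<subseteq> Pow UNIV" by simp
    moreover have "A \<in> sigma_sets UNIV ?G" using that sets by simp
    ultimately show ?thesis
    proof (induction rule: sigma_sets_induct_disjoint)
      case (basic B)
      then show ?case using z by (auto simp: set_lebesgue_integral_def)
    next
      case (compl B)
      have "set_lebesgue_integral lebesgue (UNIV - B) g = (LINT x|lebesgue. g x - indicator B x *\<^sub>R g x)"
        unfolding set_lebesgue_integral_def
        by (intro Bochner_Integration.integral_cong refl) (auto simp: indicator_def)
      also have "\<dots> = (LINT x|lebesgue. g x) - (LINT x|lebesgue. indicator B x *\<^sub>R g x)"
        by (rule Bochner_Integration.integral_diff[OF g si[OF compl(1), unfolded set_integrable_def]])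
      finally show ?case using total compl by (simp add: set_lebesgue_integral_def)
    next
      case (union B)
      then have "\<Union>(range B) \<in> sigma_sets UNIV ?G" by (intro sigma_sets.Union) auto
      then show ?case
        using union by (subst lebesgue_integral_countable_add) (auto intro!: mb si simp: disjoint_family_on_def)
    qed (simp add: set_lebesgue_integral_def)
  qed
  fix A assume "A \<in> sets (lebesgue :: real measure)"
  then obtain S N N' where A: "A = S \<union> N" "N \<subseteq> N'" "N' \<in> null_sets lborel" "S \<in> sets lborel"
    by (rule sets_completionE)
  have S: "S \<in> sets lebesgue" using A(4) by (rule sets_completionI_sets)
  have "N' \<in> null_sets lebesgue" using A(3) by (rule null_sets_completionI)
  then have "AE x in lebesgue. x \<notin> N'" by (rule AE_not_in)
  then have "AE x in lebesgue. indicator A x *\<^sub>R g x = indicator S x *\<^sub>R g x"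
    by eventually_elim (use A in \<open>auto simp: indicator_def\<close>)
  then have "set_lebesgue_integral lebesgue A g = set_lebesgue_integral lebesgue S g"
    unfolding set_lebesgue_integral_def
    by (intro integral_cong_AE borel_measurable_integrable integrable_mult_indicator g \<open>A \<in> sets lebesgue\<close> S)
  then show "set_lebesgue_integral lebesgue A g = 0" using borel A(4) by simp
qed

lemma du_Bois_Reymond:
  fixes h :: "real \<Rightarrow> 'a::{real_normed_field, euclidean_space}"
  assumes h: "locally_integrable h" and z: "\<And>\<psi>. test_fun \<psi> \<Longrightarrow> (LINT x|lebesgue. h x * \<psi> x) = 0"
  shows "AE x in lebesgue. h x = 0"
proof -
  obtain \<rho> :: "real \<Rightarrow> real" where \<rho>: "smooth \<rho>" "\<And>x. \<bar>x\<bar> > 1 \<Longrightarrow> \<rho> x = 0" "integral {-1..1} \<rho> = 1"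
    using real_bump by blast
  interpret bump \<rho> by unfold_locales (use \<rho> in auto)
  have "AE x in lebesgue. indicator {-real n..real n} x *\<^sub>R h x = 0" for n
  proof (rule AE_0_of_intervals)
    show "integrable lebesgue (\<lambda>x. indicator {-real n..real n} x *\<^sub>R h x)"
      using h unfolding locally_integrable_def set_integrable_def by blast
    show "(LINT x|lebesgue. indicator {-real n..real n} x *\<^sub>R h x) = 0"
      by (rule integral_interval_eq_0[OF h z])
    fix a b
    have "(LINT x|lebesgue. indicator {a..b} x *\<^sub>R indicator {-real n..real n} x *\<^sub>R h x) =
      (LINT x|lebesgue. indicator {max a (-real n)..min b (real n)} x *\<^sub>R h x)"
      by (intro Bochner_Integration.integral_cong refl) (auto simp: indicator_def)
    then show "(LINT x|lebesgue. indicator {a..b} x *\<^sub>R indicator {-real n..real n} x *\<^sub>R h x) = 0"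
      using integral_interval_eq_0[OF h z] by simp
  qed
  then have "AE x in lebesgue. \<forall>n. indicator {-real n..real n} x *\<^sub>R h x = 0"
    by (subst AE_all_countable) blast
  then show ?thesis
  proof eventually_elim
    case (elim x)
    obtain n where "\<bar>x\<bar> \<le> real n" using real_arch_simple by blast
    then show ?case using elim[rule_format, of n] by (auto simp: indicator_def split: if_splits)
  qed
qed

lemma distributionI:
  fixes u :: "'a::{real_normed_field, euclidean_space} functional"
  assumes "\<And>\<phi> \<psi>. test_fun \<phi> \<Longrightarrow> test_fun \<psi> \<Longrightarrow> u (\<lambda>x. \<phi> x + \<psi> x) = u \<phi> + u \<psi>"
    and "\<And>c \<phi>. test_fun \<phi> \<Longrightarrow> u (\<lambda>x. c * \<phi> x) = c * u \<phi>"
    and bound: "\<And>K. compact K \<Longrightarrow> \<exists>C m. \<forall>f b. test_fun f \<longrightarrow> (\<forall>x. x \<notin> K \<longrightarrow> f x = 0) \<longrightarrow>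
       (\<forall>k\<le>m. \<forall>x. norm (nth_deriv k f x) \<le> b) \<longrightarrow> norm (u f) \<le> C * b"
  shows "distribution u"
  unfolding distribution_def
proof (intro conjI allI impI)
  fix K :: "real set" assume "compact K"
  from bound[OF this] obtain C m where C: "\<forall>f b. test_fun f \<longrightarrow> (\<forall>x. x \<notin> K \<longrightarrow> f x = 0) \<longrightarrow>
       (\<forall>k\<le>m. \<forall>x. norm (nth_deriv k f x) \<le> b) \<longrightarrow> norm (u f) \<le> C * b"
    by (elim exE)
  show "\<exists>C m. \<forall>\<phi>. test_fun \<phi> \<longrightarrow> supp \<phi> \<subseteq> K \<longrightarrow> norm (u \<phi>) \<le> C * (\<Sum>k\<le>m. SUP x. norm (nth_deriv k \<phi> x))"
  proof (intro exI[of _ C] exI[of _ m] allI impI C[rule_format])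
    fix \<phi> :: "real \<Rightarrow> 'a" and x assume \<phi>: "test_fun \<phi>" "supp \<phi> \<subseteq> K"
    show "\<phi> x = 0" if "x \<notin> K" using that \<phi>(2) supp_0 by blast
    have bdd: "bdd_above (range (\<lambda>x. norm (nth_deriv k \<phi> x)))" for k
    proof -
      obtain M where "\<And>x. norm (nth_deriv k \<phi> x) \<le> M" using test_fun_bounded[OF \<phi>(1)] by metis
      then show ?thesis by (intro bdd_aboveI[of _ M]) auto
    qed
    have nn: "0 \<le> (SUP x. norm (nth_deriv k \<phi> x))" for k
      by (rule cSUP_upper2[OF bdd, of _ 0]) auto
    fix k assume "k \<le> m"
    have "norm (nth_deriv k \<phi> x) \<le> (SUP x. norm (nth_deriv k \<phi> x))"
      by (rule cSUP_upper[OF _ bdd]) simp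
    also have "\<dots> \<le> (\<Sum>k\<le>m. SUP x. norm (nth_deriv k \<phi> x))"
      by (rule member_le_sum) (use \<open>k \<le> m\<close> nn in auto)
    finally show "norm (nth_deriv k \<phi> x) \<le> (\<Sum>k\<le>m. SUP x. norm (nth_deriv k \<phi> x))" .
  qed
qed (use assms in auto)

lemma distribution_diff_regular:
  fixes u :: "'a::{real_normed_field, euclidean_space} functional"
  assumes u: "distribution u" and f: "integrable lebesgue f"
  shows "distribution (\<lambda>\<psi>. u \<psi> - (LINT x|lebesgue. f x * \<psi> x))"
proof (rule distributionI)
  have int: "integrable lebesgue (\<lambda>x. f x * \<psi> x)" if t: "test_fun \<psi>" for \<psi>
  proof -
    obtain M where M: "\<And>x. norm (\<psi> x) \<le> M" using test_fun_bounded[OF t, of 0] by (metis nth_deriv_0)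
    have "integrable lebesgue (\<lambda>x. \<psi> x * f x)"
      by (rule bounded_times_test_integrable[OF _ M f])
         (intro continuous_measurable_lebesgue smooth_continuous test_fun_smooth t)
    then show ?thesis by (simp add: mult.commute)
  qed
  fix \<phi> \<psi> :: "real \<Rightarrow> 'a" and c :: 'a assume \<phi>: "test_fun \<phi>"
  show "u (\<lambda>x. c * \<phi> x) - (LINT x|lebesgue. f x * (c * \<phi> x)) = c * (u \<phi> - (LINT x|lebesgue. f x * \<phi> x))"
  proof -
    have "(LINT x|lebesgue. f x * (c * \<phi> x)) = (LINT x|lebesgue. c * (f x * \<phi> x))" by (simp add: ac_simps)
    then show ?thesis
      using distribution_mult[OF u \<phi>, of c] by (simp add: right_diff_distrib)
  qed
  assume \<psi>: "test_fun \<psi>"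
  have "(LINT x|lebesgue. f x * (\<phi> x + \<psi> x)) = (LINT x|lebesgue. f x * \<phi> x) + (LINT x|lebesgue. f x * \<psi> x)"
    unfolding distrib_left by (rule Bochner_Integration.integral_add[OF int[OF \<phi>] int[OF \<psi>]])
  then show "u (\<lambda>x. \<phi> x + \<psi> x) - (LINT x|lebesgue. f x * (\<phi> x + \<psi> x)) =
      u \<phi> - (LINT x|lebesgue. f x * \<phi> x) + (u \<psi> - (LINT x|lebesgue. f x * \<psi> x))"
    using distribution_add[OF u \<phi> \<psi>] by simp
next
  fix K :: "real set" assume "compact K"
  obtain C m where C: "\<And>f b. test_fun f \<Longrightarrow> (\<And>x. x \<notin> K \<Longrightarrow> f x = 0) \<Longrightarrow>
       (\<And>k x. k \<le> m \<Longrightarrow> norm (nth_deriv k f x) \<le> b) \<Longrightarrow> norm (u f) \<le> C * b"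
    using distribution_bound[OF u \<open>compact K\<close>] by metis
  show "\<exists>C m. \<forall>\<psi> b. test_fun \<psi> \<longrightarrow> (\<forall>x. x \<notin> K \<longrightarrow> \<psi> x = 0) \<longrightarrow>
       (\<forall>k\<le>m. \<forall>x. norm (nth_deriv k \<psi> x) \<le> b) \<longrightarrow> norm (u \<psi> - (LINT x|lebesgue. f x * \<psi> x)) \<le> C * b"
  proof (intro exI[of _ "C + (LINT x|lebesgue. norm (f x))"] exI[of _ m] allI impI)
    fix \<psi> :: "real \<Rightarrow> 'a" and b :: real
    assume \<psi>: "test_fun \<psi>" "\<forall>x. x \<notin> K \<longrightarrow> \<psi> x = 0" "\<forall>k\<le>m. \<forall>x. norm (nth_deriv k \<psi> x) \<le> b"
    have b: "norm (\<psi> x) \<le> b" for x using \<psi>(3)[rule_format, of 0 x] by simp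
    have 1: "norm (u \<psi>) \<le> C * b" by (rule C) (use \<psi> in auto)
    have "norm (LINT x|lebesgue. f x * \<psi> x) \<le> (LINT x|lebesgue. norm (f x * \<psi> x))"
      by (rule integral_norm_bound)
    also have "\<dots> \<le> (LINT x|lebesgue. norm (f x) * b)"
    proof (rule integral_mono')
      show "integrable lebesgue (\<lambda>x. norm (f x) * b)"
        by (rule integrable_mult_left[OF Bochner_Integration.integrable_norm[OF f]])
      show "norm (f x * \<psi> x) \<le> norm (f x) * b" for x
        unfolding norm_mult by (intro mult_left_mono b) simp
      show "0 \<le> norm (f x) * b" for x using order_trans[OF norm_ge_zero b[of 0]] by simp
    qed
    also have "\<dots> = (LINT x|lebesgue. norm (f x)) * b" by (rule integral_mult_left_zero)
    finally show "norm (u \<psi> - (LINT x|lebesgue. f x * \<psi> x)) \<le> (C + (LINT x|lebesgue. norm (f x))) * b"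
      using 1 norm_triangle_ineq4[of "u \<psi>" "LINT x|lebesgue. f x * \<psi> x"] by (simp add: distrib_right)
  qed
qed

lemma test_fun_split:
  fixes \<psi> :: "real \<Rightarrow> 'a::real_normed_vector"
  assumes \<psi>: "test_fun \<psi>" and x0: "x0 \<notin> supp \<psi>"
  shows "test_fun (\<lambda>x. if x < x0 then \<psi> x else 0)" "supp (\<lambda>x. if x < x0 then \<psi> x else 0) \<subseteq> {..<x0}"
    "test_fun (\<lambda>x. if x < x0 then 0 else \<psi> x)" "supp (\<lambda>x. if x < x0 then 0 else \<psi> x) \<subseteq> {x0<..}"
proof -
  define D where "D n x = (if x < x0 then nth_deriv n \<psi> x else 0)" for n x
  have "(D n has_vector_derivative D (Suc n) x) (at x)" for n x
  proof -
    consider "x < x0" | "x > x0" | "x = x0" by linarith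
    then show ?thesis
    proof cases
      case 1
      have "(D n has_vector_derivative nth_deriv (Suc n) \<psi> x) (at x)"
        by (rule has_vector_derivative_transform_within_open[OF smooth_nth_deriv[OF test_fun_smooth[OF \<psi>]], of "{..<x0}"])
           (use 1 in \<open>auto simp: D_def\<close>)
      then show ?thesis using 1 by (simp add: D_def)
    next
      case 2
      have "(D n has_vector_derivative 0) (at x)"
        by (rule has_vector_derivative_transform_within_open[OF has_vector_derivative_const, of "{x0<..}"])
           (use 2 in \<open>auto simp: D_def\<close>)
      then show ?thesis using 2 by (simp add: D_def)
    next
      case 3
      have "(D n has_vector_derivative 0) (at x)"
      proof (rule has_vector_derivative_transform_within_open[OF has_vector_derivative_const, of "- supp \<psi>"])
        fix y assume "y \<in> - supp \<psi>"
        then have "y \<notin> supp (nth_deriv n \<psi>)" using supp_nth_deriv by blast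
        then show "0 = D n y" by (simp add: D_def supp_0)
      qed (use 3 x0 in \<open>auto simp: closed_supp open_Compl\<close>)
      then show ?thesis using 3 by (simp add: D_def)
    qed
  qed
  from smoothI[of D, OF this] have sm: "smooth (\<lambda>x. if x < x0 then \<psi> x else 0)" by (simp add: D_def[abs_def] cong: if_cong)
  obtain R where "R > 0" and R: "\<And>x n. \<bar>x\<bar> > R \<Longrightarrow> nth_deriv n \<psi> x = 0" using test_fun_radius[OF \<psi>] by metis
  show t: "test_fun (\<lambda>x. if x < x0 then \<psi> x else 0)"
    by (rule test_funI[OF sm, of R]) (use R[of _ 0] in auto)
  have "(\<lambda>x. if x < x0 then 0 else \<psi> x) = (\<lambda>x. \<psi> x - (if x < x0 then \<psi> x else 0))" by auto
  then show "test_fun (\<lambda>x. if x < x0 then 0 else \<psi> x)" using test_fun_diff[OF \<psi> t] by simp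
  have "supp (\<lambda>x. if x < x0 then \<psi> x else 0) \<subseteq> supp \<psi> \<inter> {..x0}"
    by (rule supp_subsetI) (auto simp: closed_supp supp_0)
  then show "supp (\<lambda>x. if x < x0 then \<psi> x else 0) \<subseteq> {..<x0}" using x0 by (force simp: less_le)
  have "supp (\<lambda>x. if x < x0 then 0 else \<psi> x) \<subseteq> supp \<psi> \<inter> {x0..}"
    by (rule supp_subsetI) (auto simp: closed_supp supp_0)
  then show "supp (\<lambda>x. if x < x0 then 0 else \<psi> x) \<subseteq> {x0<..}" using x0 by (force simp: less_le)
qed

section \<open>Structure of solutions\<close>

lemma step_at_coeff_a: "step_at x0 A B (\<lambda>x. A * heaviside (x0 - x) + B * heaviside (x - x0))"
  by (simp add: step_at_def heaviside_def)

lemma step_at_coeff_P: "step_at x0 P1 P2 (\<lambda>x. P1 + heaviside (x - x0) * (P2 - P1))"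
  by (simp add: step_at_def heaviside_def)

text \<open>Every solution is the distribution of a function that is continuously differentiable off \<open>x0\<close>, has
  one-sided limits at \<open>x0\<close> together with its derivative, and satisfies the transmission conditions.\<close>

lemma solution_structure:
  fixes A B x0 P1 P2 :: real
    and g :: "real \<Rightarrow> 'a::{real_normed_field, euclidean_space}"
  assumes A: "A > 0" and B: "B > 0" and AB: "A \<noteq> B" and x0: "0 < x0" "x0 < 1"
    and g: "g absolutely_integrable_on {0..1}"
    and sol: "is_solution A B x0 P1 P2 g u"
  obtains v v' :: "real \<Rightarrow> 'a" and l r l' r' :: 'a where
    "integrable lebesgue v" "dist_eq u (regular_dist v)"
    "\<And>x. x \<noteq> x0 \<Longrightarrow> (v has_vector_derivative v' x) (at x)"
    "continuous_on (- {x0}) v'"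
    "(v \<longlongrightarrow> l) (at_left x0)" "(v \<longlongrightarrow> r) (at_right x0)"
    "(v' \<longlongrightarrow> l') (at_left x0)" "(v' \<longlongrightarrow> r') (at_right x0)"
    "A *\<^sub>R l = B *\<^sub>R r" "A *\<^sub>R l' = B *\<^sub>R r'"
proof -
  define \<alpha> where "\<alpha> x = A * heaviside (x0 - x) + B * heaviside (x - x0)" for x
  define \<pi> where "\<pi> x = P1 + heaviside (x - x0) * (P2 - P1)" for x
  have \<alpha>: "step_at x0 A B \<alpha>" and \<pi>: "step_at x0 P1 P2 \<pi>"
    using step_at_coeff_a step_at_coeff_P by (simp_all add: \<alpha>_def[abs_def] \<pi>_def[abs_def])
  have u: "distribution u" and u_supp: "dist_supp u \<subseteq> {0..1}"
    using sol by (auto simp: is_solution_def dot_dist01_def)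
  obtain w q where w: "has_model_product (regular_dist (\<lambda>x. of_real (\<alpha> x))) u w"
    and q: "has_model_product (regular_dist (\<lambda>x. of_real (\<pi> x))) u q"
    and eq0: "dist_eq (\<lambda>\<psi>. dist_deriv (dist_deriv w) \<psi> + q \<psi>) (regular_dist (extend01 g))"
    using sol unfolding is_solution_def coeff_a_def[abs_def] coeff_P_def[abs_def] \<alpha>_def[abs_def] \<pi>_def[abs_def]
    by blast
  define G where "G = extend01 g"
  have G0: "G x = 0" if "x \<notin> {0..1}" for x unfolding G_def extend01_def using that by (rule if_not_P)
  have G: "integrable lebesgue G"
  proof -
    have "(\<lambda>x. indicator {0..1} x *\<^sub>R g x) = G"
      by (auto simp: G_def extend01_def fun_eq_iff indicator_def)
    then show ?thesis using g by (simp add: set_integrable_def)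
  qed
  have eq: "w (nth_deriv 2 \<psi>) + q \<psi> = (LINT x|lebesgue. G x * \<psi> x)" if "test_fun \<psi>" for \<psi>
    using eq0 that unfolding dist_eq_def dist_deriv_def regular_dist_def G_def
    by (simp add: nth_deriv_nth_deriv numeral_2_eq_2)
  have u0: "u \<psi> = 0" if "test_fun \<psi>" "supp \<psi> \<inter> {0..1} = {}" for \<psi>
    by (rule distribution_vanishes_off_support[OF u that(1)]) (use that(2) u_supp in blast)
  obtain \<rho> :: "real \<Rightarrow> real" where \<rho>: "smooth \<rho>" "\<And>x. \<bar>x\<bar> > 1 \<Longrightarrow> \<rho> x = 0" "integral {-1..1} \<rho> = 1"
    using real_bump by blast
  interpret bump \<rho> by unfold_locales (use \<rho> in auto)

  obtain E E1 where E: "\<And>t. (E has_real_derivative E1 t) (at t)" "\<And>t. (E1 has_real_derivative - (P1 / A) * E t) (at t)"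
    "E 0 = 0" "E1 0 = 1" using fundamental_solution[of "P1 / A"] by metis
  obtain F F1 where F: "\<And>t. (F has_real_derivative F1 t) (at t)" "\<And>t. (F1 has_real_derivative - (P2 / B) * F t) (at t)"
    "F 0 = 0" "F1 0 = 1" using fundamental_solution[of "P2 / B"] by metis
  have cE: "continuous_on UNIV E" and cE1: "continuous_on UNIV E1" and cF: "continuous_on UNIV F" and cF1: "continuous_on UNIV F1"
    using E(1,2) F(1,2) by (meson DERIV_isCont continuous_at_imp_continuous_on)+
  define KL where "KL = causal_conv E 1 G"
  define KL1 where "KL1 = causal_conv E1 1 G"
  define KR where "KR = causal_conv F (-1) G"
  define KR1 where "KR1 = causal_conv F1 (-1) G"
  have cK: "continuous_on S KL" "continuous_on S KL1" "continuous_on S KR" "continuous_on S KR1" for S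
    unfolding KL_def KL1_def KR_def KR1_def
    by (intro continuous_causal_conv cE cE1 cF cF1 G G0; simp)+
  have dKL: "(KL has_vector_derivative KL1 y) (at y)" for y
    using has_vector_derivative_causal_conv[OF E(1,3) cE1 G G0, of 1 y] by (simp add: KL_def KL1_def)
  have dKR: "(KR has_vector_derivative - KR1 y) (at y)" for y
    using has_vector_derivative_causal_conv[OF F(1,3) cF1 G G0, of "-1" y] by (simp add: KR_def KR1_def)
  define fL where "fL y = (1 / A) *\<^sub>R KL y" for y
  define fR where "fR y = (1 / B) *\<^sub>R KR y" for y
  define fL' where "fL' y = (1 / A) *\<^sub>R KL1 y" for y
  define fR' where "fR' y = - (1 / B) *\<^sub>R KR1 y" for y
  have cf: "continuous_on S fL" "continuous_on S fR" "continuous_on S fL'" "continuous_on S fR'" for S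
    unfolding fL_def fR_def fL'_def fR'_def by (intro continuous_intros cK)+
  have dfL: "(fL has_vector_derivative fL' y) (at y)" for y
    unfolding fL_def fL'_def by (intro bounded_linear.has_vector_derivative[OF bounded_linear_scaleR_right] dKL)
  have dfR: "(fR has_vector_derivative fR' y) (at y)" for y
    using bounded_linear.has_vector_derivative[OF bounded_linear_scaleR_right dKR, of "1 / B" y]
    by (simp add: fR_def[abs_def] fR'_def)
  \<comment> \<open>The left solution propagates from \<open>0\<close>, the right one from \<open>1\<close>.\<close>
  define v where "v y = (if y < x0 then fL y else fR y)" for y
  define v' where "v' y = (if y < x0 then fL' y else fR' y)" for y

  have v_off: "v y = 0" if "y \<notin> {0..1}" for y
  proof (cases "y < 0")
    case True
    have "causal E (1 * (y - x)) *\<^sub>R G x = 0" for x using True G0[of x] by (cases "x < 0") (auto simp: causal_def)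
    then have "KL y = 0" unfolding KL_def causal_conv_def by (simp only: Bochner_Integration.integral_zero)
    then show ?thesis using True x0 by (simp add: v_def fL_def)
  next
    case False
    then have y: "y > 1" using that by auto
    have "causal F (-1 * (y - x)) *\<^sub>R G x = 0" for x using y G0[of x] by (cases "x > 1") (auto simp: causal_def)
    then have "KR y = 0" unfolding KR_def causal_conv_def by (simp only: Bochner_Integration.integral_zero)
    then show ?thesis using y x0 by (simp add: v_def fR_def)
  qed
  obtain M where M: "M > 0" "\<And>y. norm (v y) \<le> M"
  proof -
    have "bounded (fL ` {0..1})" "bounded (fR ` {0..1})"
      by (intro compact_imp_bounded compact_continuous_image cf compact_Icc)+
    then obtain M1 M2 where "M1 > 0" "\<And>y. y \<in> {0..1} \<Longrightarrow> norm (fL y) \<le> M1" "M2 > 0" "\<And>y. y \<in> {0..1} \<Longrightarrow> norm (fR y) \<le> M2"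
      unfolding bounded_pos by (metis image_eqI)
    then have "norm (v y) \<le> M1 + M2" for y
      using v_off[of y] by (cases "y \<in> {0..1}") (auto simp: v_def intro: add_increasing add_increasing2)
    then show ?thesis using that[of "M1 + M2"] \<open>M1 > 0\<close> \<open>M2 > 0\<close> by simp
  qed
  have mv: "v \<in> borel_measurable borel"
    unfolding v_def[abs_def] by (intro measurable_If borel_measurable_continuous_onI cf) auto
  have iv: "integrable lebesgue v"
  proof (rule Bochner_Integration.integrable_bound[of _ "\<lambda>x. indicator {0..1} x *\<^sub>R M"])
    show "integrable lebesgue (\<lambda>x. indicator {0..1::real} x *\<^sub>R M)"
      using absolutely_integrable_continuous_real[of 0 1 "\<lambda>_. M"] by (simp add: set_integrable_def)
    show "AE x in lebesgue. norm (v x) \<le> norm (indicator {0..1} x *\<^sub>R M)"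
      using M v_off by (intro AE_I2) (auto simp: indicator_def)
  qed (rule borel_measurable_lebesgue[OF mv])
  have ev: "eventually (\<lambda>y. v y = fL y \<and> v' y = fL' y) (nhds x)" if "x < x0" for x
    using that by (auto simp: v_def v'_def eventually_nhds intro!: exI[of _ "{..<x0}"])
  have ev2: "eventually (\<lambda>y. v y = fR y \<and> v' y = fR' y) (nhds x)" if "x > x0" for x
    using that by (auto simp: v_def v'_def eventually_nhds intro!: exI[of _ "{x0<..}"])
  have c: "isCont fL x" "isCont fR x" "isCont fL' x" "isCont fR' x" for x
    using cf[of UNIV] by (simp_all add: continuous_on_eq_continuous_at)
  have contv: "isCont v x \<and> isCont v' x" if "x \<noteq> x0" for x
  proof (cases "x < x0")
    case True
    then show ?thesis
      using c eventually_mono[OF ev[OF True], of "\<lambda>y. v y = fL y"] eventually_mono[OF ev[OF True], of "\<lambda>y. v' y = fL' y"]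
      by (auto simp: isCont_cong)
  next
    case False
    then have "x > x0" using that by simp
    then show ?thesis
      using c eventually_mono[OF ev2, of x "\<lambda>y. v y = fR y"] eventually_mono[OF ev2, of x "\<lambda>y. v' y = fR' y"]
      by (auto simp: isCont_cong)
  qed
  have dv: "(v has_vector_derivative v' x) (at x)" if "x \<noteq> x0" for x
  proof (cases "x < x0")
    case True
    have "(v has_vector_derivative fL' x) (at x)"
      by (rule has_vector_derivative_transform_within_open[OF dfL, of "{..<x0}"]) (use True in \<open>auto simp: v_def\<close>)
    then show ?thesis using True by (simp add: v'_def)
  next
    case False
    have "(v has_vector_derivative fR' x) (at x)"
      by (rule has_vector_derivative_transform_within_open[OF dfR, of "{x0<..}"]) (use False that in \<open>auto simp: v_def\<close>)
    then show ?thesis using False by (simp add: v'_def)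
  qed

  have left: "u \<psi> = (LINT y|lebesgue. v y * \<psi> y)" if \<psi>: "test_fun \<psi>" "supp \<psi> \<subseteq> {..<x0}" for \<psi>
  proof -
    have "u \<psi> = (LINT y|lebesgue. ((1 / A) *\<^sub>R causal_conv E 1 G y) * \<psi> y)"
    proof (rule one_sided_solution[OF u u0 _ _ _ G G0 E \<psi>(1), of 1 x0])
      fix \<theta> :: "real \<Rightarrow> 'a" assume \<theta>: "test_fun \<theta>" "supp \<theta> \<subseteq> {y. 1 * (y - x0) < 0}"
      have "w (nth_deriv 2 \<theta>) = of_real A * u (nth_deriv 2 \<theta>)"
        by (rule model_product_local[OF w u test_fun_nth_deriv[OF \<theta>(1)], of 2 "{..<x0}"])
           (use \<theta>(2) supp_nth_deriv[of 2 \<theta>] \<alpha> in \<open>auto simp: step_at_def\<close>)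
      moreover have "q \<theta> = of_real P1 * u \<theta>"
        by (rule model_product_local[OF q u \<theta>(1), of "{..<x0}"]) (use \<theta>(2) \<pi> in \<open>auto simp: step_at_def\<close>)
      ultimately show "of_real A * u (nth_deriv 2 \<theta>) + of_real P1 * u \<theta> = (LINT x|lebesgue. G x * \<theta> x)"
        using eq[OF \<theta>(1)] by simp
    qed (use A \<psi>(2) in auto)
    also have "\<dots> = (LINT y|lebesgue. v y * \<psi> y)"
    proof (intro Bochner_Integration.integral_cong refl)
      fix y
      have "\<psi> y = 0" if "\<not> y < x0"
        using \<psi>(2) that by (intro supp_0) auto
      then show "((1 / A) *\<^sub>R causal_conv E 1 G y) * \<psi> y = v y * \<psi> y"
        by (cases "y < x0") (auto simp: v_def fL_def KL_def)
    qed
    finally show ?thesis .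
  qed
  have right: "u \<psi> = (LINT y|lebesgue. v y * \<psi> y)" if \<psi>: "test_fun \<psi>" "supp \<psi> \<subseteq> {x0<..}" for \<psi>
  proof -
    have "u \<psi> = (LINT y|lebesgue. ((1 / B) *\<^sub>R causal_conv F (-1) G y) * \<psi> y)"
    proof (rule one_sided_solution[OF u u0 _ _ _ G G0 F \<psi>(1), of "-1" x0])
      fix \<theta> :: "real \<Rightarrow> 'a" assume \<theta>: "test_fun \<theta>" "supp \<theta> \<subseteq> {y. -1 * (y - x0) < 0}"
      have "w (nth_deriv 2 \<theta>) = of_real B * u (nth_deriv 2 \<theta>)"
        by (rule model_product_local[OF w u test_fun_nth_deriv[OF \<theta>(1)], of 2 "{x0<..}"])
           (use \<theta>(2) supp_nth_deriv[of 2 \<theta>] \<alpha> in \<open>auto simp: step_at_def\<close>)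
      moreover have "q \<theta> = of_real P2 * u \<theta>"
        by (rule model_product_local[OF q u \<theta>(1), of "{x0<..}"]) (use \<theta>(2) \<pi> in \<open>auto simp: step_at_def\<close>)
      ultimately show "of_real B * u (nth_deriv 2 \<theta>) + of_real P2 * u \<theta> = (LINT x|lebesgue. G x * \<theta> x)"
        using eq[OF \<theta>(1)] by simp
    qed (use B \<psi>(2) in auto)
    also have "\<dots> = (LINT y|lebesgue. v y * \<psi> y)"
    proof (intro Bochner_Integration.integral_cong refl)
      fix y
      have "\<psi> y = 0" if "\<not> y > x0"
        using \<psi>(2) that by (intro supp_0) auto
      then show "((1 / B) *\<^sub>R causal_conv F (-1) G y) * \<psi> y = v y * \<psi> y"
        by (cases "y > x0") (auto simp: v_def fR_def KR_def)
    qed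
    finally show ?thesis .
  qed

  define us where "us \<psi> = u \<psi> - (LINT x|lebesgue. v x * \<psi> x)" for \<psi>
  have us: "distribution us"
    unfolding us_def[abs_def] by (rule distribution_diff_regular[OF u iv])
  have us_null: "us \<psi> = 0" if \<psi>: "test_fun \<psi>" "x0 \<notin> supp \<psi>" for \<psi>
  proof -
    let ?l = "\<lambda>x. if x < x0 then \<psi> x else 0" and ?r = "\<lambda>x. if x < x0 then 0 else \<psi> x"
    note split = test_fun_split[OF \<psi>]
    have "\<psi> = (\<lambda>x. ?l x + ?r x)" by auto
    then have "us \<psi> = us ?l + us ?r" using distribution_add[OF us split(1,3)] by simp
    moreover have "us ?l = 0" unfolding us_def using left[OF split(1,2)] by simp
    moreover have "us ?r = 0" unfolding us_def using right[OF split(3,4)] by simp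
    ultimately show ?thesis by simp
  qed
  obtain N c where c: "\<And>\<psi>. test_fun \<psi> \<Longrightarrow> us \<psi> = (\<Sum>k\<le>N. c k * nth_deriv k \<psi> x0)"
    using point_supported_distribution[OF us us_null] by metis
  have rep: "u \<psi> = (LINT x|lebesgue. v x * \<psi> x) + (\<Sum>k\<le>N. c k * nth_deriv k \<psi> x0)" if "test_fun \<psi>" for \<psi>
    using c[OF that] by (simp add: us_def algebra_simps)
  have cv: "isCont v x" if "x \<noteq> x0" for x using contv[OF that] by simp
  have rep0: "u \<psi> = (LINT x|lebesgue. v x * \<psi> x) + c 0 * \<psi> x0" if "test_fun \<psi>" for \<psi>
    by (rule only_delta[OF w \<alpha> AB mv M(2) cv rep that])

  \<comment> \<open>The difference of the two sides of the equation, a combination of \<open>\<delta>''\<close>, \<open>\<delta>'\<close> and \<open>\<delta>\<close> at \<open>x0\<close>,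
    tested with \<open>\<psi>\<close>.\<close>
  have jump: "c 0 * of_real ((A + B) / 2) * nth_deriv 2 \<psi> x0 + (KL x0 - KR x0) * nth_deriv 1 \<psi> x0
      + (c 0 * of_real ((P1 + P2) / 2) - KL1 x0 - KR1 x0) * \<psi> x0 = 0" if \<psi>: "test_fun \<psi>" for \<psi>
  proof -
    let ?L = "{y. 1 * (y - x0) < 0}" and ?R = "{y. - 1 * (y - x0) < 0}"
    have mL: "?L \<in> sets lebesgue" and mR: "?R \<in> sets lebesgue"
      by (intro sets_completionI_sets; simp)+
    let ?a = "\<lambda>x. of_real (\<alpha> x) * v x * nth_deriv 2 \<psi> x" and ?p = "\<lambda>x. of_real (\<pi> x) * v x * \<psi> x"
    let ?tL = "\<lambda>y. KL y * (indicator ?L y *\<^sub>R (nth_deriv 2 \<psi> y + (P1 / A) *\<^sub>R \<psi> y))"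
    let ?tR = "\<lambda>y. KR y * (indicator ?R y *\<^sub>R (nth_deriv 2 \<psi> y + (P2 / B) *\<^sub>R \<psi> y))"
    have bint: "integrable lebesgue (\<lambda>x. of_real (\<beta> x) * v x * \<theta> x)"
      if "step_at x0 bl br \<beta>" "test_fun \<theta>" for \<beta> bl br \<theta>
    proof (rule bounded_times_test_integrable[where M="(\<bar>bl\<bar> + \<bar>br\<bar> + \<bar>\<beta> x0\<bar>) * M"])
      show "(\<lambda>x. of_real (\<beta> x) * v x) \<in> borel_measurable lebesgue"
        using step_at_measurable[OF that(1)] mv
        by (intro borel_measurable_times borel_measurable_lebesgue) simp_all
      show "norm (of_real (\<beta> x) * v x) \<le> (\<bar>bl\<bar> + \<bar>br\<bar> + \<bar>\<beta> x0\<bar>) * M" for x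
        unfolding norm_mult norm_of_real by (intro mult_mono step_at_bounded[OF that(1)] M) auto
    qed (rule test_fun_integrable[OF that(2)])
    have \<psi>2: "test_fun (nth_deriv 2 \<psi>)" by (rule test_fun_nth_deriv[OF \<psi>])
    have tint: "integrable lebesgue (\<lambda>y. K y * (indicator S y *\<^sub>R (nth_deriv 2 \<psi> y + c *\<^sub>R \<psi> y)))"
      if "S \<in> sets lebesgue" "continuous_on UNIV K" for S K c
    proof -
      obtain R where "R > 0" and R: "\<And>x n. \<bar>x\<bar> > R \<Longrightarrow> nth_deriv n \<psi> x = 0" using test_fun_radius[OF \<psi>] by metis
      have c\<psi>: "continuous_on A (nth_deriv 2 \<psi>)" "continuous_on A \<psi>" for A
        by (intro continuous_nth_deriv smooth_continuous test_fun_smooth \<psi>)+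
      have "integrable lebesgue (\<lambda>y. K y * (nth_deriv 2 \<psi> y + c *\<^sub>R \<psi> y))"
        by (rule lint_Icc(1)[of "-R" R])
           (use R[of _ 2] R[of _ 0] in \<open>auto intro!: continuous_intros continuous_on_subset[OF that(2)] c\<psi>\<close>)
      from integrable_mult_indicator[OF that(1) this] show ?thesis by simp
    qed
    have gint: "integrable lebesgue (\<lambda>x. G x * (indicator S x *\<^sub>R \<psi> x))" if "S \<in> sets lebesgue" for S
    proof -
      obtain M where M: "\<And>x. norm (\<psi> x) \<le> M" using test_fun_bounded[OF \<psi>, of 0] by (metis nth_deriv_0)
      have "integrable lebesgue (\<lambda>x. \<psi> x * G x)"
        by (rule bounded_times_test_integrable[OF _ M G])
           (intro continuous_measurable_lebesgue smooth_continuous test_fun_smooth \<psi>)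
      from integrable_mult_indicator[OF that this] show ?thesis by (simp add: mult.commute)
    qed
    have "{x0} \<in> null_sets lebesgue" by simp
    then have ae: "AE x in lebesgue. x \<notin> {x0}" by (rule AE_not_in)
    have wq: "w (nth_deriv 2 \<psi>) + q \<psi> = (LINT x|lebesgue. ?a x) + (LINT x|lebesgue. ?p x)
        + c 0 * of_real ((A + B) / 2) * nth_deriv 2 \<psi> x0 + c 0 * of_real ((P1 + P2) / 2) * \<psi> x0"
      using model_product_delta[OF w \<alpha> mv M(2) cv rep0 \<psi>2] model_product_delta[OF q \<pi> mv M(2) cv rep0 \<psi>] by simp
    have "(LINT x|lebesgue. ?a x) + (LINT x|lebesgue. ?p x) = (LINT x|lebesgue. ?a x + ?p x)"
      by (rule Bochner_Integration.integral_add[symmetric, OF bint[OF \<alpha> \<psi>2] bint[OF \<pi> \<psi>]])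
    also have "\<dots> = (LINT x|lebesgue. ?tL x + ?tR x)"
    proof (rule integral_cong_AE)
      show "(\<lambda>x. ?a x + ?p x) \<in> borel_measurable lebesgue"
        by (intro borel_measurable_integrable Bochner_Integration.integrable_add bint[OF \<alpha> \<psi>2] bint[OF \<pi> \<psi>])
      show "(\<lambda>x. ?tL x + ?tR x) \<in> borel_measurable lebesgue"
        by (intro borel_measurable_integrable Bochner_Integration.integrable_add tint mL mR cK)
      show "AE x in lebesgue. ?a x + ?p x = ?tL x + ?tR x"
        using ae
      proof eventually_elim
        case (elim x)
        then consider "x < x0" | "x > x0" by force
        then show ?case
        proof cases
          case 1
          then have "\<alpha> x = A" "\<pi> x = P1" using \<alpha> \<pi> by (auto simp: step_at_def)
          then show ?thesis using 1 A by (simp add: v_def fL_def scaleR_conv_of_real field_simps)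
        next
          case 2
          then have "\<alpha> x = B" "\<pi> x = P2" using \<alpha> \<pi> by (auto simp: step_at_def)
          then show ?thesis using 2 B by (simp add: v_def fR_def scaleR_conv_of_real field_simps)
        qed
      qed
    qed
    also have "\<dots> = (LINT x|lebesgue. ?tL x) + (LINT x|lebesgue. ?tR x)"
      by (intro Bochner_Integration.integral_add tint mL mR cK)
    also have "(LINT x|lebesgue. ?tL x) = (LINT x|lebesgue. G x * (indicator ?L x *\<^sub>R \<psi> x))
        + KL x0 * (1 *\<^sub>R nth_deriv 1 \<psi> x0) - KL1 x0 * \<psi> x0"
      unfolding KL_def KL1_def by (rule one_sided_green_identity[OF _ G G0 E \<psi>]) auto
    also have "(LINT x|lebesgue. ?tR x) = (LINT x|lebesgue. G x * (indicator ?R x *\<^sub>R \<psi> x))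
        + KR x0 * ((-1) *\<^sub>R nth_deriv 1 \<psi> x0) - KR1 x0 * \<psi> x0"
      unfolding KR_def KR1_def by (rule one_sided_green_identity[OF _ G G0 F \<psi>]) auto
    finally have lhs: "(LINT x|lebesgue. ?a x) + (LINT x|lebesgue. ?p x) = 
       (LINT x|lebesgue. G x * (indicator ?L x *\<^sub>R \<psi> x)) + (LINT x|lebesgue. G x * (indicator ?R x *\<^sub>R \<psi> x))
       + (KL x0 - KR x0) * nth_deriv 1 \<psi> x0 - (KL1 x0 + KR1 x0) * \<psi> x0"
      by (simp add: algebra_simps)
    have "(LINT x|lebesgue. G x * (indicator ?L x *\<^sub>R \<psi> x)) + (LINT x|lebesgue. G x * (indicator ?R x *\<^sub>R \<psi> x)) =
      (LINT x|lebesgue. G x * (indicator ?L x *\<^sub>R \<psi> x) + G x * (indicator ?R x *\<^sub>R \<psi> x))"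
      by (rule Bochner_Integration.integral_add[symmetric, OF gint[OF mL] gint[OF mR]])
    also have "\<dots> = (LINT x|lebesgue. G x * \<psi> x)"
    proof (rule integral_cong_AE)
      show "(\<lambda>x. G x * (indicator ?L x *\<^sub>R \<psi> x) + G x * (indicator ?R x *\<^sub>R \<psi> x)) \<in> borel_measurable lebesgue"
        by (intro borel_measurable_integrable Bochner_Integration.integrable_add gint mL mR)
      show "(\<lambda>x. G x * \<psi> x) \<in> borel_measurable lebesgue"
        using gint[of UNIV] by (intro borel_measurable_integrable) simp
      show "AE x in lebesgue. G x * (indicator ?L x *\<^sub>R \<psi> x) + G x * (indicator ?R x *\<^sub>R \<psi> x) = G x * \<psi> x"
        using ae by eventually_elim (auto simp: indicator_def)
    qed
    finally have rhs: "(LINT x|lebesgue. G x * (indicator ?L x *\<^sub>R \<psi> x)) + (LINT x|lebesgue. G x * (indicator ?R x *\<^sub>R \<psi> x)) =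
      (LINT x|lebesgue. G x * \<psi> x)" .
    have "(LINT x|lebesgue. G x * \<psi> x) =
       (LINT x|lebesgue. G x * \<psi> x) + (KL x0 - KR x0) * nth_deriv 1 \<psi> x0 - (KL1 x0 + KR1 x0) * \<psi> x0
        + c 0 * of_real ((A + B) / 2) * nth_deriv 2 \<psi> x0 + c 0 * of_real ((P1 + P2) / 2) * \<psi> x0"
      using wq unfolding lhs rhs eq[OF \<psi>] .
    then show ?thesis by (simp add: algebra_simps)
  qed

  obtain e :: "nat \<Rightarrow> real \<Rightarrow> 'a" where e: "\<And>k. test_fun (e k)"
    "\<And>j k. nth_deriv j (e k) x0 = (if j = k then 1 else 0)"
    using test_monomial[of x0] by metis
  have e0: "e k x0 = (if k = 0 then 1 else 0)" for k using e(2)[of 0 k] by auto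
  have "of_real ((A + B) / 2) \<noteq> (0 :: 'a)" unfolding of_real_eq_0_iff using A B by simp
  then have c0: "c 0 = 0" using jump[OF e(1)[of 2]] by (simp add: e(2) e0)
  have KLR: "KL x0 = KR x0" using jump[OF e(1)[of 1]] by (simp add: e(2) e0)
  have "- KL1 x0 = KR1 x0" using jump[OF e(1)[of 0]] by (simp add: e(2) e0 c0)
  then have KLR1: "KL1 x0 = - KR1 x0" by (metis minus_minus)
  have lim: "(v \<longlongrightarrow> fL x0) (at_left x0)" "(v' \<longlongrightarrow> fL' x0) (at_left x0)"
    "(v \<longlongrightarrow> fR x0) (at_right x0)" "(v' \<longlongrightarrow> fR' x0) (at_right x0)"
  proof -
    have t: "(fL \<longlongrightarrow> fL x0) (at_left x0)" "(fL' \<longlongrightarrow> fL' x0) (at_left x0)"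
      "(fR \<longlongrightarrow> fR x0) (at_right x0)" "(fR' \<longlongrightarrow> fR' x0) (at_right x0)"
      using cf[of UNIV] by (auto simp: continuous_on_eq_continuous_at isCont_def intro: tendsto_within_subset)
    show "(v \<longlongrightarrow> fL x0) (at_left x0)" "(v' \<longlongrightarrow> fL' x0) (at_left x0)"
      by (rule Lim_transform_eventually[OF t(1)] Lim_transform_eventually[OF t(2)],
          simp add: eventually_at_filter v_def v'_def)+
    show "(v \<longlongrightarrow> fR x0) (at_right x0)" "(v' \<longlongrightarrow> fR' x0) (at_right x0)"
      by (rule Lim_transform_eventually[OF t(3)] Lim_transform_eventually[OF t(4)],
          simp add: eventually_at_filter v_def v'_def)+
  qed
  show ?thesis
  proof (rule that[OF iv _ dv _ lim(1,3,2,4)])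
    show "dist_eq u (regular_dist v)" using rep0 by (simp add: dist_eq_def regular_dist_def c0)
    show "continuous_on (- {x0}) v'" using contv by (auto intro: continuous_at_imp_continuous_on)
    show "A *\<^sub>R fL x0 = B *\<^sub>R fR x0" using A B KLR by (simp add: fL_def fR_def)
    show "A *\<^sub>R fL' x0 = B *\<^sub>R fR' x0" using A B KLR1 by (simp add: fL'_def fR'_def)
  qed
qed

lemma integrable_imp_locally_integrable: "integrable lebesgue f \<Longrightarrow> locally_integrable f"
  unfolding locally_integrable_def set_integrable_def
  by (auto intro!: integrable_mult_indicator simp: sets_completionI_sets borel_compact)

theorem theorem4p2:
  fixes A B x0 P1 P2 :: real
    and g :: "real \<Rightarrow> 'a::{real_normed_field, euclidean_space}"
  assumes "A > 0" and "B > 0" and "A \<noteq> B" and "0 < x0" and "x0 < 1"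
    and "g absolutely_integrable_on {0..1}"
  shows "(\<forall>u. is_solution A B x0 P1 P2 g u \<longrightarrow>
            (\<exists>f. locally_integrable f \<and> dist_eq u (regular_dist f))) \<and>
         (\<forall>f. locally_integrable f \<longrightarrow> is_solution A B x0 P1 P2 g (regular_dist f) \<longrightarrow>
            (\<exists>v v'. (AE x in lebesgue. f x = v x) \<and>
               (\<forall>x \<in> {0..1} - {x0}.
                  (v has_vector_derivative v' x) (at x within {0..1} - {x0})) \<and>
               continuous_on ({0..1} - {x0}) v' \<and>
               (\<exists>l r l' r'.
                  (v \<longlongrightarrow> l) (at_left x0) \<and> (v \<longlongrightarrow> r) (at_right x0) \<and>
                  (v' \<longlongrightarrow> l') (at_left x0) \<and> (v' \<longlongrightarrow> r') (at_right x0) \<and>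
                  (l \<noteq> r \<or> (l = 0 \<and> r = 0)) \<and>
                  A *\<^sub>R l = B *\<^sub>R r \<and> A *\<^sub>R l' = B *\<^sub>R r')))"
proof (intro conjI allI impI)
  fix u :: "'a functional" assume "is_solution A B x0 P1 P2 g u"
  from solution_structure[OF assms this]
  show "\<exists>f. locally_integrable f \<and> dist_eq u (regular_dist f)"
    using integrable_imp_locally_integrable by metis
next
  fix f :: "real \<Rightarrow> 'a"
  assume f: "locally_integrable f" and sol: "is_solution A B x0 P1 P2 g (regular_dist f)"
  obtain v v' l r l' r' where v: "integrable lebesgue v" "dist_eq (regular_dist f) (regular_dist v)"
    and dv: "\<And>x. x \<noteq> x0 \<Longrightarrow> (v has_vector_derivative v' x) (at x)" and cv': "continuous_on (- {x0}) v'"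
    and lim: "(v \<longlongrightarrow> l) (at_left x0)" "(v \<longlongrightarrow> r) (at_right x0)"
      "(v' \<longlongrightarrow> l') (at_left x0)" "(v' \<longlongrightarrow> r') (at_right x0)"
    and jump: "A *\<^sub>R l = B *\<^sub>R r" "A *\<^sub>R l' = B *\<^sub>R r'"
    by (rule solution_structure[OF assms sol], rule that)
  have "AE x in lebesgue. f x - v x = 0"
  proof (rule du_Bois_Reymond)
    show "locally_integrable (\<lambda>x. f x - v x)"
      using f integrable_imp_locally_integrable[OF v(1)] unfolding locally_integrable_def
      by (auto intro: set_integral_diff)
    fix \<psi> :: "real \<Rightarrow> 'a" assume \<psi>: "test_fun \<psi>"
    have int: "integrable lebesgue (\<lambda>x. h x * \<psi> x)" if h: "locally_integrable h" for h
    proof -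
      obtain R where "R > 0" and R: "\<And>x n. \<bar>x\<bar> > R \<Longrightarrow> nth_deriv n \<psi> x = 0" using test_fun_radius[OF \<psi>] by metis
      obtain M where M: "\<And>x. norm (\<psi> x) \<le> M" using test_fun_bounded[OF \<psi>, of 0] by (metis nth_deriv_0)
      have "integrable lebesgue (\<lambda>x. indicator {-R..R} x *\<^sub>R h x)"
        using h unfolding locally_integrable_def set_integrable_def by blast
      then have "integrable lebesgue (\<lambda>x. \<psi> x * (indicator {-R..R} x *\<^sub>R h x))"
        by (intro bounded_times_test_integrable[OF _ M] continuous_measurable_lebesgue smooth_continuous test_fun_smooth \<psi>)
      also have "(\<lambda>x. \<psi> x * (indicator {-R..R} x *\<^sub>R h x)) = (\<lambda>x. h x * \<psi> x)"
      proof
        fix x show "\<psi> x * (indicator {-R..R} x *\<^sub>R h x) = h x * \<psi> x"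
          using R[of x 0] by (cases "\<bar>x\<bar> > R") (auto simp: indicator_def)
      qed
      finally show ?thesis .
    qed
    have "(LINT x|lebesgue. (f x - v x) * \<psi> x) = (LINT x|lebesgue. f x * \<psi> x) - (LINT x|lebesgue. v x * \<psi> x)"
      unfolding left_diff_distrib
      by (intro Bochner_Integration.integral_diff int f integrable_imp_locally_integrable v(1))
    then show "(LINT x|lebesgue. (f x - v x) * \<psi> x) = 0"
      using v(2) \<psi> by (simp add: dist_eq_def regular_dist_def)
  qed
  then have "AE x in lebesgue. f x = v x" by simp
  moreover have "(v has_vector_derivative v' x) (at x within {0..1} - {x0})" if "x \<in> {0..1} - {x0}" for x
    using dv[of x] that by (auto intro: has_vector_derivative_at_within)
  moreover have "continuous_on ({0..1} - {x0}) v'" by (rule continuous_on_subset[OF cv']) auto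
  moreover have "l \<noteq> r \<or> (l = 0 \<and> r = 0)"
  proof (rule disjCI)
    assume "\<not> (l = 0 \<and> r = 0)"
    then show "l \<noteq> r" using jump(1) \<open>A \<noteq> B\<close> by auto
  qed
  ultimately show "\<exists>v v'. (AE x in lebesgue. f x = v x) \<and>
               (\<forall>x \<in> {0..1} - {x0}.
                  (v has_vector_derivative v' x) (at x within {0..1} - {x0})) \<and>
               continuous_on ({0..1} - {x0}) v' \<and>
               (\<exists>l r l' r'.
                  (v \<longlongrightarrow> l) (at_left x0) \<and> (v \<longlongrightarrow> r) (at_right x0) \<and>
                  (v' \<longlongrightarrow> l') (at_left x0) \<and> (v' \<longlongrightarrow> r') (at_right x0) \<and>
                  (l \<noteq> r \<or> (l = 0 \<and> r = 0)) \<and>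
                  A *\<^sub>R l = B *\<^sub>R r \<and> A *\<^sub>R l' = B *\<^sub>R r')"
    using lim jump by blast
qed

end
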